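(* Let $G$ be a finitely generated group that has the $b_2/b_1$ property with respect to the prime $p$. Suppose that $$\sup \{ b_1(G_i;\mathbb{F}_p) : G_i \text{ is a finite index subgroup of } G \} = \infty.$$ Then $G$ has a nested sequence of finite index subgroups $G\triangleright G_1\triangleright G_2\triangleright\dots$, where each $G_i$ is normal in $G_{i-1}$ (with $G_0=G$), such that, for some $k>0$, $$b_1(G_i;\mathbb{F}_p)=\Omega\left([G:G_i]^k\right).$$
   Context: For a prime $p$, $\mathbb{F}_p$ is the field of order $p$, and for $r=1,2$, $b_r(G;\mathbb{F}_p)$ denotes the dimension over $\mathbb{F}_p$ of the group homology $H_r(G;\mathbb{F}_p)$. A group $G$ has the $b_2/b_1$ property with respect to the prime $p$ if there is a uniform upper bound on $\dfrac{b_2(G_i;\mathbb{F}_p)}{b_1(G_i;\mathbb{F}_p)+1}$ as $G_i$ ranges over all finite index subgroups of $G$. For sequences $f_i$ and $g_i$, $f_i=\Omega(g_i)$ means that $f_i/g_i\to\infty$ as $i\to\infty$. *)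

theory Defs
  imports
    "HOL-Algebra.Generated_Groups"
    "HOL-Number_Theory.Residues"
    "HOL-Library.Extended_Real"
    "Jordan_Normal_Form.Missing_VectorSpace"
begin

section \<open>Quotients and dimensions of vector spaces\<close>

text \<open>The multiplicative part of a \<^typ>\<open>('k, 'v) module\<close> record is irrelevant for a module.\<close>

definition quotient_module :: "('k, 'v) module \<Rightarrow> 'v set \<Rightarrow> ('k, 'v set) module" where
  "quotient_module V W =
     \<lparr>carrier = a_rcosets\<^bsub>V\<^esub> W,
      monoid.mult = (\<lambda>_ _. undefined), one = undefined,
      zero = W,
      add = (\<lambda>A B. A <+>\<^bsub>V\<^esub> B),
      smult = (\<lambda>c A. \<Union>x\<in>A. W +>\<^bsub>V\<^esub> (c \<odot>\<^bsub>V\<^esub> x))\<rparr>"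

text \<open>\<^const>\<open>vectorspace.dim\<close> is meaningful only for finite-dimensional spaces.\<close>

definition edim :: "'k ring \<Rightarrow> ('k, 'v) module \<Rightarrow> enat" where
  "edim K V = (if vectorspace.fin_dim K V then enat (vectorspace.dim K V) else \<infinity>)"

section \<open>Group homology with trivial coefficients\<close>

text \<open>
  Homology is computed by the inhomogeneous bar complex. The space of \<open>n\<close>-chains is the free
  \<open>K\<close>-module on the tuples \<open>[g\<^sub>1|...|g\<^sub>n]\<close>, here lists of length \<open>n\<close> over the group; a chain is a
  finitely supported coefficient function. The boundary of a generator is
  \<open>[g\<^sub>2|...|g\<^sub>n] + (\<Sum>0<i<n. (-1)^i [g\<^sub>1|...|g\<^sub>i g\<^sub>i\<^sub>+\<^sub>1|...|g\<^sub>n]) + (-1)^n [g\<^sub>1|...|g\<^sub>n\<^sub>-\<^sub>1]\<close>.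
\<close>

definition bar_chains :: "'k ring \<Rightarrow> 'g monoid \<Rightarrow> nat \<Rightarrow> ('k, 'g list \<Rightarrow> 'k) module" where
  "bar_chains K G n =
     \<lparr>carrier = {f. range f \<subseteq> carrier K \<and> finite {x. f x \<noteq> \<zero>\<^bsub>K\<^esub>} \<and>
                    {x. f x \<noteq> \<zero>\<^bsub>K\<^esub>} \<subseteq> {x. length x = n \<and> set x \<subseteq> carrier G}},
      monoid.mult = (\<lambda>_ _. undefined), one = undefined,
      zero = (\<lambda>_. \<zero>\<^bsub>K\<^esub>),
      add = (\<lambda>f g x. f x \<oplus>\<^bsub>K\<^esub> g x),
      smult = (\<lambda>c f x. c \<otimes>\<^bsub>K\<^esub> f x)\<rparr>"

definition bar_generator :: "'k ring \<Rightarrow> 'g list \<Rightarrow> 'g list \<Rightarrow> 'k" where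
  "bar_generator K x = (\<lambda>y. if y = x then \<one>\<^bsub>K\<^esub> else \<zero>\<^bsub>K\<^esub>)"

text \<open>List positions start at 0, so \<open>g\<^sub>i\<close> and \<open>g\<^sub>i\<^sub>+\<^sub>1\<close> are \<open>x ! (i - 1)\<close> and \<open>x ! i\<close>.\<close>

definition bar_face :: "'g monoid \<Rightarrow> nat \<Rightarrow> 'g list \<Rightarrow> 'g list" where
  "bar_face G i x =
     (if i = 0 then tl x
      else if i = length x then butlast x
      else take (i - 1) x @ [x ! (i - 1) \<otimes>\<^bsub>G\<^esub> x ! i] @ drop (i + 1) x)"

text \<open>The boundary map from \<open>(n+1)\<close>-chains to \<open>n\<close>-chains.\<close>

definition bar_boundary ::
    "'k ring \<Rightarrow> 'g monoid \<Rightarrow> nat \<Rightarrow> ('g list \<Rightarrow> 'k) \<Rightarrow> 'g list \<Rightarrow> 'k" where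
  "bar_boundary K G n f =
     (\<Oplus>\<^bsub>bar_chains K G n\<^esub> x \<in> {x. f x \<noteq> \<zero>\<^bsub>K\<^esub>}.
        f x \<odot>\<^bsub>bar_chains K G n\<^esub>
          (\<Oplus>\<^bsub>bar_chains K G n\<^esub> i \<in> {..n + 1}.
             (\<ominus>\<^bsub>K\<^esub> \<one>\<^bsub>K\<^esub>) [^]\<^bsub>K\<^esub> i \<odot>\<^bsub>bar_chains K G n\<^esub> bar_generator K (bar_face G i x)))"

fun bar_cycles :: "'k ring \<Rightarrow> 'g monoid \<Rightarrow> nat \<Rightarrow> ('g list \<Rightarrow> 'k) set" where
  "bar_cycles K G 0 = carrier (bar_chains K G 0)"
| "bar_cycles K G (Suc n) =
     {f \<in> carrier (bar_chains K G (Suc n)). bar_boundary K G n f = \<zero>\<^bsub>bar_chains K G n\<^esub>}"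

definition bar_boundaries :: "'k ring \<Rightarrow> 'g monoid \<Rightarrow> nat \<Rightarrow> ('g list \<Rightarrow> 'k) set" where
  "bar_boundaries K G n = bar_boundary K G n ` carrier (bar_chains K G (Suc n))"

definition group_homology ::
    "nat \<Rightarrow> 'g monoid \<Rightarrow> 'k ring \<Rightarrow> ('k, ('g list \<Rightarrow> 'k) set) module" where
  "group_homology r G K =
     quotient_module ((bar_chains K G r)\<lparr>carrier := bar_cycles K G r\<rparr>) (bar_boundaries K G r)"

text \<open>\<open>betti r p G\<close> is \<open>b\<^sub>r(G; F\<^sub>p)\<close>. It may be infinite, e.g. \<open>b\<^sub>2\<close> of a finitely generated group
  that is not finitely presented.\<close>

definition betti :: "nat \<Rightarrow> nat \<Rightarrow> 'g monoid \<Rightarrow> enat" where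
  "betti r p G = edim (residue_ring (int p)) (group_homology r G (residue_ring (int p)))"

section \<open>Finite index subgroups and the b2/b1 property\<close>

definition finitely_generated_group :: "'g monoid \<Rightarrow> bool" where
  "finitely_generated_group G \<longleftrightarrow>
     group G \<and> (\<exists>S. finite S \<and> S \<subseteq> carrier G \<and> generate G S = carrier G)"

definition subgroup_index :: "'g monoid \<Rightarrow> 'g set \<Rightarrow> nat" where
  "subgroup_index G H = card (rcosets\<^bsub>G\<^esub> H)"

definition finite_index_subgroups :: "'g monoid \<Rightarrow> 'g set set" where
  "finite_index_subgroups G = {H. subgroup H G \<and> finite (rcosets\<^bsub>G\<^esub> H)}"

text \<open>For finitely generated \<open>G\<close> the denominator below is finite, and an infinite \<open>b\<^sub>2\<close> makes the
  quotient infinite, so the property includes finiteness of every \<open>b\<^sub>2\<close>.\<close>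

definition b2_b1_property :: "nat \<Rightarrow> 'g monoid \<Rightarrow> bool" where
  "b2_b1_property p G \<longleftrightarrow>
     (\<exists>C::real. \<forall>H \<in> finite_index_subgroups G.
        ereal_of_enat (betti 2 p (G\<lparr>carrier := H\<rparr>)) /
          (ereal_of_enat (betti 1 p (G\<lparr>carrier := H\<rparr>)) + 1) \<le> ereal C)"

text \<open>\<open>f\<^sub>i = \<Omega>(g\<^sub>i)\<close> in the sense that \<open>f\<^sub>i / g\<^sub>i\<close> tends to infinity (not the Landau
  symbol of the same name for an asymptotic lower bound).\<close>

definition dominates :: "(nat \<Rightarrow> ereal) \<Rightarrow> (nat \<Rightarrow> ereal) \<Rightarrow> bool" where
  "dominates f g \<longleftrightarrow> (\<lambda>i. f i / g i) \<longlonglongrightarrow> \<infinity>"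

end

theory Submission
  imports Defs "HOL-Real_Asymp.Real_Asymp"
begin

text \<open>
  The subgroups are found by passing repeatedly to the joint kernel of a bounded number of
  homomorphisms to \<open>F\<^sub>p\<close>, each time at least doubling \<open>b\<^sub>1\<close>.

  \<^bold>\<open>One step.\<close> Let \<open>H\<close> have \<open>b\<^sub>1(H) = r\<close>, let \<open>x\<^sub>1, ..., x\<^sub>n\<close> be linearly independent
  homomorphisms \<open>H \<rightarrow> F\<^sub>p\<close>, and let \<open>N\<close> be their joint kernel, so that \<open>[H:N] \<le> p^n\<close>. Then
  \<open>b\<^sub>1(N) \<ge> n (r - n) - b\<^sub>2(H)\<close> (lemma \<open>betti_kernel_bound\<close>). To see this, complete the \<open>x\<^sub>i\<close>
  by \<open>y\<^sub>1, ..., y\<^sub>r\<^sub>-\<^sub>n\<close> to a basis of \<open>Hom(H, F\<^sub>p)\<close>. The cocycles \<open>\<alpha> = \<Sum> c\<^sub>i\<^sub>j (x\<^sub>i \<union> y\<^sub>j)\<close> form a space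
  of dimension \<open>n (r - n)\<close>, and those that are coboundaries form a subspace of codimension at most
  \<open>b\<^sub>2(H)\<close>. If \<open>\<alpha>\<close> is the coboundary of \<open>\<beta>\<close>, then \<open>\<beta>\<close> is a homomorphism on \<open>N\<close>, because \<open>x\<^sub>i\<close>
  vanishes there. This homomorphism determines \<open>c\<close>: for \<open>h \<in> N\<close>, evaluating \<open>\<beta>\<close> on
  \<open>g h = (g h g\<inverse>) g\<close> in two ways gives \<open>\<alpha>(g, h) = \<beta>(h) - \<beta>(g h g\<inverse>)\<close>, and both arguments on the
  right are in \<open>N\<close>.

  The b2/b1 property gives \<open>b\<^sub>2(H) \<le> c (b\<^sub>1(H) + 1)\<close>. For \<open>n = c + 3\<close> the bound above is at least
  \<open>2 r\<close> as soon as \<open>r\<close> exceeds a constant. Iterating yields subgroups with \<open>b\<^sub>1 \<ge> 2^i\<close> and index at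
  most a constant times \<open>p^(n i)\<close>; any exponent \<open>k\<close> with \<open>p^(n k) < 2\<close> then works. Should \<open>b\<^sub>1\<close> become
  infinite at some stage, the sequence is continued as a constant.

  \<^bold>\<open>The first step.\<close> The hypothesis provides a subgroup \<open>H\<close> with large \<open>b\<^sub>1\<close>, which need not be
  subnormal. It is replaced by its normal core \<open>N\<close>, and \<open>b\<^sub>1(N)\<close> cannot be small
  (lemma \<open>betti_finite_index_lower_bound\<close>): otherwise let \<open>P\<close> be minimal among the finitely many
  subgroups between \<open>N\<close> and \<open>H\<close> that have large \<open>b\<^sub>1\<close>. Restriction to \<open>N\<close> can only detect \<open>b\<^sub>1(N)\<close>
  dimensions of \<open>Hom(P, F\<^sub>p)\<close>, so there are \<open>n\<close> independent homomorphisms on \<open>P\<close> that vanish on \<open>N\<close>.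
  Their joint kernel contains \<open>N\<close>, is smaller than \<open>P\<close>, and has larger \<open>b\<^sub>1\<close> by the step above,
  which contradicts minimality.

  \<^bold>\<open>Translation from homology.\<close> Dimensions are compared by counting. A group with \<open>b\<^sub>1 = s\<close> has exactly
  \<open>p^s\<close> homomorphisms to \<open>F\<^sub>p\<close> (\<open>card_characters_le\<close>, \<open>card_characters_ge\<close>), and there are \<open>b\<^sub>2\<close>
  cycles such that two cocycles that agree on them are cohomologous (\<open>cocycles_cohomologous\<close>).
  Both rest on the existence of enough linear functionals on spaces of arbitrary dimension
  (\<open>separating_functional\<close>, by Zorn's lemma).
\<close>

section \<open>Linear functionals on vector spaces\<close>

text \<open>
  Linear functionals on \<open>V\<close> that vanish on \<open>W\<close>, with arbitrary values outside \<open>carrier V\<close>.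
  The case \<open>W = {}\<close> gives all linear functionals.
\<close>

definition annihilator :: "('k, 'm) ring_scheme \<Rightarrow> ('k, 'v, 'e) module_scheme \<Rightarrow> 'v set \<Rightarrow> ('v \<Rightarrow> 'k) set" where
  "annihilator K V W =
     {f. (\<forall>v\<in>carrier V. f v \<in> carrier K) \<and>
         (\<forall>u\<in>carrier V. \<forall>v\<in>carrier V. f (u \<oplus>\<^bsub>V\<^esub> v) = f u \<oplus>\<^bsub>K\<^esub> f v) \<and>
         (\<forall>c\<in>carrier K. \<forall>v\<in>carrier V. f (c \<odot>\<^bsub>V\<^esub> v) = c \<otimes>\<^bsub>K\<^esub> f v) \<and>
         (\<forall>w\<in>W. f w = \<zero>\<^bsub>K\<^esub>)}"

lemma annihilatorI:
  assumes "\<And>v. v \<in> carrier V \<Longrightarrow> f v \<in> carrier K"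
    and "\<And>u v. u \<in> carrier V \<Longrightarrow> v \<in> carrier V \<Longrightarrow> f (u \<oplus>\<^bsub>V\<^esub> v) = f u \<oplus>\<^bsub>K\<^esub> f v"
    and "\<And>c v. c \<in> carrier K \<Longrightarrow> v \<in> carrier V \<Longrightarrow> f (c \<odot>\<^bsub>V\<^esub> v) = c \<otimes>\<^bsub>K\<^esub> f v"
    and "\<And>w. w \<in> W \<Longrightarrow> f w = \<zero>\<^bsub>K\<^esub>"
  shows "f \<in> annihilator K V W"
  using assms by (simp add: annihilator_def)

lemma annihilatorD:
  assumes "f \<in> annihilator K V W"
  shows "\<And>v. v \<in> carrier V \<Longrightarrow> f v \<in> carrier K"
    and "\<And>u v. u \<in> carrier V \<Longrightarrow> v \<in> carrier V \<Longrightarrow> f (u \<oplus>\<^bsub>V\<^esub> v) = f u \<oplus>\<^bsub>K\<^esub> f v"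
    and "\<And>c v. c \<in> carrier K \<Longrightarrow> v \<in> carrier V \<Longrightarrow> f (c \<odot>\<^bsub>V\<^esub> v) = c \<otimes>\<^bsub>K\<^esub> f v"
    and "\<And>w. w \<in> W \<Longrightarrow> f w = \<zero>\<^bsub>K\<^esub>"
  using assms by (simp_all add: annihilator_def)

lemma annihilator_antimono: "U \<subseteq> W \<Longrightarrow> annihilator K V W \<subseteq> annihilator K V U"
  by (auto simp: annihilator_def)

context vectorspace
begin

lemma submoduleI_vs:
  assumes "N \<subseteq> carrier V" "\<zero>\<^bsub>V\<^esub> \<in> N"
    and "\<And>v w. v \<in> N \<Longrightarrow> w \<in> N \<Longrightarrow> v \<oplus>\<^bsub>V\<^esub> w \<in> N"
    and "\<And>c v. c \<in> carrier K \<Longrightarrow> v \<in> N \<Longrightarrow> c \<odot>\<^bsub>V\<^esub> v \<in> N"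
  shows "submodule K N V"
  using assms module_axioms by (auto intro!: submodule.intro)

lemma submodule_minus_closed:
  assumes "submodule K N V" "v \<in> N" shows "\<ominus>\<^bsub>V\<^esub> v \<in> N"
proof -
  have "v \<in> carrier V" using assms by (auto dest: submodule.subset)
  then have "\<ominus>\<^bsub>V\<^esub> v = (\<ominus>\<^bsub>K\<^esub> \<one>\<^bsub>K\<^esub>) \<odot>\<^bsub>V\<^esub> v" by (simp add: smult_minus_1)
  then show ?thesis using assms by (simp add: submodule.smult_closed)
qed

lemma annihilator_lincomb:
  assumes "f \<in> annihilator K V W" "g \<in> annihilator K V W" "c \<in> carrier K" "W \<subseteq> carrier V"
  shows "(\<lambda>v. f v \<oplus>\<^bsub>K\<^esub> c \<otimes>\<^bsub>K\<^esub> g v) \<in> annihilator K V W"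
proof (rule annihilatorI)
  note F = annihilatorD[OF assms(1)] and G = annihilatorD[OF assms(2)]
  fix u v assume uv: "u \<in> carrier V" "v \<in> carrier V"
  show "f (u \<oplus>\<^bsub>V\<^esub> v) \<oplus>\<^bsub>K\<^esub> c \<otimes>\<^bsub>K\<^esub> g (u \<oplus>\<^bsub>V\<^esub> v) = f u \<oplus>\<^bsub>K\<^esub> c \<otimes>\<^bsub>K\<^esub> g u \<oplus>\<^bsub>K\<^esub> (f v \<oplus>\<^bsub>K\<^esub> c \<otimes>\<^bsub>K\<^esub> g v)"
    using uv F(1)[OF uv(1)] F(1)[OF uv(2)] G(1)[OF uv(1)] G(1)[OF uv(2)] assms(3)
    by (simp add: F(2) G(2) R.r_distr R.a_ac)
next
  note F = annihilatorD[OF assms(1)] and G = annihilatorD[OF assms(2)]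
  fix d v assume uv: "d \<in> carrier K" "v \<in> carrier V"
  show "f (d \<odot>\<^bsub>V\<^esub> v) \<oplus>\<^bsub>K\<^esub> c \<otimes>\<^bsub>K\<^esub> g (d \<odot>\<^bsub>V\<^esub> v) = d \<otimes>\<^bsub>K\<^esub> (f v \<oplus>\<^bsub>K\<^esub> c \<otimes>\<^bsub>K\<^esub> g v)"
    using uv F(1)[OF uv(2)] G(1)[OF uv(2)] assms(3)
    by (simp add: F(3) G(3) R.r_distr R.m_lcomm)
qed (use annihilatorD[OF assms(1)] annihilatorD[OF assms(2)] assms(3,4) in auto)

text \<open>
  A maximal subspace \<open>M\<close> that contains \<open>U\<close> and avoids \<open>v\<close> is a hyperplane with \<open>V = M \<oplus> Kv\<close>, and
  the coordinate along \<open>v\<close> is the functional.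
\<close>

lemma separating_functional:
  assumes U: "submodule K U V" and v: "v \<in> carrier V" "v \<notin> U"
  obtains f where "f \<in> annihilator K V U" "f v = \<one>\<^bsub>K\<^esub>"
proof -
  define \<A> where "\<A> = {M. submodule K M V \<and> U \<subseteq> M \<and> v \<notin> M}"
  have "\<exists>M\<in>\<A>. \<forall>X\<in>\<A>. M \<subseteq> X \<longrightarrow> X = M"
  proof (rule subset_Zorn_nonempty)
    show "\<A> \<noteq> {}" using U v by (auto simp: \<A>_def)
    fix \<C> assume C: "\<C> \<noteq> {}" "subset.chain \<A> \<C>"
    have CA: "X \<in> \<A>" if "X \<in> \<C>" for X using C that by (auto simp: subset.chain_def)
    have sub: "submodule K X V" if "X \<in> \<C>" for X using CA[OF that] by (simp add: \<A>_def)
    obtain X0 where X0: "X0 \<in> \<C>" using C by auto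
    have "submodule K (\<Union>\<C>) V"
    proof (rule submoduleI_vs)
      show "\<Union>\<C> \<subseteq> carrier V" using sub by (auto dest: submodule.subset)
      show "\<zero>\<^bsub>V\<^esub> \<in> \<Union>\<C>" using sub X0 by (auto dest: submodule.zero_closed)
    next
      fix x y assume "x \<in> \<Union>\<C>" "y \<in> \<Union>\<C>"
      then obtain X Y where XY: "X \<in> \<C>" "x \<in> X" "Y \<in> \<C>" "y \<in> Y" by auto
      have "X \<subseteq> Y \<or> Y \<subseteq> X" using C(2) XY by (auto simp: subset.chain_def)
      then obtain Z where "Z \<in> \<C>" "x \<in> Z" "y \<in> Z" using XY by blast
      then show "x \<oplus>\<^bsub>V\<^esub> y \<in> \<Union>\<C>" using sub[of Z] by (auto dest: submodule.m_closed)
    next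
      fix c x assume "c \<in> carrier K" "x \<in> \<Union>\<C>"
      then show "c \<odot>\<^bsub>V\<^esub> x \<in> \<Union>\<C>" using sub by (auto dest: submodule.smult_closed)
    qed
    moreover have "U \<subseteq> \<Union>\<C>" "v \<notin> \<Union>\<C>" using CA X0 by (auto simp: \<A>_def)
    ultimately show "\<Union>\<C> \<in> \<A>" by (simp add: \<A>_def)
  qed
  then obtain M where M: "M \<in> \<A>" and maxM: "\<And>X. X \<in> \<A> \<Longrightarrow> M \<subseteq> X \<Longrightarrow> X = M" by blast
  have Ms: "submodule K M V" and UM: "U \<subseteq> M" and vM: "v \<notin> M" using M by (auto simp: \<A>_def)
  note Mc = submodule.m_closed[OF Ms] submodule.smult_closed[OF Ms] submodule.zero_closed[OF Ms]
    submodule_minus_closed[OF Ms]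
  have MV: "x \<in> carrier V" if "x \<in> M" for x using Ms that by (auto dest: submodule.subset)
  have inv: "inv\<^bsub>K\<^esub> c \<in> carrier K" "inv\<^bsub>K\<^esub> c \<otimes>\<^bsub>K\<^esub> c = \<one>\<^bsub>K\<^esub>" if "c \<in> carrier K" "c \<noteq> \<zero>\<^bsub>K\<^esub>" for c
    using that field.field_Units by auto
  have ex: "\<exists>a\<in>carrier K. \<exists>m\<in>M. u = m \<oplus>\<^bsub>V\<^esub> a \<odot>\<^bsub>V\<^esub> v" if u: "u \<in> carrier V" for u
  proof (cases "u \<in> M")
    case True
    then show ?thesis using v(1) u by (intro bexI[of _ "\<zero>\<^bsub>K\<^esub>"] bexI[of _ u]) auto
  next
    case False
    define M' where "M' = {m \<oplus>\<^bsub>V\<^esub> c \<odot>\<^bsub>V\<^esub> u | m c. m \<in> M \<and> c \<in> carrier K}"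
    have "submodule K M' V"
    proof (rule submoduleI_vs)
      show "M' \<subseteq> carrier V" using MV u by (auto simp: M'_def)
      show "\<zero>\<^bsub>V\<^esub> \<in> M'" unfolding M'_def using Mc(3) u
        by (auto intro!: exI[of _ "\<zero>\<^bsub>V\<^esub>"] exI[of _ "\<zero>\<^bsub>K\<^esub>"])
    next
      fix x y assume "x \<in> M'" "y \<in> M'"
      then obtain m c n d where *: "m \<in> M" "c \<in> carrier K" "x = m \<oplus>\<^bsub>V\<^esub> c \<odot>\<^bsub>V\<^esub> u"
        "n \<in> M" "d \<in> carrier K" "y = n \<oplus>\<^bsub>V\<^esub> d \<odot>\<^bsub>V\<^esub> u" by (auto simp: M'_def)
      have "x \<oplus>\<^bsub>V\<^esub> y = (m \<oplus>\<^bsub>V\<^esub> n) \<oplus>\<^bsub>V\<^esub> (c \<oplus>\<^bsub>K\<^esub> d) \<odot>\<^bsub>V\<^esub> u"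
        using * MV[OF *(1)] MV[OF *(4)] u by (simp add: smult_l_distr M.a_ac)
      then show "x \<oplus>\<^bsub>V\<^esub> y \<in> M'" using * Mc(1) by (auto simp: M'_def)
    next
      fix e x assume e: "e \<in> carrier K" and "x \<in> M'"
      then obtain m c where *: "m \<in> M" "c \<in> carrier K" "x = m \<oplus>\<^bsub>V\<^esub> c \<odot>\<^bsub>V\<^esub> u" by (auto simp: M'_def)
      have "e \<odot>\<^bsub>V\<^esub> x = e \<odot>\<^bsub>V\<^esub> m \<oplus>\<^bsub>V\<^esub> (e \<otimes>\<^bsub>K\<^esub> c) \<odot>\<^bsub>V\<^esub> u"
        using * MV[OF *(1)] u e by (simp add: smult_r_distr smult_assoc1)
      then show "e \<odot>\<^bsub>V\<^esub> x \<in> M'" using * Mc(2) e by (auto simp: M'_def)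
    qed
    moreover have MM': "M \<subseteq> M'"
    proof
      fix x assume "x \<in> M"
      then show "x \<in> M'" unfolding M'_def using u MV by (auto intro!: exI[of _ x] exI[of _ "\<zero>\<^bsub>K\<^esub>"])
    qed
    moreover have "u \<in> M'" unfolding M'_def using u Mc(3)
      by (auto intro!: exI[of _ "\<zero>\<^bsub>V\<^esub>"] exI[of _ "\<one>\<^bsub>K\<^esub>"])
    ultimately have "v \<in> M'" using maxM[of M'] False UM by (auto simp: \<A>_def)
    then obtain m c where *: "m \<in> M" "c \<in> carrier K" "v = m \<oplus>\<^bsub>V\<^esub> c \<odot>\<^bsub>V\<^esub> u" by (auto simp: M'_def)
    \<comment> \<open>\<open>v\<close> is a combination of an element of \<open>M\<close> and \<open>u\<close>; solve for \<open>u\<close>.\<close>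
    have "c \<noteq> \<zero>\<^bsub>K\<^esub>" using vM * u MV by auto
    note i = inv[OF *(2) this]
    let ?w = "inv\<^bsub>K\<^esub> c \<odot>\<^bsub>V\<^esub> m"
    have w: "?w \<in> M" using i Mc(2) * by auto
    have "inv\<^bsub>K\<^esub> c \<odot>\<^bsub>V\<^esub> v = ?w \<oplus>\<^bsub>V\<^esub> u"
      using *(2) MV[OF *(1)] u i by (simp add: *(3) smult_r_distr flip: smult_assoc1)
    then have "u = \<ominus>\<^bsub>V\<^esub> ?w \<oplus>\<^bsub>V\<^esub> inv\<^bsub>K\<^esub> c \<odot>\<^bsub>V\<^esub> v"
      using u MV[OF w] by (simp add: M.r_neg1)
    then show ?thesis using i Mc(4)[OF w] by blast
  qed
  have uniq: "a = b" if "a \<in> carrier K" "b \<in> carrier K" "m \<in> M" "n \<in> M"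
    "m \<oplus>\<^bsub>V\<^esub> a \<odot>\<^bsub>V\<^esub> v = n \<oplus>\<^bsub>V\<^esub> b \<odot>\<^bsub>V\<^esub> v" for a b m n
  proof (rule ccontr)
    assume "a \<noteq> b"
    let ?c = "a \<ominus>\<^bsub>K\<^esub> b"
    have c: "?c \<in> carrier K" "?c \<noteq> \<zero>\<^bsub>K\<^esub>" using that \<open>a \<noteq> b\<close> by auto
    note cs = MV[OF that(3)] MV[OF that(4)] that(1,2) v(1)
    have "?c \<odot>\<^bsub>V\<^esub> v = a \<odot>\<^bsub>V\<^esub> v \<oplus>\<^bsub>V\<^esub> \<ominus>\<^bsub>V\<^esub> (b \<odot>\<^bsub>V\<^esub> v)"
      using cs by (simp add: a_minus_def smult_l_distr smult_l_minus)
    also have "a \<odot>\<^bsub>V\<^esub> v = \<ominus>\<^bsub>V\<^esub> m \<oplus>\<^bsub>V\<^esub> (m \<oplus>\<^bsub>V\<^esub> a \<odot>\<^bsub>V\<^esub> v)"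
      using cs by (simp add: M.r_neg1)
    also have "\<dots> = \<ominus>\<^bsub>V\<^esub> m \<oplus>\<^bsub>V\<^esub> (n \<oplus>\<^bsub>V\<^esub> b \<odot>\<^bsub>V\<^esub> v)" using that(5) by simp
    also have "\<dots> \<oplus>\<^bsub>V\<^esub> \<ominus>\<^bsub>V\<^esub> (b \<odot>\<^bsub>V\<^esub> v) = \<ominus>\<^bsub>V\<^esub> m \<oplus>\<^bsub>V\<^esub> n"
      using cs by (simp add: M.a_assoc M.r_neg)
    finally have "?c \<odot>\<^bsub>V\<^esub> v \<in> M" using that Mc by auto
    then have "inv\<^bsub>K\<^esub> ?c \<odot>\<^bsub>V\<^esub> (?c \<odot>\<^bsub>V\<^esub> v) \<in> M" using Mc(2) inv[OF c] by blast
    then show False using vM inv[OF c] c v(1) by (simp flip: smult_assoc1)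
  qed
  define f where "f u = (THE a. a \<in> carrier K \<and> (\<exists>m\<in>M. u = m \<oplus>\<^bsub>V\<^esub> a \<odot>\<^bsub>V\<^esub> v))" for u
  have fI: "f u = a" if "a \<in> carrier K" "m \<in> M" "u = m \<oplus>\<^bsub>V\<^esub> a \<odot>\<^bsub>V\<^esub> v" for u a m
    unfolding f_def using that uniq by (intro the_equality) blast+
  have fE: "\<exists>m\<in>M. u = m \<oplus>\<^bsub>V\<^esub> f u \<odot>\<^bsub>V\<^esub> v \<and> f u \<in> carrier K" if "u \<in> carrier V" for u
    using ex[OF that] fI by metis
  have f0: "f x = \<zero>\<^bsub>K\<^esub>" if "x \<in> M" for x using that v MV by (intro fI[of _ x]) auto
  have "f \<in> annihilator K V U"
  proof (rule annihilatorI)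
    show "f u \<in> carrier K" if "u \<in> carrier V" for u using fE[OF that] by blast
    show "f w = \<zero>\<^bsub>K\<^esub>" if "w \<in> U" for w using that f0 UM by auto
  next
    fix x y assume xy: "x \<in> carrier V" "y \<in> carrier V"
    obtain m where m: "m \<in> M" "x = m \<oplus>\<^bsub>V\<^esub> f x \<odot>\<^bsub>V\<^esub> v" "f x \<in> carrier K" using fE[OF xy(1)] by blast
    obtain n where n: "n \<in> M" "y = n \<oplus>\<^bsub>V\<^esub> f y \<odot>\<^bsub>V\<^esub> v" "f y \<in> carrier K" using fE[OF xy(2)] by blast
    have "(m \<oplus>\<^bsub>V\<^esub> f x \<odot>\<^bsub>V\<^esub> v) \<oplus>\<^bsub>V\<^esub> (n \<oplus>\<^bsub>V\<^esub> f y \<odot>\<^bsub>V\<^esub> v) = (m \<oplus>\<^bsub>V\<^esub> n) \<oplus>\<^bsub>V\<^esub> (f x \<oplus>\<^bsub>K\<^esub> f y) \<odot>\<^bsub>V\<^esub> v"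
      using m(1,3) n(1,3) v(1) MV by (simp add: smult_l_distr M.a_ac)
    then show "f (x \<oplus>\<^bsub>V\<^esub> y) = f x \<oplus>\<^bsub>K\<^esub> f y"
      using m n Mc(1) by (intro fI[of _ "m \<oplus>\<^bsub>V\<^esub> n"]) auto
  next
    fix c x assume cx: "c \<in> carrier K" "x \<in> carrier V"
    obtain m where m: "m \<in> M" "x = m \<oplus>\<^bsub>V\<^esub> f x \<odot>\<^bsub>V\<^esub> v" "f x \<in> carrier K" using fE[OF cx(2)] by blast
    have "c \<odot>\<^bsub>V\<^esub> (m \<oplus>\<^bsub>V\<^esub> f x \<odot>\<^bsub>V\<^esub> v) = c \<odot>\<^bsub>V\<^esub> m \<oplus>\<^bsub>V\<^esub> (c \<otimes>\<^bsub>K\<^esub> f x) \<odot>\<^bsub>V\<^esub> v"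
      using m(1,3) cx v(1) MV by (simp add: smult_r_distr smult_assoc1)
    then show "f (c \<odot>\<^bsub>V\<^esub> x) = c \<otimes>\<^bsub>K\<^esub> f x"
      using m cx Mc(2) by (intro fI[of _ "c \<odot>\<^bsub>V\<^esub> m"]) auto
  qed
  moreover have "f v = \<one>\<^bsub>K\<^esub>" using v Mc by (intro fI[of _ "\<zero>\<^bsub>V\<^esub>"]) auto
  ultimately show thesis using that by blast
qed

end

section \<open>Quotient spaces and their dimension\<close>

locale quotient_space = vectorspace K V for K :: "'k ring" and V :: "('k, 'v) module" +
  fixes W :: "'v set"
  assumes W: "submodule K W V"
begin

abbreviation Q where "Q \<equiv> quotient_module V W"
abbreviation cls where "cls v \<equiv> W +>\<^bsub>V\<^esub> v"

lemma W_in_carrier: "w \<in> W \<Longrightarrow> w \<in> carrier V"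
  using W by (auto dest: submodule.subset)

lemma W_subgroup: "abelian_subgroup W V"
proof (rule abelian_subgroupI3)
  show "additive_subgroup W V"
  proof (intro additive_subgroup.intro subgroup.intro)
    show "W \<subseteq> carrier (add_monoid V)" using W_in_carrier by auto
    show "\<one>\<^bsub>add_monoid V\<^esub> \<in> W" using submodule.zero_closed[OF W] by simp
    show "\<And>x y. x \<in> W \<Longrightarrow> y \<in> W \<Longrightarrow> x \<otimes>\<^bsub>add_monoid V\<^esub> y \<in> W" using submodule.m_closed[OF W] by simp
    show "\<And>x. x \<in> W \<Longrightarrow> inv\<^bsub>add_monoid V\<^esub> x \<in> W"
      using submodule_minus_closed[OF W] by (simp add: a_inv_def)
  qed
qed (rule M.abelian_group_axioms)

interpretation W: abelian_subgroup W V by (rule W_subgroup)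

lemma carrier_Q: "carrier Q = cls ` carrier V"
  by (auto simp: quotient_module_def A_RCOSETS_def')

lemma zero_Q: "\<zero>\<^bsub>Q\<^esub> = cls \<zero>\<^bsub>V\<^esub>"
  using W.a_subset by (simp add: quotient_module_def)

lemma add_Q: "u \<in> carrier V \<Longrightarrow> v \<in> carrier V \<Longrightarrow> cls u \<oplus>\<^bsub>Q\<^esub> cls v = cls (u \<oplus>\<^bsub>V\<^esub> v)"
  by (simp add: quotient_module_def W.a_rcos_sum)

lemma cls_eq_iff:
  assumes "u \<in> carrier V" "v \<in> carrier V"
  shows "cls u = cls v \<longleftrightarrow> (\<exists>w\<in>W. u = w \<oplus>\<^bsub>V\<^esub> v)"
proof
  assume "cls u = cls v"
  then have "u \<in> cls v" using W.a_rcos_self[OF assms(1)] by simp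
  then show "\<exists>w\<in>W. u = w \<oplus>\<^bsub>V\<^esub> v" by (auto simp: a_r_coset_def')
next
  assume "\<exists>w\<in>W. u = w \<oplus>\<^bsub>V\<^esub> v"
  then have "u \<in> cls v" by (auto simp: a_r_coset_def')
  then show "cls u = cls v"
    using assms(2) W.a_subgroup by (metis M.a_repr_independence)
qed

lemma smult_Q:
  assumes "c \<in> carrier K" "v \<in> carrier V"
  shows "c \<odot>\<^bsub>Q\<^esub> cls v = cls (c \<odot>\<^bsub>V\<^esub> v)"
proof -
  have eq: "cls (c \<odot>\<^bsub>V\<^esub> x) = cls (c \<odot>\<^bsub>V\<^esub> v)" if x: "x \<in> cls v" for x
  proof -
    obtain w where w: "w \<in> W" "x = w \<oplus>\<^bsub>V\<^esub> v" using x by (auto simp: a_r_coset_def')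
    then have "c \<odot>\<^bsub>V\<^esub> x = c \<odot>\<^bsub>V\<^esub> w \<oplus>\<^bsub>V\<^esub> c \<odot>\<^bsub>V\<^esub> v" using assms W_in_carrier by (simp add: smult_r_distr)
    then show ?thesis
      using w assms W_in_carrier submodule.smult_closed[OF W assms(1) w(1)] by (subst cls_eq_iff) auto
  qed
  have "c \<odot>\<^bsub>Q\<^esub> cls v = (\<Union>x\<in>cls v. cls (c \<odot>\<^bsub>V\<^esub> x))" by (simp add: quotient_module_def)
  also have "\<dots> = (\<Union>x\<in>cls v. cls (c \<odot>\<^bsub>V\<^esub> v))" by (rule SUP_cong[OF refl eq])
  also have "\<dots> = cls (c \<odot>\<^bsub>V\<^esub> v)" using W.a_rcos_self[OF assms(2)] by blast
  finally show ?thesis .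
qed

lemma quotient_vectorspace: "vectorspace K Q"
proof (rule vectorspace.intro)
  show "module K Q"
  proof (rule module_criteria)
    show "cring K" ..
    show "\<zero>\<^bsub>Q\<^esub> \<in> carrier Q" by (auto simp: zero_Q carrier_Q)
    show "\<forall>v w. v \<in> carrier Q \<and> w \<in> carrier Q \<longrightarrow> v \<oplus>\<^bsub>Q\<^esub> w \<in> carrier Q"
      by (auto simp: carrier_Q add_Q)
    show "\<forall>v\<in>carrier Q. \<exists>neg_v\<in>carrier Q. v \<oplus>\<^bsub>Q\<^esub> neg_v = \<zero>\<^bsub>Q\<^esub>"
    proof
      fix v assume "v \<in> carrier Q"
      then obtain x where x: "x \<in> carrier V" "v = cls x" by (auto simp: carrier_Q)
      then have "v \<oplus>\<^bsub>Q\<^esub> cls (\<ominus>\<^bsub>V\<^esub> x) = \<zero>\<^bsub>Q\<^esub>" by (simp add: add_Q zero_Q M.r_neg del: M.a_coset_add_zero)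
      then show "\<exists>neg_v\<in>carrier Q. v \<oplus>\<^bsub>Q\<^esub> neg_v = \<zero>\<^bsub>Q\<^esub>" using x by (auto simp: carrier_Q)
    qed
    show "\<forall>c v. c \<in> carrier K \<and> v \<in> carrier Q \<longrightarrow> c \<odot>\<^bsub>Q\<^esub> v \<in> carrier Q"
      by (auto simp: carrier_Q smult_Q)
    show "\<forall>v w. v \<in> carrier Q \<and> w \<in> carrier Q \<longrightarrow> v \<oplus>\<^bsub>Q\<^esub> w = w \<oplus>\<^bsub>Q\<^esub> v"
      by (auto simp: carrier_Q add_Q M.a_comm)
    show "\<forall>v w x. v \<in> carrier Q \<and> w \<in> carrier Q \<and> x \<in> carrier Q \<longrightarrow>
        v \<oplus>\<^bsub>Q\<^esub> w \<oplus>\<^bsub>Q\<^esub> x = v \<oplus>\<^bsub>Q\<^esub> (w \<oplus>\<^bsub>Q\<^esub> x)"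
      by (auto simp: carrier_Q add_Q M.a_assoc)
    show "\<forall>v\<in>carrier Q. v \<oplus>\<^bsub>Q\<^esub> \<zero>\<^bsub>Q\<^esub> = v"
      by (auto simp: carrier_Q add_Q zero_Q simp del: M.a_coset_add_zero)
    show "\<forall>a b v. a \<in> carrier K \<and> b \<in> carrier K \<and> v \<in> carrier Q \<longrightarrow>
        (a \<otimes>\<^bsub>K\<^esub> b) \<odot>\<^bsub>Q\<^esub> v = a \<odot>\<^bsub>Q\<^esub> (b \<odot>\<^bsub>Q\<^esub> v)"
      by (auto simp: carrier_Q smult_Q smult_assoc1)
    show "\<forall>v\<in>carrier Q. \<one>\<^bsub>K\<^esub> \<odot>\<^bsub>Q\<^esub> v = v"
      by (auto simp: carrier_Q smult_Q)
    show "\<forall>a b v. a \<in> carrier K \<and> b \<in> carrier K \<and> v \<in> carrier Q \<longrightarrow>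
        (a \<oplus>\<^bsub>K\<^esub> b) \<odot>\<^bsub>Q\<^esub> v = a \<odot>\<^bsub>Q\<^esub> v \<oplus>\<^bsub>Q\<^esub> b \<odot>\<^bsub>Q\<^esub> v"
      by (auto simp: carrier_Q smult_Q add_Q smult_l_distr)
    show "\<forall>a v w. a \<in> carrier K \<and> v \<in> carrier Q \<and> w \<in> carrier Q \<longrightarrow>
        a \<odot>\<^bsub>Q\<^esub> (v \<oplus>\<^bsub>Q\<^esub> w) = a \<odot>\<^bsub>Q\<^esub> v \<oplus>\<^bsub>Q\<^esub> a \<odot>\<^bsub>Q\<^esub> w"
      by (auto simp: carrier_Q smult_Q add_Q smult_r_distr)
  qed
qed (rule field_axioms)

interpretation Q: vectorspace K Q by (rule quotient_vectorspace)

text \<open>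
  Representatives of a basis of \<open>V/W\<close> detect every functional that vanishes on \<open>W\<close>. This is the
  form in which an upper bound on a Betti number is used.
\<close>

lemma detecting_vectors:
  assumes "edim K Q = enat d"
  shows "\<exists>z\<in>{..<d} \<rightarrow> carrier V. \<forall>f\<in>annihilator K V W.
    (\<forall>i<d. f (z i) = \<zero>\<^bsub>K\<^esub>) \<longrightarrow> (\<forall>v\<in>carrier V. f v = \<zero>\<^bsub>K\<^esub>)"
proof -
  have "Q.fin_dim" "Q.dim = d" using assms by (auto simp: edim_def split: if_splits)
  then obtain B where B: "finite B" "Q.basis B" "card B = d"
    using Q.finite_basis_exists Q.dim_basis by metis
  then have span: "Q.span B = carrier Q" and BQ: "B \<subseteq> carrier Q" by (auto simp: Q.basis_def)
  obtain b where b: "bij_betw b {..<d} B"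
    using ex_bij_betw_nat_finite[OF B(1)] B(3) by (auto simp: atLeast0LessThan)
  define z where "z i = (SOME v. v \<in> carrier V \<and> b i = cls v)" for i
  have z: "z i \<in> carrier V" "b i = cls (z i)" if "i < d" for i
  proof -
    have "b i \<in> carrier Q" using b that BQ by (auto simp: bij_betw_def)
    then have "\<exists>v. v \<in> carrier V \<and> b i = cls v" by (auto simp: carrier_Q)
    from someI_ex[OF this] show "z i \<in> carrier V" "b i = cls (z i)" by (simp_all add: z_def)
  qed
  show ?thesis
  proof (intro bexI[of _ z] ballI impI)
    show "z \<in> {..<d} \<rightarrow> carrier V" using z by auto
  next
    fix f v assume f: "f \<in> annihilator K V W" and fz: "\<forall>i<d. f (z i) = \<zero>\<^bsub>K\<^esub>" and v: "v \<in> carrier V"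
    note F = annihilatorD[OF f]
    have fcls: "f u = f v" if "cls u = cls v" "u \<in> carrier V" "v \<in> carrier V" for u v
      using that F(1)[OF that(3)] by (auto simp: cls_eq_iff F(2) F(4) W_in_carrier)
    have f0: "f \<zero>\<^bsub>V\<^esub> = \<zero>\<^bsub>K\<^esub>" using F(4) submodule.zero_closed[OF W] by simp
    \<comment> \<open>the image of \<open>ker f\<close> in the quotient is a subspace that contains the basis\<close>
    define N where "N = cls ` {v\<in>carrier V. f v = \<zero>\<^bsub>K\<^esub>}"
    have "submodule K N Q"
    proof (rule Q.submoduleI_vs)
      show "N \<subseteq> carrier Q" by (auto simp: N_def carrier_Q)
      show "\<zero>\<^bsub>Q\<^esub> \<in> N" unfolding zero_Q N_def using f0 by blast
    next
      fix x y assume "x \<in> N" "y \<in> N"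
      then obtain u v where "u \<in> carrier V" "f u = \<zero>\<^bsub>K\<^esub>" "x = cls u" "v \<in> carrier V" "f v = \<zero>\<^bsub>K\<^esub>" "y = cls v"
        by (auto simp: N_def)
      then show "x \<oplus>\<^bsub>Q\<^esub> y \<in> N" unfolding N_def
        by (auto simp: add_Q F(2) intro!: imageI)
    next
      fix c x assume "c \<in> carrier K" "x \<in> N"
      then obtain u where "u \<in> carrier V" "f u = \<zero>\<^bsub>K\<^esub>" "x = cls u" by (auto simp: N_def)
      then show "c \<odot>\<^bsub>Q\<^esub> x \<in> N" unfolding N_def using \<open>c \<in> carrier K\<close>
        by (auto simp: smult_Q F(3) intro!: imageI)
    qed
    moreover have "B \<subseteq> N"
    proof
      fix x assume "x \<in> B"
      then obtain i where "i < d" "x = b i" using b by (auto simp: bij_betw_def)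
      then show "x \<in> N" using z fz by (auto simp: N_def)
    qed
    ultimately have "carrier Q \<subseteq> N" using Q.span_is_subset span by blast
    then have "cls v \<in> N" using v by (auto simp: carrier_Q)
    then obtain u where "u \<in> carrier V" "f u = \<zero>\<^bsub>K\<^esub>" "cls v = cls u" by (auto simp: N_def)
    then show "f v = \<zero>\<^bsub>K\<^esub>" using fcls v by metis
  qed
qed

text \<open>
  The form in which a lower bound on a Betti number is used; \<open>V/W\<close> may be infinite-dimensional. The
  vectors are chosen one at a time: the earlier ones do not span modulo \<open>W\<close>, and a functional that
  is 1 on a new vector and 0 on the earlier ones corrects the last value.
\<close>

lemma functionals_interpolate:
  assumes "enat r \<le> edim K Q"
  shows "\<exists>z\<in>{..<r} \<rightarrow> carrier V. \<forall>t\<in>{..<r} \<rightarrow> carrier K. \<exists>f\<in>annihilator K V W. \<forall>i<r. f (z i) = t i"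
  using assms
proof (induction r)
  case 0
  have "(\<lambda>_. \<zero>\<^bsub>K\<^esub>) \<in> annihilator K V W" by (rule annihilatorI) auto
  then show ?case by auto
next
  case (Suc r)
  then have "enat r \<le> edim K Q" by (metis Suc_ile_eq less_imp_le)
  then obtain z where z: "z \<in> {..<r} \<rightarrow> carrier V"
    and ip: "\<And>t. t \<in> {..<r} \<rightarrow> carrier K \<Longrightarrow> \<exists>f\<in>annihilator K V W. \<forall>i<r. f (z i) = t i"
    using Suc.IH by blast
  define B where "B = (\<lambda>i. cls (z i)) ` {..<r}"
  have B: "finite B" "card B \<le> r" "B \<subseteq> carrier Q"
    using z card_image_le[of "{..<r}" "\<lambda>i. cls (z i)"] by (auto simp: B_def carrier_Q)
  have "Q.span B \<noteq> carrier Q"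
  proof
    assume span: "Q.span B = carrier Q"
    then have "Q.fin_dim" "Q.dim \<le> r" using B Q.gen_ge_dim[of B] by (auto simp: Q.fin_dim_def)
    then have "edim K Q \<le> enat r" by (simp add: edim_def)
    then show False using Suc.prems by (meson enat_ord_simps(1) not_less_eq_eq order_trans order_refl)
  qed
  \<comment> \<open>the preimage in \<open>V\<close> of the span of the earlier vectors; it contains \<open>W\<close>\<close>
  define U where "U = {v \<in> carrier V. cls v \<in> Q.span B}"
  have spanB: "submodule K (Q.span B) Q" using B Q.span_is_submodule by blast
  have U: "submodule K U V"
  proof (rule submoduleI_vs)
    show "\<zero>\<^bsub>V\<^esub> \<in> U" using submodule.zero_closed[OF spanB] by (simp add: U_def zero_Q del: M.a_coset_add_zero)
    show "\<And>v w. v \<in> U \<Longrightarrow> w \<in> U \<Longrightarrow> v \<oplus>\<^bsub>V\<^esub> w \<in> U"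
      using submodule.m_closed[OF spanB] by (auto simp: U_def simp flip: add_Q)
    show "\<And>c v. c \<in> carrier K \<Longrightarrow> v \<in> U \<Longrightarrow> c \<odot>\<^bsub>V\<^esub> v \<in> U"
      using submodule.smult_closed[OF spanB] by (auto simp: U_def simp flip: smult_Q)
  qed (auto simp: U_def)
  have "Q.span B \<subseteq> carrier Q" using spanB by (rule submodule.subset)
  with \<open>Q.span B \<noteq> carrier Q\<close> obtain v where v: "v \<in> carrier V" "v \<notin> U"
    by (auto simp: carrier_Q U_def)
  obtain g where g: "g \<in> annihilator K V U" "g v = \<one>\<^bsub>K\<^esub>" using separating_functional[OF U v] .
  have "W \<subseteq> U"
  proof
    fix w assume w: "w \<in> W"
    then have "cls w = cls \<zero>\<^bsub>V\<^esub>" using W_in_carrier by (subst cls_eq_iff) auto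
    then have "cls w = \<zero>\<^bsub>Q\<^esub>" using zero_Q by simp
    then show "w \<in> U" using submodule.zero_closed[OF spanB] w W_in_carrier by (simp add: U_def)
  qed
  then have gW: "g \<in> annihilator K V W" using g(1) annihilator_antimono by blast
  have gz: "g (z i) = \<zero>\<^bsub>K\<^esub>" if "i < r" for i
  proof -
    have "cls (z i) \<in> Q.span B" using Q.in_own_span[OF B(3)] that by (auto simp: B_def)
    then have "z i \<in> U" using z that by (auto simp: U_def)
    then show ?thesis using annihilatorD(4)[OF g(1)] by simp
  qed
  show ?case
  proof (intro bexI[of _ "z(r := v)"] ballI)
    show "z(r := v) \<in> {..<Suc r} \<rightarrow> carrier V" using z v by (auto simp: less_Suc_eq Pi_iff)
    fix t assume t: "t \<in> {..<Suc r} \<rightarrow> carrier K"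
    then have "t \<in> {..<r} \<rightarrow> carrier K" and tr: "t r \<in> carrier K"
      and tK: "\<And>i. i < r \<Longrightarrow> t i \<in> carrier K" by (auto simp: Pi_iff)
    then obtain f where f: "f \<in> annihilator K V W" "\<forall>i<r. f (z i) = t i" using ip by blast
    define c where "c = t r \<ominus>\<^bsub>K\<^esub> f v"
    have c: "c \<in> carrier K" using tr annihilatorD(1)[OF f(1) v(1)] by (simp add: c_def)
    have "f v \<oplus>\<^bsub>K\<^esub> c = t r"
      using tr annihilatorD(1)[OF f(1) v(1)] by (simp add: c_def a_minus_def R.a_comm[of "t r"] R.r_neg2)
    then show "\<exists>f\<in>annihilator K V W. \<forall>i<Suc r. f ((z(r := v)) i) = t i"
      using f g(2) gz c tr tK W_in_carrier
      by (intro bexI[OF _ annihilator_lincomb[OF f(1) gW c]]) (auto simp: less_Suc_eq)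
  qed
qed

end

section \<open>Chains and cochains of the bar complex\<close>

context cring
begin

text \<open>
  The identity behind the vanishing of the double coboundary of a 1-cochain.
\<close>

lemma alternating_sum_cancel:
  assumes "u \<in> carrier R" "v \<in> carrier R" "w \<in> carrier R" "x \<in> carrier R" "y \<in> carrier R" "z \<in> carrier R"
  shows "(u \<ominus> v \<oplus> w) \<ominus> (u \<ominus> x \<oplus> y) \<oplus> ((v \<ominus> x \<oplus> z) \<ominus> (w \<ominus> y \<oplus> z)) = \<zero>"
  using assms by algebra

lemma minus_add_add_eq_zero_iff:
  assumes "u \<in> carrier R" "v \<in> carrier R" "w \<in> carrier R"
  shows "u \<ominus> v \<oplus> w = \<zero> \<longleftrightarrow> v = w \<oplus> u"
proof
  assume "u \<ominus> v \<oplus> w = \<zero>"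
  then have "v = v \<oplus> (u \<ominus> v \<oplus> w)" using assms by simp
  also have "\<dots> = w \<oplus> u" using assms by algebra
  finally show "v = w \<oplus> u" .
next
  assume "v = w \<oplus> u"
  moreover have "u \<ominus> (w \<oplus> u) \<oplus> w = \<zero>" using assms by algebra
  ultimately show "u \<ominus> v \<oplus> w = \<zero>" by simp
qed

end

lemma annihilator_finsum:
  assumes "vectorspace K V" "F \<in> annihilator K V {}" "finite A" "h \<in> A \<rightarrow> carrier V"
  shows "F (\<Oplus>\<^bsub>V\<^esub>x\<in>A. h x) = (\<Oplus>\<^bsub>K\<^esub>x\<in>A. F (h x))"
proof -
  interpret vectorspace K V by fact
  note F = annihilatorD[OF assms(2)]
  show ?thesis using assms(3,4)
  proof (induction A)
    case empty
    have "F (\<zero>\<^bsub>K\<^esub> \<odot>\<^bsub>V\<^esub> \<zero>\<^bsub>V\<^esub>) = \<zero>\<^bsub>K\<^esub> \<otimes>\<^bsub>K\<^esub> F \<zero>\<^bsub>V\<^esub>" by (rule F(3)) auto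
    then show ?case using F(1)[of "\<zero>\<^bsub>V\<^esub>"] by simp
  next
    case (insert x A)
    then have "h \<in> A \<rightarrow> carrier V" "h x \<in> carrier V" by auto
    moreover from this have "(\<lambda>x. F (h x)) \<in> A \<rightarrow> carrier K" "F (h x) \<in> carrier K" using F(1) by auto
    ultimately show ?case using insert by (simp add: F(2))
  qed
qed

definition tuples :: "'g monoid \<Rightarrow> nat \<Rightarrow> 'g list set" where
  "tuples G n = {x. length x = n \<and> set x \<subseteq> carrier G}"

text \<open>
  The value on the chain \<open>f\<close> of the functional that takes the generator \<open>x\<close> to \<open>a x\<close>. Every
  functional on chains has this form, see \<open>functional_eq_pairing\<close>.
\<close>

definition pairing :: "'k ring \<Rightarrow> ('g list \<Rightarrow> 'k) \<Rightarrow> ('g list \<Rightarrow> 'k) \<Rightarrow> 'k" where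
  "pairing K a f = (\<Oplus>\<^bsub>K\<^esub>x\<in>{x. f x \<noteq> \<zero>\<^bsub>K\<^esub>}. f x \<otimes>\<^bsub>K\<^esub> a x)"

text \<open>
  The coboundary map on cochains: the transpose of the boundary map under \<^const>\<open>pairing\<close>, see
  \<open>functional_bd\<close>.
\<close>

definition cobar :: "'k ring \<Rightarrow> 'g monoid \<Rightarrow> nat \<Rightarrow> ('g list \<Rightarrow> 'k) \<Rightarrow> 'g list \<Rightarrow> 'k" where
  "cobar K G n a x = (\<Oplus>\<^bsub>K\<^esub>i\<in>{..n + 1}. (\<ominus>\<^bsub>K\<^esub> \<one>\<^bsub>K\<^esub>) [^]\<^bsub>K\<^esub> i \<otimes>\<^bsub>K\<^esub> a (bar_face G i x))"

locale bar_complex = K: field K + G: group G for K :: "'k ring" and G :: "'g monoid"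
begin

abbreviation C where "C n \<equiv> bar_chains K G n"
abbreviation gen where "gen x \<equiv> bar_generator K x"
abbreviation bd where "bd n f \<equiv> bar_boundary K G n f"

lemma chain_iff:
  "f \<in> carrier (C n) \<longleftrightarrow> (\<forall>x. f x \<in> carrier K) \<and> finite {x. f x \<noteq> \<zero>\<^bsub>K\<^esub>} \<and> {x. f x \<noteq> \<zero>\<^bsub>K\<^esub>} \<subseteq> tuples G n"
  by (auto simp: bar_chains_def tuples_def)

lemma chain_ops [simp]:
  "\<zero>\<^bsub>C n\<^esub> = (\<lambda>_. \<zero>\<^bsub>K\<^esub>)" "f \<oplus>\<^bsub>C n\<^esub> g = (\<lambda>x. f x \<oplus>\<^bsub>K\<^esub> g x)" "c \<odot>\<^bsub>C n\<^esub> f = (\<lambda>x. c \<otimes>\<^bsub>K\<^esub> f x)"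
  by (simp_all add: bar_chains_def)

lemma chain_add_closed:
  assumes "f \<in> carrier (C n)" "g \<in> carrier (C n)"
  shows "(\<lambda>x. f x \<oplus>\<^bsub>K\<^esub> g x) \<in> carrier (C n)"
proof -
  have "{x. f x \<oplus>\<^bsub>K\<^esub> g x \<noteq> \<zero>\<^bsub>K\<^esub>} \<subseteq> {x. f x \<noteq> \<zero>\<^bsub>K\<^esub>} \<union> {x. g x \<noteq> \<zero>\<^bsub>K\<^esub>}" by auto
  then show ?thesis using assms unfolding chain_iff
    by (auto elim!: finite_subset)
qed

lemma chain_smult_closed:
  assumes "f \<in> carrier (C n)" "c \<in> carrier K"
  shows "(\<lambda>x. c \<otimes>\<^bsub>K\<^esub> f x) \<in> carrier (C n)"
proof -
  have "{x. c \<otimes>\<^bsub>K\<^esub> f x \<noteq> \<zero>\<^bsub>K\<^esub>} \<subseteq> {x. f x \<noteq> \<zero>\<^bsub>K\<^esub>}" using assms by auto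
  then show ?thesis using assms unfolding chain_iff
    by (auto elim!: finite_subset)
qed

lemma chains_vectorspace: "vectorspace K (C n)"
proof (rule vectorspace.intro)
  show "module K (C n)"
  proof (rule module_criteria)
    show "cring K" ..
    show "\<forall>v\<in>carrier (C n). \<exists>neg_v\<in>carrier (C n). v \<oplus>\<^bsub>C n\<^esub> neg_v = \<zero>\<^bsub>C n\<^esub>"
    proof
      fix v assume v: "v \<in> carrier (C n)"
      then have "(\<lambda>x. (\<ominus>\<^bsub>K\<^esub> \<one>\<^bsub>K\<^esub>) \<otimes>\<^bsub>K\<^esub> v x) \<in> carrier (C n)" by (intro chain_smult_closed) auto
      moreover have "v x \<oplus>\<^bsub>K\<^esub> (\<ominus>\<^bsub>K\<^esub> \<one>\<^bsub>K\<^esub>) \<otimes>\<^bsub>K\<^esub> v x = \<zero>\<^bsub>K\<^esub>" for x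
        using v by (simp add: chain_iff K.l_minus K.r_neg)
      ultimately show "\<exists>neg_v\<in>carrier (C n). v \<oplus>\<^bsub>C n\<^esub> neg_v = \<zero>\<^bsub>C n\<^esub>" by force
    qed
    show "\<zero>\<^bsub>C n\<^esub> \<in> carrier (C n)" by (auto simp: chain_iff)
  qed (auto simp: chain_add_closed chain_smult_closed, auto simp: chain_iff K.a_ac K.m_assoc K.l_distr K.r_distr)
qed (rule K.field_axioms)

lemma gen_closed: "x \<in> tuples G n \<Longrightarrow> gen x \<in> carrier (C n)"
  by (auto simp: chain_iff bar_generator_def split: if_splits)

lemma pairing_superset:
  assumes "f \<in> carrier (C n)" "finite A" "{x. f x \<noteq> \<zero>\<^bsub>K\<^esub>} \<subseteq> A" "A \<subseteq> tuples G n"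
    and "a \<in> tuples G n \<rightarrow> carrier K"
  shows "pairing K a f = (\<Oplus>\<^bsub>K\<^esub>x\<in>A. f x \<otimes>\<^bsub>K\<^esub> a x)"
  unfolding pairing_def
proof (rule K.add.finprod_mono_neutral_cong_left)
  show "(\<lambda>x. f x \<otimes>\<^bsub>K\<^esub> a x) \<in> A \<rightarrow> carrier K"
    using assms by (auto simp: chain_iff intro!: K.m_closed)
  show "\<And>i. i \<in> A - {x. f x \<noteq> \<zero>\<^bsub>K\<^esub>} \<Longrightarrow> f i \<otimes>\<^bsub>K\<^esub> a i = \<zero>\<^bsub>K\<^esub>"
    using assms by (auto simp: Pi_iff subset_iff)
qed (use assms in auto)

lemma pairing_functional:
  assumes a: "a \<in> tuples G n \<rightarrow> carrier K"
  shows "pairing K a \<in> annihilator K (C n) {}"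
proof (rule annihilatorI)
  fix f assume f: "f \<in> carrier (C n)"
  then show "pairing K a f \<in> carrier K"
    unfolding pairing_def using a by (intro K.finsum_closed) (auto simp: chain_iff)
next
  fix f g assume fg: "f \<in> carrier (C n)" "g \<in> carrier (C n)"
  define A where "A = {x. f x \<noteq> \<zero>\<^bsub>K\<^esub>} \<union> {x. g x \<noteq> \<zero>\<^bsub>K\<^esub>}"
  have A: "finite A" "A \<subseteq> tuples G n" using fg by (auto simp: A_def chain_iff)
  have "pairing K a (f \<oplus>\<^bsub>C n\<^esub> g) = (\<Oplus>\<^bsub>K\<^esub>x\<in>A. (f x \<oplus>\<^bsub>K\<^esub> g x) \<otimes>\<^bsub>K\<^esub> a x)"
    using A by (subst pairing_superset[OF _ A(1) _ A(2) a]) (auto simp: chain_add_closed fg A_def)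
  also have "\<dots> = (\<Oplus>\<^bsub>K\<^esub>x\<in>A. f x \<otimes>\<^bsub>K\<^esub> a x \<oplus>\<^bsub>K\<^esub> g x \<otimes>\<^bsub>K\<^esub> a x)"
    using fg A a by (intro K.finsum_cong') (auto simp: chain_iff K.l_distr Pi_iff subset_iff)
  also have "\<dots> = pairing K a f \<oplus>\<^bsub>K\<^esub> pairing K a g"
    using fg A a by (subst K.finsum_addf)
      (auto simp: pairing_superset[OF _ A(1) _ A(2) a] A_def chain_iff Pi_iff subset_iff)
  finally show "pairing K a (f \<oplus>\<^bsub>C n\<^esub> g) = pairing K a f \<oplus>\<^bsub>K\<^esub> pairing K a g" .
next
  fix c f assume cf: "c \<in> carrier K" "f \<in> carrier (C n)"
  define A where "A = {x. f x \<noteq> \<zero>\<^bsub>K\<^esub>}"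
  have A: "finite A" "A \<subseteq> tuples G n" using cf by (auto simp: A_def chain_iff)
  have fa: "(\<lambda>x. f x \<otimes>\<^bsub>K\<^esub> a x) \<in> A \<rightarrow> carrier K" using cf A a by (auto simp: chain_iff Pi_iff subset_iff)
  have "pairing K a (c \<odot>\<^bsub>C n\<^esub> f) = (\<Oplus>\<^bsub>K\<^esub>x\<in>A. (c \<otimes>\<^bsub>K\<^esub> f x) \<otimes>\<^bsub>K\<^esub> a x)"
    using A cf by (subst pairing_superset[OF _ A(1) _ A(2) a]) (auto simp: chain_smult_closed A_def)
  also have "\<dots> = (\<Oplus>\<^bsub>K\<^esub>x\<in>A. c \<otimes>\<^bsub>K\<^esub> (f x \<otimes>\<^bsub>K\<^esub> a x))"
    using cf A a by (intro K.finsum_cong') (auto simp: chain_iff K.m_assoc Pi_iff subset_iff)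
  also have "\<dots> = c \<otimes>\<^bsub>K\<^esub> (\<Oplus>\<^bsub>K\<^esub>x\<in>A. f x \<otimes>\<^bsub>K\<^esub> a x)"
    using A cf fa by (intro K.finsum_rdistr[symmetric]) auto
  finally show "pairing K a (c \<odot>\<^bsub>C n\<^esub> f) = c \<otimes>\<^bsub>K\<^esub> pairing K a f"
    by (simp add: pairing_def A_def)
qed auto

text \<open>
  Coefficients of a chain are functionals. Statements about boundaries are reduced to
  statements about functionals through this lemma.
\<close>

lemma evaluation_functional: "(\<lambda>f. f y) \<in> annihilator K (C n) {}"
  by (rule annihilatorI) (auto simp: chain_iff)

lemma chain_expansion:
  assumes f: "f \<in> carrier (C n)"
  shows "f = (\<Oplus>\<^bsub>C n\<^esub>x\<in>{x. f x \<noteq> \<zero>\<^bsub>K\<^esub>}. f x \<odot>\<^bsub>C n\<^esub> gen x)"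
proof
  fix y
  interpret C: vectorspace K "C n" by (rule chains_vectorspace)
  let ?A = "{x. f x \<noteq> \<zero>\<^bsub>K\<^esub>}"
  have A: "finite ?A" "?A \<subseteq> tuples G n" using f by (auto simp: chain_iff)
  have "(\<lambda>x. f x \<odot>\<^bsub>C n\<^esub> gen x) \<in> ?A \<rightarrow> carrier (C n)"
    using A gen_closed f by (auto intro!: chain_smult_closed simp: chain_iff)
  then have "(\<Oplus>\<^bsub>C n\<^esub>x\<in>?A. f x \<odot>\<^bsub>C n\<^esub> gen x) y = (\<Oplus>\<^bsub>K\<^esub>x\<in>?A. f x \<otimes>\<^bsub>K\<^esub> gen x y)"
    using annihilator_finsum[OF chains_vectorspace evaluation_functional A(1)] by simp
  also have "\<dots> = (\<Oplus>\<^bsub>K\<^esub>x\<in>?A. if y = x then f x else \<zero>\<^bsub>K\<^esub>)"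
    using f by (intro K.finsum_cong') (auto simp: bar_generator_def chain_iff)
  also have "\<dots> = f y"
  proof (cases "y \<in> ?A")
    case True
    then show ?thesis using f A by (subst K.finsum_singleton) (auto simp: chain_iff)
  next
    case False
    then have "(\<Oplus>\<^bsub>K\<^esub>x\<in>?A. if y = x then f x else \<zero>\<^bsub>K\<^esub>) = (\<Oplus>\<^bsub>K\<^esub>x\<in>?A. \<zero>\<^bsub>K\<^esub>)"
      by (intro K.finsum_cong') auto
    then show ?thesis using False by simp
  qed
  finally show "f y = (\<Oplus>\<^bsub>C n\<^esub>x\<in>?A. f x \<odot>\<^bsub>C n\<^esub> gen x) y" by simp
qed

lemma functional_eq_pairing:
  assumes F: "F \<in> annihilator K (C n) {}" and f: "f \<in> carrier (C n)"
  shows "F f = pairing K (\<lambda>x. F (gen x)) f"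
proof -
  let ?A = "{x. f x \<noteq> \<zero>\<^bsub>K\<^esub>}"
  have A: "finite ?A" "?A \<subseteq> tuples G n" using f by (auto simp: chain_iff)
  have g: "(\<lambda>x. f x \<odot>\<^bsub>C n\<^esub> gen x) \<in> ?A \<rightarrow> carrier (C n)"
    using A gen_closed f by (auto intro!: chain_smult_closed simp: chain_iff)
  have "F f = F (\<Oplus>\<^bsub>C n\<^esub>x\<in>?A. f x \<odot>\<^bsub>C n\<^esub> gen x)" using chain_expansion[OF f] by simp
  also have "\<dots> = (\<Oplus>\<^bsub>K\<^esub>x\<in>?A. F (f x \<odot>\<^bsub>C n\<^esub> gen x))"
    by (rule annihilator_finsum[OF chains_vectorspace F A(1) g])
  also have "\<dots> = (\<Oplus>\<^bsub>K\<^esub>x\<in>?A. f x \<otimes>\<^bsub>K\<^esub> F (gen x))"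
    using f A gen_closed annihilatorD(1,3)[OF F]
    by (intro K.finsum_cong') (auto simp: chain_iff simp del: chain_ops)
  finally show ?thesis by (simp add: pairing_def)
qed

lemma face_closed: "x \<in> tuples G (Suc n) \<Longrightarrow> i \<le> Suc n \<Longrightarrow> bar_face G i x \<in> tuples G n"
  by (auto simp: tuples_def bar_face_def dest!: in_set_takeD in_set_dropD in_set_butlastD
      list.set_sel(2)[rotated] intro!: G.m_closed)

lemma sign_closed: "(\<ominus>\<^bsub>K\<^esub> \<one>\<^bsub>K\<^esub>) [^]\<^bsub>K\<^esub> (i::nat) \<in> carrier K"
  by (intro K.nat_pow_closed) auto

lemma bd_summand_closed:
  assumes "x \<in> tuples G (Suc n)"
  shows "(\<Oplus>\<^bsub>C n\<^esub> i \<in> {..n + 1}. (\<ominus>\<^bsub>K\<^esub> \<one>\<^bsub>K\<^esub>) [^]\<^bsub>K\<^esub> i \<odot>\<^bsub>C n\<^esub> gen (bar_face G i x)) \<in> carrier (C n)"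
    and "(\<lambda>i. (\<ominus>\<^bsub>K\<^esub> \<one>\<^bsub>K\<^esub>) [^]\<^bsub>K\<^esub> i \<odot>\<^bsub>C n\<^esub> gen (bar_face G i x)) \<in> {..n + 1} \<rightarrow> carrier (C n)"
proof -
  interpret C: vectorspace K "C n" by (rule chains_vectorspace)
  show *: "(\<lambda>i. (\<ominus>\<^bsub>K\<^esub> \<one>\<^bsub>K\<^esub>) [^]\<^bsub>K\<^esub> i \<odot>\<^bsub>C n\<^esub> gen (bar_face G i x)) \<in> {..n + 1} \<rightarrow> carrier (C n)"
    using assms sign_closed face_closed gen_closed by (auto simp del: chain_ops intro!: C.smult_closed)
  then show "(\<Oplus>\<^bsub>C n\<^esub> i \<in> {..n + 1}. (\<ominus>\<^bsub>K\<^esub> \<one>\<^bsub>K\<^esub>) [^]\<^bsub>K\<^esub> i \<odot>\<^bsub>C n\<^esub> gen (bar_face G i x)) \<in> carrier (C n)"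
    by (rule C.finsum_closed)
qed

lemma bd_closed:
  assumes "f \<in> carrier (C (Suc n))" shows "bd n f \<in> carrier (C n)"
proof -
  interpret C: vectorspace K "C n" by (rule chains_vectorspace)
  show ?thesis unfolding bar_boundary_def
  proof (intro C.M.finsum_closed Pi_I)
    fix x assume "x \<in> {x. f x \<noteq> \<zero>\<^bsub>K\<^esub>}"
    then have "x \<in> tuples G (Suc n)" "f x \<in> carrier K" using assms by (auto simp: chain_iff)
    then show "f x \<odot>\<^bsub>C n\<^esub> (\<Oplus>\<^bsub>C n\<^esub> i \<in> {..n + 1}. (\<ominus>\<^bsub>K\<^esub> \<one>\<^bsub>K\<^esub>) [^]\<^bsub>K\<^esub> i \<odot>\<^bsub>C n\<^esub> gen (bar_face G i x)) \<in> carrier (C n)"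
      using bd_summand_closed(1) C.smult_closed by blast
  qed
qed

lemma cobar_closed:
  assumes "a \<in> tuples G n \<rightarrow> carrier K" shows "cobar K G n a \<in> tuples G (Suc n) \<rightarrow> carrier K"
  unfolding cobar_def using assms sign_closed face_closed
  by (auto intro!: K.finsum_closed K.m_closed)

text \<open>
  A functional commutes with the sums that define the boundary. Linearity of the
  boundary map and the vanishing of its square follow from this formula.
\<close>

lemma functional_bd:
  assumes F: "F \<in> annihilator K (C n) {}" and f: "f \<in> carrier (C (Suc n))"
  shows "F (bd n f) = pairing K (cobar K G n (\<lambda>x. F (gen x))) f"
proof -
  interpret C: vectorspace K "C n" by (rule chains_vectorspace)
  let ?A = "{x. f x \<noteq> \<zero>\<^bsub>K\<^esub>}"
  let ?b = "\<lambda>x. (\<Oplus>\<^bsub>C n\<^esub> i \<in> {..n + 1}. (\<ominus>\<^bsub>K\<^esub> \<one>\<^bsub>K\<^esub>) [^]\<^bsub>K\<^esub> i \<odot>\<^bsub>C n\<^esub> gen (bar_face G i x))"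
  note FD = annihilatorD[OF F]
  have A: "finite ?A" "?A \<subseteq> tuples G (Suc n)" and fK: "f x \<in> carrier K" for x using f by (auto simp: chain_iff)
  have b: "?b x \<in> carrier (C n)" if "x \<in> ?A" for x using bd_summand_closed(1) A that by blast
  have Fb: "F (?b x) = cobar K G n (\<lambda>x. F (gen x)) x" if "x \<in> ?A" for x
  proof -
    have x: "x \<in> tuples G (Suc n)" using that A by auto
    have "F (?b x) = (\<Oplus>\<^bsub>K\<^esub> i \<in> {..n + 1}. F ((\<ominus>\<^bsub>K\<^esub> \<one>\<^bsub>K\<^esub>) [^]\<^bsub>K\<^esub> i \<odot>\<^bsub>C n\<^esub> gen (bar_face G i x)))"
      by (rule annihilator_finsum[OF chains_vectorspace F _ bd_summand_closed(2)[OF x]]) auto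
    also have "\<dots> = cobar K G n (\<lambda>x. F (gen x)) x"
      unfolding cobar_def using FD(1,3) sign_closed gen_closed face_closed[OF x]
      by (intro K.finsum_cong') (auto simp del: chain_ops)
    finally show ?thesis .
  qed
  have "F (bd n f) = (\<Oplus>\<^bsub>K\<^esub>x\<in>?A. F (f x \<odot>\<^bsub>C n\<^esub> ?b x))"
    unfolding bar_boundary_def
    by (rule annihilator_finsum[OF chains_vectorspace F A(1)]) (use b fK in \<open>auto simp del: chain_ops\<close>)
  also have "\<dots> = (\<Oplus>\<^bsub>K\<^esub>x\<in>?A. f x \<otimes>\<^bsub>K\<^esub> cobar K G n (\<lambda>x. F (gen x)) x)"
    using FD(1,3) b fK Fb by (intro K.finsum_cong') (auto simp del: chain_ops simp flip: Fb)
  finally show ?thesis by (simp add: pairing_def)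
qed

lemma gen_functional_closed:
  assumes "F \<in> annihilator K (C n) {}" shows "(\<lambda>x. F (gen x)) \<in> tuples G n \<rightarrow> carrier K"
  using annihilatorD(1)[OF assms] gen_closed by auto

lemma functional_comp_bd:
  assumes F: "F \<in> annihilator K (C n) {}"
  shows "(\<lambda>f. F (bd n f)) \<in> annihilator K (C (Suc n)) {}"
proof -
  interpret C: vectorspace K "C (Suc n)" by (rule chains_vectorspace)
  note p = annihilatorD[OF pairing_functional[OF cobar_closed[OF gen_functional_closed[OF F]]]]
  show ?thesis
    by (rule annihilatorI) (simp_all add: functional_bd[OF F] p del: chain_ops)
qed

lemma bd_add:
  assumes "f \<in> carrier (C (Suc n))" "g \<in> carrier (C (Suc n))"
  shows "bd n (f \<oplus>\<^bsub>C (Suc n)\<^esub> g) = bd n f \<oplus>\<^bsub>C n\<^esub> bd n g"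
  using annihilatorD(2)[OF functional_comp_bd[OF evaluation_functional] assms] by auto

lemma bd_smult:
  assumes "c \<in> carrier K" "f \<in> carrier (C (Suc n))"
  shows "bd n (c \<odot>\<^bsub>C (Suc n)\<^esub> f) = c \<odot>\<^bsub>C n\<^esub> bd n f"
  using annihilatorD(3)[OF functional_comp_bd[OF evaluation_functional] assms] by auto

lemma bd_zero: "bd n \<zero>\<^bsub>C (Suc n)\<^esub> = \<zero>\<^bsub>C n\<^esub>"
proof -
  interpret C: vectorspace K "C n" by (rule chains_vectorspace)
  show ?thesis unfolding bar_boundary_def by simp
qed

lemma gen_eval:
  assumes "x \<in> tuples G n" "a \<in> tuples G n \<rightarrow> carrier K"
  shows "pairing K a (gen x) = a x"
proof -
  have "pairing K a (gen x) = (\<Oplus>\<^bsub>K\<^esub>y\<in>{x}. gen x y \<otimes>\<^bsub>K\<^esub> a y)"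
    using assms by (intro pairing_superset gen_closed) (auto simp: bar_generator_def)
  then show ?thesis using assms by (auto simp: bar_generator_def Pi_iff)
qed

lemma functional_gen_bd:
  assumes "F \<in> annihilator K (C n) {}" "x \<in> tuples G (Suc n)"
  shows "F (bd n (gen x)) = cobar K G n (\<lambda>x. F (gen x)) x"
  using assms by (simp add: functional_bd gen_closed gen_eval cobar_closed gen_functional_closed)

lemma submodule_boundaries: "submodule K (bar_boundaries K G n) (C n)"
proof -
  interpret C: vectorspace K "C n" by (rule chains_vectorspace)
  interpret C': vectorspace K "C (Suc n)" by (rule chains_vectorspace)
  show ?thesis
  proof (rule C.submoduleI_vs)
    show "\<zero>\<^bsub>C n\<^esub> \<in> bar_boundaries K G n"
      unfolding bar_boundaries_def using C'.M.zero_closed by (subst bd_zero[symmetric]) blast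
    show "v \<oplus>\<^bsub>C n\<^esub> w \<in> bar_boundaries K G n" if "v \<in> bar_boundaries K G n" "w \<in> bar_boundaries K G n" for v w
      using that unfolding bar_boundaries_def
      by (auto simp flip: bd_add simp del: chain_ops)
    show "c \<odot>\<^bsub>C n\<^esub> v \<in> bar_boundaries K G n" if "c \<in> carrier K" "v \<in> bar_boundaries K G n" for c v
      using that unfolding bar_boundaries_def
      by (auto simp flip: bd_smult simp del: chain_ops)
  qed (auto simp: bar_boundaries_def bd_closed)
qed

lemma submodule_cycles: "submodule K (bar_cycles K G (Suc n)) (C (Suc n))"
proof -
  interpret C: vectorspace K "C n" by (rule chains_vectorspace)
  interpret C': vectorspace K "C (Suc n)" by (rule chains_vectorspace)
  show ?thesis
    by (rule C'.submoduleI_vs) (auto simp: bd_add bd_smult bd_zero simp del: chain_ops)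
qed

lemma cobar_0: "x \<in> tuples G 1 \<Longrightarrow> a [] \<in> carrier K \<Longrightarrow> cobar K G 0 a x = \<zero>\<^bsub>K\<^esub>"
  by (cases x) (auto simp: cobar_def tuples_def bar_face_def K.finsum_Suc K.l_minus K.l_neg)

lemma cobar_1:
  assumes "g \<in> carrier G" "h \<in> carrier G" "a \<in> tuples G 1 \<rightarrow> carrier K"
  shows "cobar K G 1 a [g, h] = a [h] \<ominus>\<^bsub>K\<^esub> a [g \<otimes>\<^bsub>G\<^esub> h] \<oplus>\<^bsub>K\<^esub> a [g]"
proof -
  have "a [g] \<in> carrier K" "a [h] \<in> carrier K" "a [g \<otimes>\<^bsub>G\<^esub> h] \<in> carrier K"
    using assms by (auto simp: tuples_def Pi_iff)
  then show ?thesis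
    by (simp add: cobar_def bar_face_def K.finsum_Suc numeral_2_eq_2 K.l_minus a_minus_def K.a_ac)
qed

lemma cobar_2:
  assumes "g \<in> carrier G" "h \<in> carrier G" "k \<in> carrier G" "a \<in> tuples G 2 \<rightarrow> carrier K"
  shows "cobar K G 2 a [g, h, k] =
    a [h, k] \<ominus>\<^bsub>K\<^esub> a [g \<otimes>\<^bsub>G\<^esub> h, k] \<oplus>\<^bsub>K\<^esub> (a [g, h \<otimes>\<^bsub>G\<^esub> k] \<ominus>\<^bsub>K\<^esub> a [g, h])"
proof -
  have sum4: "(\<Oplus>\<^bsub>K\<^esub>i\<in>{..2 + 1}. t i) = t 3 \<oplus>\<^bsub>K\<^esub> (t 2 \<oplus>\<^bsub>K\<^esub> (t 1 \<oplus>\<^bsub>K\<^esub> t 0))"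
    if "t \<in> {..3} \<rightarrow> carrier K" for t :: "nat \<Rightarrow> 'k"
    using that by (simp add: eval_nat_numeral K.finsum_Suc Pi_iff)
  have "a [h, k] \<in> carrier K" "a [g \<otimes>\<^bsub>G\<^esub> h, k] \<in> carrier K" "a [g, h \<otimes>\<^bsub>G\<^esub> k] \<in> carrier K" "a [g, h] \<in> carrier K"
    using assms by (auto simp: tuples_def Pi_iff)
  moreover have "bar_face G i [g, h, k] \<in> tuples G 2" if "i \<le> 3" for i
    using face_closed[of "[g, h, k]" 2 i] that assms by (simp add: tuples_def)
  then have "(\<lambda>i. (\<ominus>\<^bsub>K\<^esub> \<one>\<^bsub>K\<^esub>) [^]\<^bsub>K\<^esub> i \<otimes>\<^bsub>K\<^esub> a (bar_face G i [g, h, k])) \<in> {..3} \<rightarrow> carrier K"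
    using assms(4) sign_closed by (auto intro!: K.m_closed)
  ultimately show ?thesis unfolding cobar_def
    by (subst sum4) (simp_all add: bar_face_def eval_nat_numeral K.l_minus a_minus_def K.a_ac)
qed

end

section \<open>Low-dimensional homology and characters\<close>

text \<open>
  The group \<open>Hom(G, K)\<close> into the additive group of \<open>K\<close>. The functions are extensional so that
  they can be counted.
\<close>

definition characters :: "'k ring \<Rightarrow> 'g monoid \<Rightarrow> ('g \<Rightarrow> 'k) set" where
  "characters K G = {\<phi> \<in> carrier G \<rightarrow>\<^sub>E carrier K.
     \<forall>g\<in>carrier G. \<forall>h\<in>carrier G. \<phi> (g \<otimes>\<^bsub>G\<^esub> h) = \<phi> g \<oplus>\<^bsub>K\<^esub> \<phi> h}"

definition cocycles2 :: "'k ring \<Rightarrow> 'g monoid \<Rightarrow> ('g list \<Rightarrow> 'k) set" where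
  "cocycles2 K G = {a \<in> tuples G 2 \<rightarrow> carrier K. \<forall>x\<in>tuples G 3. cobar K G 2 a x = \<zero>\<^bsub>K\<^esub>}"

lemma annihilator_restrict:
  assumes "f \<in> annihilator K V W" "Z \<subseteq> carrier V"
  shows "f \<in> annihilator K (V\<lparr>carrier := Z\<rparr>) W"
  using assms by (simp add: annihilator_def subset_iff)

lemma charactersD:
  assumes "\<phi> \<in> characters K G"
  shows "g \<in> carrier G \<Longrightarrow> \<phi> g \<in> carrier K"
    and "g \<in> carrier G \<Longrightarrow> h \<in> carrier G \<Longrightarrow> \<phi> (g \<otimes>\<^bsub>G\<^esub> h) = \<phi> g \<oplus>\<^bsub>K\<^esub> \<phi> h"
    and "g \<notin> carrier G \<Longrightarrow> \<phi> g = undefined"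
  using assms by (auto simp: characters_def PiE_iff extensional_def)

lemma characters_eqI:
  assumes "\<phi> \<in> characters K G" "\<psi> \<in> characters K G" "\<And>g. g \<in> carrier G \<Longrightarrow> \<phi> g = \<psi> g"
  shows "\<phi> = \<psi>"
  using assms by (auto simp: characters_def intro: PiE_ext)

context bar_complex
begin

lemma tuples_1:
  "x \<in> tuples G 1 \<longleftrightarrow> (\<exists>g\<in>carrier G. x = [g])"
  "x \<in> tuples G (Suc 0) \<longleftrightarrow> (\<exists>g\<in>carrier G. x = [g])"
  by (auto simp: tuples_def length_Suc_conv)

lemma tuples_2:
  "x \<in> tuples G 2 \<longleftrightarrow> (\<exists>g\<in>carrier G. \<exists>h\<in>carrier G. x = [g, h])"
  "x \<in> tuples G (Suc 1) \<longleftrightarrow> (\<exists>g\<in>carrier G. \<exists>h\<in>carrier G. x = [g, h])"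
  by (auto simp: tuples_def length_Suc_conv numeral_2_eq_2)

lemma tuples_3: "x \<in> tuples G 3 \<longleftrightarrow> (\<exists>g\<in>carrier G. \<exists>h\<in>carrier G. \<exists>k\<in>carrier G. x = [g, h, k])"
  by (auto simp: tuples_def length_Suc_conv numeral_3_eq_3)

lemma pairing_zero:
  assumes "\<And>x. x \<in> tuples G n \<Longrightarrow> a x = \<zero>\<^bsub>K\<^esub>" "f \<in> carrier (C n)"
  shows "pairing K a f = \<zero>\<^bsub>K\<^esub>"
proof -
  have "pairing K a f = (\<Oplus>\<^bsub>K\<^esub>x\<in>{x. f x \<noteq> \<zero>\<^bsub>K\<^esub>}. \<zero>\<^bsub>K\<^esub>)"
    unfolding pairing_def using assms by (intro K.finsum_cong') (auto simp: chain_iff subset_iff)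
  then show ?thesis by simp
qed

lemma cobar_cong:
  assumes "\<And>x. x \<in> tuples G n \<Longrightarrow> a x = b x" "b \<in> tuples G n \<rightarrow> carrier K" "x \<in> tuples G (Suc n)"
  shows "cobar K G n a x = cobar K G n b x"
  unfolding cobar_def using assms sign_closed face_closed[OF assms(3)]
  by (intro K.finsum_cong') auto

lemma pairing_bd:
  assumes a: "a \<in> tuples G n \<rightarrow> carrier K" and f: "f \<in> carrier (C (Suc n))"
    and "\<And>x. x \<in> tuples G (Suc n) \<Longrightarrow> cobar K G n a x = \<zero>\<^bsub>K\<^esub>"
  shows "pairing K a (bd n f) = \<zero>\<^bsub>K\<^esub>"
proof -
  have "cobar K G n (\<lambda>x. pairing K a (gen x)) x = \<zero>\<^bsub>K\<^esub>" if "x \<in> tuples G (Suc n)" for x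
    using that assms(3) cobar_cong[of n "\<lambda>x. pairing K a (gen x)" a x] a by (simp add: gen_eval)
  then show ?thesis
    using pairing_zero[OF _ f] by (simp add: functional_bd[OF pairing_functional[OF a] f])
qed

text \<open>
  The transpose of the statement that boundaries of 3-chains are cycles.
\<close>

lemma cobar_cobar:
  assumes a: "a \<in> tuples G 1 \<rightarrow> carrier K" and x: "x \<in> tuples G 3"
  shows "cobar K G 2 (cobar K G 1 a) x = \<zero>\<^bsub>K\<^esub>"
proof -
  obtain g h k where x: "x = [g, h, k]" and ghk: "g \<in> carrier G" "h \<in> carrier G" "k \<in> carrier G"
    using x by (auto simp: tuples_3)
  have c: "cobar K G 1 a \<in> tuples G 2 \<rightarrow> carrier K"
    using cobar_closed[OF a] by (simp add: numeral_2_eq_2)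
  have aK: "a [y] \<in> carrier K" if "y \<in> carrier G" for y using a that by (auto simp: tuples_1)
  have "a [g] \<in> carrier K" "a [h] \<in> carrier K" "a [k] \<in> carrier K" "a [g \<otimes>\<^bsub>G\<^esub> h] \<in> carrier K"
    "a [h \<otimes>\<^bsub>G\<^esub> k] \<in> carrier K" "a [g \<otimes>\<^bsub>G\<^esub> h \<otimes>\<^bsub>G\<^esub> k] \<in> carrier K"
    using ghk by (auto intro!: aK)
  then show ?thesis
    unfolding x cobar_2[OF ghk c]
    using ghk a G.m_assoc[OF ghk] by (simp only: cobar_1 G.m_closed K.alternating_sum_cancel)
qed

lemma bd_bd:
  assumes f: "f \<in> carrier (C 3)" shows "bd 1 (bd 2 f) = \<zero>\<^bsub>C 1\<^esub>"
proof
  fix y :: "'g list"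
  let ?a = "\<lambda>x. gen x y"
  have f': "f \<in> carrier (C (Suc 2))" using f by (simp add: numeral_3_eq_3 numeral_2_eq_2)
  have a: "?a \<in> tuples G 1 \<rightarrow> carrier K"
    by (auto simp: bar_generator_def)
  have c: "cobar K G 1 ?a \<in> tuples G 2 \<rightarrow> carrier K"
    using cobar_closed[OF a] by (simp add: numeral_2_eq_2)
  have "bd 2 f \<in> carrier (C (Suc 1))" using bd_closed[OF f'] by (simp add: numeral_2_eq_2)
  from functional_bd[OF evaluation_functional this]
  have "bd 1 (bd 2 f) y = pairing K (cobar K G 1 ?a) (bd 2 f)" by simp
  also have "\<dots> = \<zero>\<^bsub>K\<^esub>"
    using cobar_cobar[OF a] by (intro pairing_bd[OF c f']) (simp add: numeral_3_eq_3 numeral_2_eq_2)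
  finally show "bd 1 (bd 2 f) y = \<zero>\<^bsub>C 1\<^esub> y" by simp
qed

text \<open>
  Both faces of a 1-tuple are the empty tuple, and their signs are opposite.
\<close>

lemma cycles_1: "bar_cycles K G 1 = carrier (C 1)"
proof -
  have "bd 0 f = \<zero>\<^bsub>C 0\<^esub>" if f: "f \<in> carrier (C (Suc 0))" for f
  proof
    fix y
    have "bd 0 f y = pairing K (cobar K G 0 (\<lambda>x. gen x y)) f"
      by (rule functional_bd[OF evaluation_functional f])
    also have "\<dots> = \<zero>\<^bsub>K\<^esub>"
      by (rule pairing_zero[OF _ f]) (simp add: cobar_0 bar_generator_def)
    finally show "bd 0 f y = \<zero>\<^bsub>C 0\<^esub> y" by simp
  qed
  then show ?thesis by (auto simp del: chain_ops)
qed

lemma homology_1: "group_homology 1 G K = quotient_module (C 1) (bar_boundaries K G 1)"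
proof -
  have "(C 1)\<lparr>carrier := carrier (C 1)\<rparr> = C 1" by simp
  then show ?thesis unfolding group_homology_def cycles_1 by simp
qed

lemma quotient_space_1: "quotient_space K (C 1) (bar_boundaries K G 1)"
  by (intro quotient_space.intro quotient_space_axioms.intro chains_vectorspace submodule_boundaries)

lemma boundaries_2_subset: "bar_boundaries K G 2 \<subseteq> bar_cycles K G 2"
proof
  fix f assume "f \<in> bar_boundaries K G 2"
  then obtain e where e: "e \<in> carrier (C 3)" "f = bd 2 e"
    by (auto simp: bar_boundaries_def numeral_3_eq_3 numeral_2_eq_2)
  have "f \<in> carrier (C (Suc 1))" using bd_closed[of e 2] e by (simp add: numeral_3_eq_3 numeral_2_eq_2)
  then show "f \<in> bar_cycles K G 2"
    using bd_bd e by (simp add: numeral_2_eq_2 del: chain_ops)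
qed

lemma quotient_space_2:
  "quotient_space K ((C 2)\<lparr>carrier := bar_cycles K G 2\<rparr>) (bar_boundaries K G 2)"
proof -
  interpret C: vectorspace K "C 2" by (rule chains_vectorspace)
  have Z: "submodule K (bar_cycles K G 2) (C 2)"
    using submodule_cycles[of 1] by (simp add: numeral_2_eq_2 del: bar_cycles.simps)
  have m: "module K ((C 2)\<lparr>carrier := bar_cycles K G 2\<rparr>)" by (rule C.submodule_is_module[OF Z])
  have "submodule K (bar_boundaries K G 2) ((C 2)\<lparr>carrier := bar_cycles K G 2\<rparr>)"
    using submodule_boundaries[of 2] boundaries_2_subset m
    by (auto simp: submodule_def simp del: chain_ops)
  then show ?thesis
    using m by (intro quotient_space.intro quotient_space_axioms.intro vectorspace.intro K.field_axioms)
qed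

lemma homology_2:
  "group_homology 2 G K = quotient_module ((C 2)\<lparr>carrier := bar_cycles K G 2\<rparr>) (bar_boundaries K G 2)"
  by (simp add: group_homology_def)

text \<open>
  Vanishing on the boundary of \<open>[g, h]\<close> is the same as additivity on \<open>g h\<close>. Thus characters are
  the functionals on \<open>H\<^sub>1\<close>; the converse direction is the next lemma.
\<close>

lemma character_functional:
  assumes \<phi>: "\<phi> \<in> characters K G"
  shows "pairing K (\<lambda>x. \<phi> (hd x)) \<in> annihilator K (C 1) (bar_boundaries K G 1)"
proof -
  let ?a = "\<lambda>x. \<phi> (hd x)"
  note ch = charactersD[OF \<phi>]
  have a: "?a \<in> tuples G 1 \<rightarrow> carrier K" using ch(1) by (auto simp: tuples_1)
  have "cobar K G 1 ?a x = \<zero>\<^bsub>K\<^esub>" if t: "x \<in> tuples G (Suc 1)" for x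
  proof -
    obtain g h where x: "x = [g, h]" and gh: "g \<in> carrier G" "h \<in> carrier G"
      using t unfolding tuples_2 by blast
    then show ?thesis unfolding x cobar_1[OF gh a]
      using ch(1)[OF gh(1)] ch(1)[OF gh(2)]
      by (simp add: ch(2) K.minus_add_add_eq_zero_iff gh)
  qed
  then have "pairing K ?a (bd 1 f) = \<zero>\<^bsub>K\<^esub>" if "f \<in> carrier (C (Suc 1))" for f
    using that pairing_bd[OF a] by blast
  then show ?thesis
    using pairing_functional[OF a] by (auto simp: annihilator_def bar_boundaries_def)
qed

lemma functional_character:
  assumes F: "F \<in> annihilator K (C 1) (bar_boundaries K G 1)"
  shows "restrict (\<lambda>g. F (gen [g])) (carrier G) \<in> characters K G"
proof -
  have F': "F \<in> annihilator K (C 1) {}" using F annihilator_antimono by blast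
  note FK = gen_functional_closed[OF F']
  have Fg: "F (gen [g]) \<in> carrier K" if "g \<in> carrier G" for g using FK that by (auto simp: tuples_1)
  have "F (gen [g \<otimes>\<^bsub>G\<^esub> h]) = F (gen [g]) \<oplus>\<^bsub>K\<^esub> F (gen [h])" if gh: "g \<in> carrier G" "h \<in> carrier G" for g h
  proof -
    have x: "[g, h] \<in> tuples G (Suc 1)" using gh by (simp add: tuples_def)
    then have "F (bd 1 (gen [g, h])) = \<zero>\<^bsub>K\<^esub>"
      using annihilatorD(4)[OF F] gen_closed by (auto simp: bar_boundaries_def)
    then have "F (gen [h]) \<ominus>\<^bsub>K\<^esub> F (gen [g \<otimes>\<^bsub>G\<^esub> h]) \<oplus>\<^bsub>K\<^esub> F (gen [g]) = \<zero>\<^bsub>K\<^esub>"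
      using functional_gen_bd[OF F' x] cobar_1[OF gh FK] by simp
    then show ?thesis
      using Fg[OF gh(1)] Fg[OF gh(2)] Fg[OF G.m_closed[OF gh]]
      by (simp add: K.minus_add_add_eq_zero_iff)
  qed
  then show ?thesis using Fg by (auto simp: characters_def)
qed

text \<open>
  A character is determined by its values on \<open>s\<close> chains that span \<open>H\<^sub>1\<close>.
\<close>

lemma card_characters_le:
  assumes "edim K (group_homology 1 G K) = enat s" "finite (carrier K)"
  shows "finite (characters K G)" "card (characters K G) \<le> card (carrier K) ^ s"
proof -
  interpret Q: quotient_space K "C 1" "bar_boundaries K G 1" by (rule quotient_space_1)
  let ?L = "\<lambda>\<phi>. pairing K (\<lambda>x. \<phi> (hd x))"
  let ?B = "bar_boundaries K G 1"
  obtain z where z: "z \<in> {..<s} \<rightarrow> carrier (C 1)" and det: "\<forall>f\<in>annihilator K (C 1) ?B.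
    (\<forall>i<s. f (z i) = \<zero>\<^bsub>K\<^esub>) \<longrightarrow> (\<forall>v\<in>carrier (C 1). f v = \<zero>\<^bsub>K\<^esub>)"
    using Q.detecting_vectors[of s] assms(1) unfolding homology_1 by blast
  define E where "E \<phi> = restrict (\<lambda>i. ?L \<phi> (z i)) {..<s}" for \<phi>
  have BC: "?B \<subseteq> carrier (C 1)" using submodule.subset[OF submodule_boundaries] .
  have zC: "z i \<in> carrier (C 1)" if "i < s" for i using z that by auto
  have inj: "inj_on E (characters K G)"
  proof (rule inj_onI)
    fix \<phi> \<psi> assume \<phi>: "\<phi> \<in> characters K G" and \<psi>: "\<psi> \<in> characters K G" and eq: "E \<phi> = E \<psi>"
    note A = character_functional[OF \<phi>] and B = character_functional[OF \<psi>]
    have m1: "\<ominus>\<^bsub>K\<^esub> \<one>\<^bsub>K\<^esub> \<in> carrier K" by simp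
    let ?D = "\<lambda>v. ?L \<phi> v \<oplus>\<^bsub>K\<^esub> (\<ominus>\<^bsub>K\<^esub> \<one>\<^bsub>K\<^esub>) \<otimes>\<^bsub>K\<^esub> ?L \<psi> v"
    have D: "?D \<in> annihilator K (C 1) ?B" by (rule Q.annihilator_lincomb[OF A B m1 BC])
    have "\<forall>i<s. ?D (z i) = \<zero>\<^bsub>K\<^esub>"
    proof (intro allI impI)
      fix i assume i: "i < s"
      have "?L \<phi> (z i) = ?L \<psi> (z i)" using eq i unfolding E_def by (metis lessThan_iff restrict_apply')
      then show "?D (z i) = \<zero>\<^bsub>K\<^esub>" using annihilatorD(1)[OF B zC[OF i]] by (simp add: K.l_minus K.r_neg)
    qed
    note D0 = bspec[OF det D, THEN mp, OF this, THEN bspec]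
    show "\<phi> = \<psi>"
    proof (rule characters_eqI[OF \<phi> \<psi>])
      fix g assume g: "g \<in> carrier G"
      have x: "[g] \<in> tuples G 1" using g by (simp add: tuples_1)
      have "(\<lambda>x. \<phi> (hd x)) \<in> tuples G 1 \<rightarrow> carrier K" "(\<lambda>x. \<psi> (hd x)) \<in> tuples G 1 \<rightarrow> carrier K"
        using charactersD(1)[OF \<phi>] charactersD(1)[OF \<psi>] by (auto simp: tuples_1)
      then have "\<phi> g \<oplus>\<^bsub>K\<^esub> (\<ominus>\<^bsub>K\<^esub> \<one>\<^bsub>K\<^esub>) \<otimes>\<^bsub>K\<^esub> \<psi> g = \<zero>\<^bsub>K\<^esub>"
        using D0[OF gen_closed[OF x]] gen_eval[OF x] by simp
      then show "\<phi> g = \<psi> g"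
        using charactersD(1)[OF \<phi> g] charactersD(1)[OF \<psi> g]
        by (simp add: K.l_minus flip: a_minus_def)
    qed
  qed
  have sub: "E ` characters K G \<subseteq> {..<s} \<rightarrow>\<^sub>E carrier K"
  proof (rule image_subsetI)
    fix \<phi> assume "\<phi> \<in> characters K G"
    from annihilatorD(1)[OF character_functional[OF this]]
    show "E \<phi> \<in> {..<s} \<rightarrow>\<^sub>E carrier K"
      unfolding E_def restrict_PiE_iff using zC by blast
  qed
  have fin: "finite ({..<s} \<rightarrow>\<^sub>E carrier K)" using assms(2) by (simp add: finite_PiE)
  show fin': "finite (characters K G)" by (rule finite_imageD[OF finite_subset[OF sub fin] inj])
  have "card (characters K G) = card (E ` characters K G)" using inj by (simp add: card_image)
  also have "\<dots> \<le> card ({..<s} \<rightarrow>\<^sub>E carrier K)" using card_mono[OF fin sub] .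
  finally show "card (characters K G) \<le> card (carrier K) ^ s" by (simp add: card_funcsetE)
qed

text \<open>
  Functionals on \<open>H\<^sub>1\<close> take arbitrary values on \<open>r\<close> suitable chains, and functionals with
  different values come from different characters.
\<close>

lemma card_characters_ge:
  assumes "enat r \<le> edim K (group_homology 1 G K)" "finite (characters K G)"
  shows "card (carrier K) ^ r \<le> card (characters K G)"
proof -
  interpret Q: quotient_space K "C 1" "bar_boundaries K G 1" by (rule quotient_space_1)
  let ?A = "annihilator K (C 1) (bar_boundaries K G 1)"
  obtain z where z: "z \<in> {..<r} \<rightarrow> carrier (C 1)"
    and ip: "\<And>t. t \<in> {..<r} \<rightarrow> carrier K \<Longrightarrow> \<exists>f\<in>?A. \<forall>i<r. f (z i) = t i"
    using Q.functionals_interpolate[of r] assms(1) unfolding homology_1 by blast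
  define F where "F t = (SOME f. f \<in> ?A \<and> (\<forall>i<r. f (z i) = t i))" for t
  have F: "F t \<in> ?A" "\<And>i. i < r \<Longrightarrow> F t (z i) = t i" if "t \<in> {..<r} \<rightarrow>\<^sub>E carrier K" for t
  proof -
    have "\<exists>f. f \<in> ?A \<and> (\<forall>i<r. f (z i) = t i)" using ip[of t] that by (auto simp: PiE_iff)
    from someI_ex[OF this] show "F t \<in> ?A" "\<And>i. i < r \<Longrightarrow> F t (z i) = t i" by (auto simp: F_def)
  qed
  define \<Phi> where "\<Phi> t = restrict (\<lambda>g. F t (gen [g])) (carrier G)" for t
  have "inj_on \<Phi> ({..<r} \<rightarrow>\<^sub>E carrier K)"
  proof (rule inj_onI)
    fix s t assume s: "s \<in> {..<r} \<rightarrow>\<^sub>E carrier K" and t: "t \<in> {..<r} \<rightarrow>\<^sub>E carrier K" and eq: "\<Phi> s = \<Phi> t"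
    have Fs: "F s \<in> annihilator K (C 1) {}" and Ft: "F t \<in> annihilator K (C 1) {}"
      using F(1)[OF s] F(1)[OF t] annihilator_antimono by blast+
    have gens: "F s (gen x) = F t (gen x)" if x: "x \<in> tuples G 1" for x
    proof -
      obtain g where g: "g \<in> carrier G" "x = [g]" using x by (auto simp: tuples_1)
      then show ?thesis using fun_cong[OF eq, of g] by (simp add: \<Phi>_def)
    qed
    have "F s v = F t v" if v: "v \<in> carrier (C 1)" for v
    proof -
      have "pairing K (\<lambda>x. F s (gen x)) v = pairing K (\<lambda>x. F t (gen x)) v"
        unfolding pairing_def
        using v gens gen_functional_closed[OF Ft]
        by (intro K.finsum_cong') (auto simp: chain_iff subset_iff Pi_iff)
      then show ?thesis using functional_eq_pairing[OF Fs v] functional_eq_pairing[OF Ft v] by simp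
    qed
    then show "s = t" using F(2)[OF s] F(2)[OF t] z
      by (intro PiE_ext[OF s t]) (metis Pi_mem lessThan_iff)
  qed
  moreover have "\<Phi> ` ({..<r} \<rightarrow>\<^sub>E carrier K) \<subseteq> characters K G"
    unfolding \<Phi>_def using functional_character F(1) by blast
  ultimately have "card ({..<r} \<rightarrow>\<^sub>E carrier K) \<le> card (characters K G)"
    using assms(2) card_inj_on_le by blast
  then show ?thesis by (simp add: card_funcsetE)
qed

text \<open>
  A functional on the boundaries has to be extended to all \<open>n\<close>-chains. Choose \<open>f\<^sub>0\<close> with
  \<open>F f\<^sub>0 = 1\<close>, and let \<open>H\<close> vanish on the boundaries of \<open>ker F\<close> and be 1 on the boundary of \<open>f\<^sub>0\<close>; such
  an \<open>H\<close> exists by \<open>separating_functional\<close>, and it is as required because every chain differs from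
  an element of \<open>ker F\<close> by a multiple of \<open>f\<^sub>0\<close>.
\<close>

lemma functional_factors_through_boundary:
  assumes F: "F \<in> annihilator K (C (Suc n)) (bar_cycles K G (Suc n))"
  shows "\<exists>H\<in>annihilator K (C n) {}. \<forall>f\<in>carrier (C (Suc n)). F f = H (bd n f)"
proof -
  interpret C1: vectorspace K "C n" by (rule chains_vectorspace)
  interpret C2: vectorspace K "C (Suc n)" by (rule chains_vectorspace)
  note FD = annihilatorD[OF F]
  show ?thesis
  proof (cases "\<exists>f\<in>carrier (C (Suc n)). F f \<noteq> \<zero>\<^bsub>K\<^esub>")
    case False
    have "(\<lambda>_. \<zero>\<^bsub>K\<^esub>) \<in> annihilator K (C n) {}" by (rule annihilatorI) auto
    then show ?thesis using False by (intro bexI[of _ "\<lambda>_. \<zero>\<^bsub>K\<^esub>"]) auto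
  next
    case True
    then obtain f1 where f1: "f1 \<in> carrier (C (Suc n))" "F f1 \<noteq> \<zero>\<^bsub>K\<^esub>" by blast
    define f0 where "f0 = inv\<^bsub>K\<^esub> (F f1) \<odot>\<^bsub>C (Suc n)\<^esub> f1"
    have i: "inv\<^bsub>K\<^esub> (F f1) \<in> carrier K" "inv\<^bsub>K\<^esub> (F f1) \<otimes>\<^bsub>K\<^esub> F f1 = \<one>\<^bsub>K\<^esub>"
      using FD(1)[OF f1(1)] f1(2) K.field_Units by auto
    have f0: "f0 \<in> carrier (C (Suc n))" "F f0 = \<one>\<^bsub>K\<^esub>"
      using f1 i by (auto simp: f0_def FD(3) simp del: chain_ops)
    define U where "U = bd n ` {f \<in> carrier (C (Suc n)). F f = \<zero>\<^bsub>K\<^esub>}"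
    have F0: "F \<zero>\<^bsub>C (Suc n)\<^esub> = \<zero>\<^bsub>K\<^esub>"
      using FD(4) submodule.zero_closed[OF submodule_cycles] by blast
    have U: "submodule K U (C n)"
    proof (rule C1.submoduleI_vs)
      show "U \<subseteq> carrier (C n)" using bd_closed by (auto simp: U_def)
      have "\<zero>\<^bsub>C n\<^esub> = bd n \<zero>\<^bsub>C (Suc n)\<^esub>" by (rule bd_zero[symmetric])
      then show "\<zero>\<^bsub>C n\<^esub> \<in> U" unfolding U_def using F0 C2.M.zero_closed by blast
      show "v \<oplus>\<^bsub>C n\<^esub> w \<in> U" if "v \<in> U" "w \<in> U" for v w
        using that unfolding U_def
        by (auto simp: FD(2) simp flip: bd_add simp del: chain_ops)
      show "c \<odot>\<^bsub>C n\<^esub> v \<in> U" if "c \<in> carrier K" "v \<in> U" for c v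
        using that unfolding U_def
        by (auto simp: FD(3) simp flip: bd_smult simp del: chain_ops)
    qed
    have kerF: "f \<oplus>\<^bsub>C (Suc n)\<^esub> (\<ominus>\<^bsub>K\<^esub> c) \<odot>\<^bsub>C (Suc n)\<^esub> f0 \<in> carrier (C (Suc n))"
      "F (f \<oplus>\<^bsub>C (Suc n)\<^esub> (\<ominus>\<^bsub>K\<^esub> c) \<odot>\<^bsub>C (Suc n)\<^esub> f0) = F f \<ominus>\<^bsub>K\<^esub> c"
      if "f \<in> carrier (C (Suc n))" "c \<in> carrier K" for f c
      using that f0 by (auto simp: FD(2) FD(3) K.l_minus a_minus_def simp del: chain_ops)
    have "bd n f0 \<notin> U"
    proof
      assume "bd n f0 \<in> U"
      then obtain k where k: "k \<in> carrier (C (Suc n))" "F k = \<zero>\<^bsub>K\<^esub>" "bd n f0 = bd n k" by (auto simp: U_def)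
      let ?d = "k \<oplus>\<^bsub>C (Suc n)\<^esub> (\<ominus>\<^bsub>K\<^esub> \<one>\<^bsub>K\<^esub>) \<odot>\<^bsub>C (Suc n)\<^esub> f0"
      have "bd n ?d = bd n k \<oplus>\<^bsub>C n\<^esub> (\<ominus>\<^bsub>K\<^esub> \<one>\<^bsub>K\<^esub>) \<odot>\<^bsub>C n\<^esub> bd n k"
        using k f0 by (simp add: bd_add bd_smult del: chain_ops)
      also have "\<dots> = \<zero>\<^bsub>C n\<^esub>"
        using bd_closed[OF k(1)] by (auto simp: chain_iff K.l_minus K.r_neg)
      finally have "F ?d = \<zero>\<^bsub>K\<^esub>" using kerF(1)[OF k(1)] FD(4) by (auto simp del: chain_ops)
      then show False using kerF(2)[OF k(1)] k(2) by (auto simp del: chain_ops simp: a_minus_def)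
    qed
    then obtain H where H: "H \<in> annihilator K (C n) U" "H (bd n f0) = \<one>\<^bsub>K\<^esub>"
      using C1.separating_functional[OF U] bd_closed[OF f0(1)] by blast
    note HD = annihilatorD[OF H(1)]
    have "F f = H (bd n f)" if f: "f \<in> carrier (C (Suc n))" for f
    proof -
      note c = FD(1)[OF f]
      let ?e = "f \<oplus>\<^bsub>C (Suc n)\<^esub> (\<ominus>\<^bsub>K\<^esub> F f) \<odot>\<^bsub>C (Suc n)\<^esub> f0"
      have "bd n ?e \<in> U" unfolding U_def using kerF[OF f c] c by (auto simp: a_minus_def K.r_neg simp del: chain_ops)
      then have "H (bd n ?e) = \<zero>\<^bsub>K\<^esub>" by (rule HD(4))
      moreover have "H (bd n ?e) = H (bd n f) \<oplus>\<^bsub>K\<^esub> (\<ominus>\<^bsub>K\<^esub> F f)"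
        using f f0 c bd_closed[OF f] bd_closed[OF f0(1)] H(2)
        by (simp add: bd_add bd_smult HD(2) HD(3) del: chain_ops)
      ultimately have "H (bd n f) \<ominus>\<^bsub>K\<^esub> F f = \<zero>\<^bsub>K\<^esub>" by (simp only: a_minus_def)
      then show ?thesis using c HD(1)[OF bd_closed[OF f]] by simp
    qed
    moreover have "H \<in> annihilator K (C n) {}" using H(1) annihilator_antimono by blast
    ultimately show ?thesis by blast
  qed
qed

lemma coboundary_if_vanishes_on_cycles:
  assumes F: "F \<in> annihilator K (C 2) (bar_cycles K G 2)"
  shows "\<exists>\<beta>\<in>carrier G \<rightarrow> carrier K. \<forall>g\<in>carrier G. \<forall>h\<in>carrier G.
    F (gen [g, h]) = \<beta> h \<ominus>\<^bsub>K\<^esub> \<beta> (g \<otimes>\<^bsub>G\<^esub> h) \<oplus>\<^bsub>K\<^esub> \<beta> g"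
proof -
  have "(2::nat) = Suc 1" by simp
  with F have "F \<in> annihilator K (C (Suc 1)) (bar_cycles K G (Suc 1))" by (simp only:)
  from functional_factors_through_boundary[OF this]
  obtain H where H: "H \<in> annihilator K (C 1) {}" and FH: "\<And>f. f \<in> carrier (C (Suc 1)) \<Longrightarrow> F f = H (bd 1 f)"
    by blast
  show ?thesis
  proof (intro bexI[of _ "\<lambda>g. H (gen [g])"] ballI)
    show "(\<lambda>g. H (gen [g])) \<in> carrier G \<rightarrow> carrier K"
      using gen_functional_closed[OF H] by (auto simp: tuples_1)
    fix g h assume gh: "g \<in> carrier G" "h \<in> carrier G"
    then have x: "[g, h] \<in> tuples G (Suc 1)" by (simp add: tuples_def)
    show "F (gen [g, h]) = H (gen [h]) \<ominus>\<^bsub>K\<^esub> H (gen [g \<otimes>\<^bsub>G\<^esub> h]) \<oplus>\<^bsub>K\<^esub> H (gen [g])"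
      using FH[OF gen_closed[OF x]] functional_gen_bd[OF H x] cobar_1[OF gh gen_functional_closed[OF H]]
      by simp
  qed
qed

text \<open>
  The pairing with a cocycle induces a functional on \<open>H\<^sub>2\<close>. If two cocycles agree on chains that
  span \<open>H\<^sub>2\<close>, their difference vanishes on all cycles, hence is a coboundary.
\<close>

lemma cocycles_cohomologous:
  assumes "edim K (group_homology 2 G K) = enat d"
  shows "\<exists>z\<in>{..<d} \<rightarrow> carrier (C 2). \<forall>a\<in>cocycles2 K G. \<forall>b\<in>cocycles2 K G.
    (\<forall>i<d. pairing K a (z i) = pairing K b (z i)) \<longrightarrow>
    (\<exists>\<beta>\<in>carrier G \<rightarrow> carrier K. \<forall>g\<in>carrier G. \<forall>h\<in>carrier G.
       a [g, h] \<ominus>\<^bsub>K\<^esub> b [g, h] = \<beta> h \<ominus>\<^bsub>K\<^esub> \<beta> (g \<otimes>\<^bsub>G\<^esub> h) \<oplus>\<^bsub>K\<^esub> \<beta> g)"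
proof -
  let ?Z = "(C 2)\<lparr>carrier := bar_cycles K G 2\<rparr>"
  let ?B = "bar_boundaries K G 2"
  interpret C2: vectorspace K "C 2" by (rule chains_vectorspace)
  interpret Q: quotient_space K ?Z ?B by (rule quotient_space_2)
  have ZC: "bar_cycles K G 2 \<subseteq> carrier (C 2)" by (auto simp: numeral_2_eq_2)
  obtain z where z: "z \<in> {..<d} \<rightarrow> carrier ?Z" and det: "\<forall>f\<in>annihilator K ?Z ?B.
    (\<forall>i<d. f (z i) = \<zero>\<^bsub>K\<^esub>) \<longrightarrow> (\<forall>v\<in>carrier ?Z. f v = \<zero>\<^bsub>K\<^esub>)"
    using Q.detecting_vectors[of d] assms unfolding homology_2 by blast
  have zZ: "z i \<in> bar_cycles K G 2" if "i < d" for i using z that by auto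
  show ?thesis
  proof (intro bexI[of _ z] ballI impI)
    show "z \<in> {..<d} \<rightarrow> carrier (C 2)" using z ZC by auto
    fix a b assume ab: "a \<in> cocycles2 K G" "b \<in> cocycles2 K G"
      and eq: "\<forall>i<d. pairing K a (z i) = pairing K b (z i)"
    have aK: "a \<in> tuples G 2 \<rightarrow> carrier K" and bK: "b \<in> tuples G 2 \<rightarrow> carrier K"
      using ab by (auto simp: cocycles2_def)
    have kills: "pairing K c \<in> annihilator K (C 2) ?B" if "c \<in> cocycles2 K G" for c
    proof -
      have c: "c \<in> tuples G 2 \<rightarrow> carrier K" "\<And>x. x \<in> tuples G (Suc 2) \<Longrightarrow> cobar K G 2 c x = \<zero>\<^bsub>K\<^esub>"
        using that by (auto simp: cocycles2_def numeral_3_eq_3 numeral_2_eq_2)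
      show ?thesis using pairing_functional[OF c(1)] pairing_bd[OF c(1) _ c(2)]
        by (auto simp: annihilator_def bar_boundaries_def)
    qed
    let ?D = "\<lambda>v. pairing K a v \<oplus>\<^bsub>K\<^esub> (\<ominus>\<^bsub>K\<^esub> \<one>\<^bsub>K\<^esub>) \<otimes>\<^bsub>K\<^esub> pairing K b v"
    have D: "?D \<in> annihilator K (C 2) ?B"
      by (rule C2.annihilator_lincomb[OF kills[OF ab(1)] kills[OF ab(2)]])
        (use submodule.subset[OF submodule_boundaries] in auto)
    have DZ: "?D \<in> annihilator K ?Z ?B" by (rule annihilator_restrict[OF D ZC])
    have "\<forall>i<d. ?D (z i) = \<zero>\<^bsub>K\<^esub>"
    proof (intro allI impI)
      fix i assume i: "i < d"
      then have "z i \<in> carrier (C 2)" using zZ ZC by blast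
      from annihilatorD(1)[OF kills[OF ab(2)] this] show "?D (z i) = \<zero>\<^bsub>K\<^esub>"
        using eq i by (simp add: K.l_minus K.r_neg)
    qed
    note D0 = bspec[OF det DZ, THEN mp, OF this, THEN bspec]
    have "?D \<in> annihilator K (C 2) (bar_cycles K G 2)"
    proof (rule annihilatorI)
      fix w assume "w \<in> bar_cycles K G 2"
      then show "?D w = \<zero>\<^bsub>K\<^esub>" using D0[of w] by simp
    qed (rule annihilatorD[OF D]; assumption)+
    from coboundary_if_vanishes_on_cycles[OF this] obtain \<beta> where \<beta>: "\<beta> \<in> carrier G \<rightarrow> carrier K"
      "\<And>g h. g \<in> carrier G \<Longrightarrow> h \<in> carrier G \<Longrightarrow>
         ?D (gen [g, h]) = \<beta> h \<ominus>\<^bsub>K\<^esub> \<beta> (g \<otimes>\<^bsub>G\<^esub> h) \<oplus>\<^bsub>K\<^esub> \<beta> g" by blast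
    have "a [g, h] \<ominus>\<^bsub>K\<^esub> b [g, h] = \<beta> h \<ominus>\<^bsub>K\<^esub> \<beta> (g \<otimes>\<^bsub>G\<^esub> h) \<oplus>\<^bsub>K\<^esub> \<beta> g"
      if gh: "g \<in> carrier G" "h \<in> carrier G" for g h
    proof -
      have x: "[g, h] \<in> tuples G 2" using gh by (simp add: tuples_2)
      then have "b [g, h] \<in> carrier K" using bK by auto
      then show ?thesis using \<beta>(2)[OF gh] gen_eval[OF x aK] gen_eval[OF x bK]
        by (simp add: K.l_minus a_minus_def)
    qed
    then show "\<exists>\<beta>\<in>carrier G \<rightarrow> carrier K. \<forall>g\<in>carrier G. \<forall>h\<in>carrier G.
       a [g, h] \<ominus>\<^bsub>K\<^esub> b [g, h] = \<beta> h \<ominus>\<^bsub>K\<^esub> \<beta> (g \<otimes>\<^bsub>G\<^esub> h) \<oplus>\<^bsub>K\<^esub> \<beta> g"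
      using \<beta>(1) by blast
  qed
qed

end

section \<open>Dual systems of characters and the first Betti number of a joint kernel\<close>

text \<open>
  Linear independence of characters, witnessed by group elements.
\<close>

definition dual_system :: "'k ring \<Rightarrow> 'g monoid \<Rightarrow> nat \<Rightarrow> (nat \<Rightarrow> 'g \<Rightarrow> 'k) \<Rightarrow> (nat \<Rightarrow> 'g) \<Rightarrow> bool" where
  "dual_system K G m \<phi> g \<longleftrightarrow>
     (\<forall>i<m. \<phi> i \<in> characters K G \<and> g i \<in> carrier G) \<and>
     (\<forall>i<m. \<forall>j<m. \<phi> i (g j) = (if i = j then \<one>\<^bsub>K\<^esub> else \<zero>\<^bsub>K\<^esub>))"

text \<open>
  Closure under \<open>c (\<phi> - \<psi>)\<close> says that a nonempty \<open>X\<close> is a linear subspace of the characters.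
\<close>

definition character_space :: "'k ring \<Rightarrow> 'g monoid \<Rightarrow> ('g \<Rightarrow> 'k) set \<Rightarrow> bool" where
  "character_space K G X \<longleftrightarrow> X \<subseteq> characters K G \<and>
     (\<forall>\<phi>\<in>X. \<forall>\<psi>\<in>X. \<forall>c\<in>carrier K. restrict (\<lambda>g. c \<otimes>\<^bsub>K\<^esub> (\<phi> g \<ominus>\<^bsub>K\<^esub> \<psi> g)) (carrier G) \<in> X)"

definition joint_kernel :: "'k ring \<Rightarrow> 'g monoid \<Rightarrow> nat \<Rightarrow> (nat \<Rightarrow> 'g \<Rightarrow> 'k) \<Rightarrow> 'g set" where
  "joint_kernel K G n \<phi> = {h \<in> carrier G. \<forall>i<n. \<phi> i h = \<zero>\<^bsub>K\<^esub>}"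

lemma dual_systemD:
  assumes "dual_system K G m \<phi> g" "i < m"
  shows "\<phi> i \<in> characters K G" "g i \<in> carrier G" "j < m \<Longrightarrow> \<phi> i (g j) = (if i = j then \<one>\<^bsub>K\<^esub> else \<zero>\<^bsub>K\<^esub>)"
  using assms by (auto simp: dual_system_def)

text \<open>
  The additive group of \<open>K\<close> is generated by 1, so \<open>K\<close> is a field of prime order. This allows
  values of characters to be corrected by powers of group elements.
\<close>

locale bar_complex_prime = bar_complex K G for K :: "'k ring" and G :: "'g monoid" +
  assumes finite_K: "finite (carrier K)"
    and prime_field: "\<And>c. c \<in> carrier K \<Longrightarrow> \<exists>k::nat. c = [k] \<cdot>\<^bsub>K\<^esub> \<one>\<^bsub>K\<^esub>"
begin

lemma card_K: "card (carrier K) > 1"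
proof -
  have "{\<zero>\<^bsub>K\<^esub>, \<one>\<^bsub>K\<^esub>} \<subseteq> carrier K" by auto
  from card_mono[OF finite_K this] show ?thesis by simp
qed

lemma character_one: "\<phi> \<in> characters K G \<Longrightarrow> \<phi> \<one>\<^bsub>G\<^esub> = \<zero>\<^bsub>K\<^esub>"
  using charactersD(1,2)[of \<phi> K G "\<one>\<^bsub>G\<^esub>"] charactersD(2)[of \<phi> K G "\<one>\<^bsub>G\<^esub>" "\<one>\<^bsub>G\<^esub>"]
  by (metis G.one_closed G.r_one K.add.r_cancel_one')

lemma character_pow:
  assumes "\<phi> \<in> characters K G" "g \<in> carrier G"
  shows "\<phi> (g [^]\<^bsub>G\<^esub> (k::nat)) = [k] \<cdot>\<^bsub>K\<^esub> \<one>\<^bsub>K\<^esub> \<otimes>\<^bsub>K\<^esub> \<phi> g"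
  using assms charactersD(1)[OF assms]
  by (induction k) (simp_all add: character_one charactersD(2) K.l_distr)

lemma all_characters_space: "character_space K G (characters K G)"
  unfolding character_space_def
proof (intro conjI ballI)
  fix \<phi> \<psi> c assume \<phi>: "\<phi> \<in> characters K G" and \<psi>: "\<psi> \<in> characters K G" and c: "c \<in> carrier K"
  have "c \<otimes>\<^bsub>K\<^esub> (\<phi> (g \<otimes>\<^bsub>G\<^esub> h) \<ominus>\<^bsub>K\<^esub> \<psi> (g \<otimes>\<^bsub>G\<^esub> h)) =
      c \<otimes>\<^bsub>K\<^esub> (\<phi> g \<ominus>\<^bsub>K\<^esub> \<psi> g) \<oplus>\<^bsub>K\<^esub> c \<otimes>\<^bsub>K\<^esub> (\<phi> h \<ominus>\<^bsub>K\<^esub> \<psi> h)"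
    if gh: "g \<in> carrier G" "h \<in> carrier G" for g h
  proof -
    have "c \<otimes>\<^bsub>K\<^esub> (u \<oplus>\<^bsub>K\<^esub> v \<ominus>\<^bsub>K\<^esub> (w \<oplus>\<^bsub>K\<^esub> x)) = c \<otimes>\<^bsub>K\<^esub> (u \<ominus>\<^bsub>K\<^esub> w) \<oplus>\<^bsub>K\<^esub> c \<otimes>\<^bsub>K\<^esub> (v \<ominus>\<^bsub>K\<^esub> x)"
      if "u \<in> carrier K" "v \<in> carrier K" "w \<in> carrier K" "x \<in> carrier K" for u v w x
      using that c by algebra
    then show ?thesis using charactersD(1)[OF \<phi>] charactersD(1)[OF \<psi>] gh
      by (simp add: charactersD(2)[OF \<phi>] charactersD(2)[OF \<psi>])
  qed
  then show "restrict (\<lambda>g. c \<otimes>\<^bsub>K\<^esub> (\<phi> g \<ominus>\<^bsub>K\<^esub> \<psi> g)) (carrier G) \<in> characters K G"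
    using charactersD(1)[OF \<phi>] charactersD(1)[OF \<psi>] c by (auto simp: characters_def)
qed simp

lemma vanishing_characters_space:
  assumes "N \<subseteq> carrier G"
  shows "character_space K G {\<phi> \<in> characters K G. \<forall>h\<in>N. \<phi> h = \<zero>\<^bsub>K\<^esub>}"
  using all_characters_space assms unfolding character_space_def
  by (auto simp: a_minus_def subset_iff)

text \<open>
  Multiplying \<open>h\<close> by powers of the \<open>g i\<close> makes the \<open>\<phi> i\<close> vanish one after the other, without
  changing the value of a character that vanishes on all \<open>g i\<close>.
\<close>

lemma orthogonalise:
  assumes dual: "dual_system K G m \<phi> g" and h: "h \<in> carrier G" and "l \<le> m"
  shows "\<exists>h'\<in>carrier G. (\<forall>i<l. \<phi> i h' = \<zero>\<^bsub>K\<^esub>) \<and>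
    (\<forall>\<psi>\<in>characters K G. (\<forall>i<m. \<psi> (g i) = \<zero>\<^bsub>K\<^esub>) \<longrightarrow> \<psi> h' = \<psi> h)"
  using \<open>l \<le> m\<close>
proof (induction l)
  case 0
  then show ?case using h by auto
next
  case (Suc l)
  then obtain h' where h': "h' \<in> carrier G" "\<forall>i<l. \<phi> i h' = \<zero>\<^bsub>K\<^esub>"
    "\<forall>\<psi>\<in>characters K G. (\<forall>i<m. \<psi> (g i) = \<zero>\<^bsub>K\<^esub>) \<longrightarrow> \<psi> h' = \<psi> h" by auto
  note D = dual_systemD[OF dual]
  have l: "l < m" using Suc.prems by simp
  note ch = charactersD[OF D(1)[OF l]]
  obtain k :: nat where k: "\<ominus>\<^bsub>K\<^esub> \<phi> l h' = [k] \<cdot>\<^bsub>K\<^esub> \<one>\<^bsub>K\<^esub>"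
    using prime_field[of "\<ominus>\<^bsub>K\<^esub> \<phi> l h'"] ch(1)[OF h'(1)] by auto
  let ?h = "h' \<otimes>\<^bsub>G\<^esub> g l [^]\<^bsub>G\<^esub> k"
  have val: "\<psi> ?h = \<psi> h' \<oplus>\<^bsub>K\<^esub> (\<ominus>\<^bsub>K\<^esub> \<phi> l h') \<otimes>\<^bsub>K\<^esub> \<psi> (g l)" if "\<psi> \<in> characters K G" for \<psi>
    using that h'(1) D(2)[OF l] by (simp add: charactersD(2) character_pow k)
  have "\<phi> i ?h = \<zero>\<^bsub>K\<^esub>" if i: "i < Suc l" for i
  proof -
    have im: "i < m" using i l by simp
    show ?thesis
    proof (cases "i = l")
      case True
      then show ?thesis using val[OF D(1)[OF l]] D(3)[OF l l] ch(1)[OF h'(1)] by (simp add: K.r_neg)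
    next
      case False
      then show ?thesis using val[OF D(1)[OF im]] D(3)[OF im l] ch(1)[OF h'(1)] h'(2) i by simp
    qed
  qed
  moreover have "\<psi> ?h = \<psi> h" if \<psi>: "\<psi> \<in> characters K G" "\<forall>i<m. \<psi> (g i) = \<zero>\<^bsub>K\<^esub>" for \<psi>
  proof -
    have "\<psi> h' = \<psi> h" using h'(3) \<psi> by blast
    then show ?thesis
      using val[OF \<psi>(1)] \<psi>(2) l ch(1)[OF h'(1)] charactersD(1)[OF \<psi>(1) h] by simp
  qed
  moreover have "?h \<in> carrier G" using h'(1) D(2)[OF l] by simp
  ultimately show ?case by blast
qed

text \<open>
  There are only \<open>q^m\<close> possibilities for the values at \<open>g 0, ..., g (m - 1)\<close>, where \<open>q\<close> is the
  order of \<open>K\<close>. So two elements of \<open>X\<close> have the same values, and their difference, normalised, is the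
  new character.
\<close>

lemma extend_dual_system_step:
  assumes dual: "dual_system K G m \<phi> g" and X: "character_space K G X"
    and big: "\<not> (finite X \<and> card X \<le> card (carrier K) ^ m)"
  shows "\<exists>\<psi>\<in>X. \<exists>h. dual_system K G (Suc m) (\<phi>(m := \<psi>)) (g(m := h))"
proof -
  note D = dual_systemD[OF dual]
  have Xc: "X \<subseteq> characters K G" using X by (simp add: character_space_def)
  define E where "E \<psi> = restrict (\<lambda>i. \<psi> (g i)) {..<m}" for \<psi> :: "'g \<Rightarrow> 'k"
  have "\<not> inj_on E X"
  proof
    assume inj: "inj_on E X"
    have sub: "E ` X \<subseteq> {..<m} \<rightarrow>\<^sub>E carrier K"
    proof (rule image_subsetI)
      fix \<psi> assume "\<psi> \<in> X"
      then have "\<psi> \<in> characters K G" using Xc by auto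
      from charactersD(1)[OF this D(2)]
      show "E \<psi> \<in> {..<m} \<rightarrow>\<^sub>E carrier K" unfolding E_def restrict_PiE_iff by simp
    qed
    have fin: "finite ({..<m} \<rightarrow>\<^sub>E carrier K)" using finite_K by (simp add: finite_PiE)
    have "finite X" by (rule finite_imageD[OF finite_subset[OF sub fin] inj])
    moreover have "card X \<le> card (carrier K) ^ m"
      using card_mono[OF fin sub] inj by (simp add: card_image card_funcsetE)
    ultimately show False using big by simp
  qed
  then obtain \<psi>1 \<psi>2 where \<psi>: "\<psi>1 \<in> X" "\<psi>2 \<in> X" "E \<psi>1 = E \<psi>2" "\<psi>1 \<noteq> \<psi>2" by (auto simp: inj_on_def)
  have \<psi>c: "\<psi>1 \<in> characters K G" "\<psi>2 \<in> characters K G" using \<psi> Xc by auto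
  obtain h where h: "h \<in> carrier G" "\<psi>1 h \<noteq> \<psi>2 h" using \<psi>(4) characters_eqI[OF \<psi>c] by blast
  define d where "d = \<psi>1 h \<ominus>\<^bsub>K\<^esub> \<psi>2 h"
  have d: "d \<in> carrier K" "d \<noteq> \<zero>\<^bsub>K\<^esub>"
    using h charactersD(1)[OF \<psi>c(1) h(1)] charactersD(1)[OF \<psi>c(2) h(1)] by (auto simp: d_def)
  then have i: "inv\<^bsub>K\<^esub> d \<in> carrier K" "inv\<^bsub>K\<^esub> d \<otimes>\<^bsub>K\<^esub> d = \<one>\<^bsub>K\<^esub>" using K.field_Units by auto
  define \<theta> where "\<theta> = restrict (\<lambda>x. inv\<^bsub>K\<^esub> d \<otimes>\<^bsub>K\<^esub> (\<psi>1 x \<ominus>\<^bsub>K\<^esub> \<psi>2 x)) (carrier G)"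
  have \<theta>X: "\<theta> \<in> X" using X \<psi>(1,2) i(1) by (auto simp: character_space_def \<theta>_def)
  then have \<theta>c: "\<theta> \<in> characters K G" using Xc by auto
  have \<theta>g: "\<theta> (g j) = \<zero>\<^bsub>K\<^esub>" if "j < m" for j
  proof -
    have "\<psi>1 (g j) = \<psi>2 (g j)" using \<psi>(3) that unfolding E_def by (metis lessThan_iff restrict_apply')
    then show ?thesis using i(1) D(2)[OF that] charactersD(1)[OF \<psi>c(2) D(2)[OF that]]
      by (simp add: \<theta>_def a_minus_def K.r_neg)
  qed
  have \<theta>h: "\<theta> h = \<one>\<^bsub>K\<^esub>" using h i by (simp add: \<theta>_def flip: d_def)
  obtain h' where h': "h' \<in> carrier G" "\<forall>i<m. \<phi> i h' = \<zero>\<^bsub>K\<^esub>" "\<theta> h' = \<theta> h"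
    using orthogonalise[OF dual h(1) order_refl] \<theta>c \<theta>g by blast
  have "dual_system K G (Suc m) (\<phi>(m := \<theta>)) (g(m := h'))"
    unfolding dual_system_def using D \<theta>c h' \<theta>h \<theta>g by (auto simp: less_Suc_eq)
  then show ?thesis using \<theta>X by blast
qed

text \<open>
  The first \<open>n\<close> pairs are kept: they define the subgroup \<open>N\<close> below, and the additional ones
  only serve to count cup products.
\<close>

lemma extend_dual_system:
  assumes "dual_system K G n \<phi> g" "n \<le> r" "character_space K G X"
    and "\<not> (finite X \<and> card X < card (carrier K) ^ r)"
  shows "\<exists>\<phi>' g'. dual_system K G r \<phi>' g' \<and> (\<forall>i<n. \<phi>' i = \<phi> i \<and> g' i = g i) \<and> (\<forall>i. n \<le> i \<and> i < r \<longrightarrow> \<phi>' i \<in> X)"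
  using assms(2,4)
proof (induction r rule: dec_induct)
  case base
  show ?case using assms(1) by (intro exI[of _ \<phi>] exI[of _ g]) auto
next
  case (step r)
  have "card (carrier K) ^ r < card (carrier K) ^ Suc r" using card_K by simp
  then have "\<not> (finite X \<and> card X \<le> card (carrier K) ^ r)" "\<not> (finite X \<and> card X < card (carrier K) ^ r)"
    using step.prems by linarith+
  with step.IH obtain \<phi>' g' where *: "dual_system K G r \<phi>' g'"
    "\<forall>i<n. \<phi>' i = \<phi> i \<and> g' i = g i" "\<forall>i. n \<le> i \<and> i < r \<longrightarrow> \<phi>' i \<in> X" by blast
  obtain \<psi> h where \<psi>: "\<psi> \<in> X" and dual': "dual_system K G (Suc r) (\<phi>'(r := \<psi>)) (g'(r := h))"
    using extend_dual_system_step[OF *(1) assms(3)] \<open>\<not> (finite X \<and> card X \<le> card (carrier K) ^ r)\<close> by blast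
  have "\<forall>i<n. (\<phi>'(r := \<psi>)) i = \<phi> i \<and> (g'(r := h)) i = g i"
    "\<forall>i. n \<le> i \<and> i < Suc r \<longrightarrow> (\<phi>'(r := \<psi>)) i \<in> X"
    using * step.hyps \<psi> by (auto simp: less_Suc_eq)
  with dual' show ?case by blast
qed

lemma exists_dual_system:
  assumes "character_space K G X" "\<not> (finite X \<and> card X < card (carrier K) ^ r)"
  obtains \<phi> g where "dual_system K G r \<phi> g" "\<forall>i<r. \<phi> i \<in> X"
proof -
  have "dual_system K G 0 (\<lambda>_ _. \<zero>\<^bsub>K\<^esub>) (\<lambda>_. \<one>\<^bsub>G\<^esub>)" by (simp add: dual_system_def)
  from extend_dual_system[OF this le0 assms] show thesis
    using that by (elim exE conjE) simp
qed

lemma joint_kernel_normal: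
  assumes "\<And>i. i < n \<Longrightarrow> \<phi> i \<in> characters K G"
  shows "joint_kernel K G n \<phi> \<lhd> G"
proof -
  note ch = charactersD[OF assms]
  have inv: "\<phi> i (inv\<^bsub>G\<^esub> x) = \<ominus>\<^bsub>K\<^esub> \<phi> i x" if "i < n" "x \<in> carrier G" for i x
    using ch(2)[OF that(1) G.inv_closed[OF that(2)] that(2)] that ch(1) character_one[OF assms[OF that(1)]]
    by (metis G.inv_closed G.l_inv K.minus_equality)
  show ?thesis
    unfolding G.normal_inv_iff
  proof (intro conjI ballI)
    show "subgroup (joint_kernel K G n \<phi>) G"
      using character_one[OF assms] inv ch
      by (intro subgroup.intro) (auto simp: joint_kernel_def)
  next
    fix x h assume "x \<in> carrier G" "h \<in> joint_kernel K G n \<phi>"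
    then show "x \<otimes>\<^bsub>G\<^esub> h \<otimes>\<^bsub>G\<^esub> inv\<^bsub>G\<^esub> x \<in> joint_kernel K G n \<phi>"
      using inv ch by (auto simp: joint_kernel_def K.r_neg)
  qed
qed

text \<open>
  The inhomogeneous 2-cocycle \<open>\<Sum> c\<^sub>i\<^sub>j (\<phi>\<^sub>i \<union> \<phi>\<^sub>j)\<close>, summed over the pairs \<open>(i, j)\<close> in \<open>P\<close>.
\<close>

definition cup_sum :: "(nat \<Rightarrow> 'g \<Rightarrow> 'k) \<Rightarrow> (nat \<times> nat) set \<Rightarrow> (nat \<times> nat \<Rightarrow> 'k) \<Rightarrow> 'g list \<Rightarrow> 'k" where
  "cup_sum \<phi> P c x = (\<Oplus>\<^bsub>K\<^esub>p\<in>P. c p \<otimes>\<^bsub>K\<^esub> (\<phi> (fst p) (x ! 0) \<otimes>\<^bsub>K\<^esub> \<phi> (snd p) (x ! 1)))"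

lemma cup_sum_cocycle:
  assumes \<phi>: "\<And>i. i < r \<Longrightarrow> \<phi> i \<in> characters K G" and P: "P \<subseteq> {..<r} \<times> {..<r}" and c: "c \<in> P \<rightarrow> carrier K"
  shows "cup_sum \<phi> P c \<in> cocycles2 K G"
proof -
  let ?A = "\<lambda>g h. cup_sum \<phi> P c [g, h]"
  have cK: "c p \<in> carrier K" if "p \<in> P" for p using c that by auto
  have \<phi>K: "\<phi> (fst p) g \<in> carrier K" "\<phi> (snd p) g \<in> carrier K" if "p \<in> P" "g \<in> carrier G" for p g
    using charactersD(1)[OF \<phi>] that P by auto
  have \<phi>m: "\<phi> (fst p) (g \<otimes>\<^bsub>G\<^esub> h) = \<phi> (fst p) g \<oplus>\<^bsub>K\<^esub> \<phi> (fst p) h"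
    "\<phi> (snd p) (g \<otimes>\<^bsub>G\<^esub> h) = \<phi> (snd p) g \<oplus>\<^bsub>K\<^esub> \<phi> (snd p) h"
    if "p \<in> P" "g \<in> carrier G" "h \<in> carrier G" for p g h
    using charactersD(2)[OF \<phi>] that P by auto
  have AK: "?A g h \<in> carrier K" if "g \<in> carrier G" "h \<in> carrier G" for g h
    unfolding cup_sum_def using cK \<phi>K that by (intro K.finsum_closed) auto
  have l: "?A (g \<otimes>\<^bsub>G\<^esub> h) k = ?A g k \<oplus>\<^bsub>K\<^esub> ?A h k"
    if ghk: "g \<in> carrier G" "h \<in> carrier G" "k \<in> carrier G" for g h k
  proof -
    have "?A (g \<otimes>\<^bsub>G\<^esub> h) k = (\<Oplus>\<^bsub>K\<^esub>p\<in>P. c p \<otimes>\<^bsub>K\<^esub> (\<phi> (fst p) g \<otimes>\<^bsub>K\<^esub> \<phi> (snd p) k) \<oplus>\<^bsub>K\<^esub> c p \<otimes>\<^bsub>K\<^esub> (\<phi> (fst p) h \<otimes>\<^bsub>K\<^esub> \<phi> (snd p) k))"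
      unfolding cup_sum_def
    proof (rule K.finsum_cong'[OF refl])
      show "(\<lambda>p. c p \<otimes>\<^bsub>K\<^esub> (\<phi> (fst p) g \<otimes>\<^bsub>K\<^esub> \<phi> (snd p) k) \<oplus>\<^bsub>K\<^esub> c p \<otimes>\<^bsub>K\<^esub> (\<phi> (fst p) h \<otimes>\<^bsub>K\<^esub> \<phi> (snd p) k)) \<in> P \<rightarrow> carrier K"
        using ghk cK \<phi>K by (intro Pi_I) simp
    qed (use ghk cK \<phi>K in \<open>simp add: \<phi>m K.l_distr K.r_distr\<close>)
    also have "\<dots> = ?A g k \<oplus>\<^bsub>K\<^esub> ?A h k"
      unfolding cup_sum_def using ghk cK \<phi>K by (subst K.finsum_addf) (simp_all add: Pi_iff)
    finally show ?thesis .
  qed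
  have r: "?A g (h \<otimes>\<^bsub>G\<^esub> k) = ?A g h \<oplus>\<^bsub>K\<^esub> ?A g k"
    if ghk: "g \<in> carrier G" "h \<in> carrier G" "k \<in> carrier G" for g h k
  proof -
    have "?A g (h \<otimes>\<^bsub>G\<^esub> k) = (\<Oplus>\<^bsub>K\<^esub>p\<in>P. c p \<otimes>\<^bsub>K\<^esub> (\<phi> (fst p) g \<otimes>\<^bsub>K\<^esub> \<phi> (snd p) h) \<oplus>\<^bsub>K\<^esub> c p \<otimes>\<^bsub>K\<^esub> (\<phi> (fst p) g \<otimes>\<^bsub>K\<^esub> \<phi> (snd p) k))"
      unfolding cup_sum_def
    proof (rule K.finsum_cong'[OF refl])
      show "(\<lambda>p. c p \<otimes>\<^bsub>K\<^esub> (\<phi> (fst p) g \<otimes>\<^bsub>K\<^esub> \<phi> (snd p) h) \<oplus>\<^bsub>K\<^esub> c p \<otimes>\<^bsub>K\<^esub> (\<phi> (fst p) g \<otimes>\<^bsub>K\<^esub> \<phi> (snd p) k)) \<in> P \<rightarrow> carrier K"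
        using ghk cK \<phi>K by (intro Pi_I) simp
    qed (use ghk cK \<phi>K in \<open>simp add: \<phi>m K.l_distr K.r_distr\<close>)
    also have "\<dots> = ?A g h \<oplus>\<^bsub>K\<^esub> ?A g k"
      unfolding cup_sum_def using ghk cK \<phi>K by (subst K.finsum_addf) (simp_all add: Pi_iff)
    finally show ?thesis .
  qed
  have A2: "cup_sum \<phi> P c \<in> tuples G 2 \<rightarrow> carrier K" using AK by (auto simp: tuples_2)
  have cancel: "u \<ominus>\<^bsub>K\<^esub> (v \<oplus>\<^bsub>K\<^esub> u) \<oplus>\<^bsub>K\<^esub> (w \<oplus>\<^bsub>K\<^esub> v \<ominus>\<^bsub>K\<^esub> w) = \<zero>\<^bsub>K\<^esub>"
    if "u \<in> carrier K" "v \<in> carrier K" "w \<in> carrier K" for u v w using that by algebra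
  have "cobar K G 2 (cup_sum \<phi> P c) x = \<zero>\<^bsub>K\<^esub>" if x: "x \<in> tuples G 3" for x
  proof -
    obtain g h k where x: "x = [g, h, k]" and ghk: "g \<in> carrier G" "h \<in> carrier G" "k \<in> carrier G"
      using x unfolding tuples_3 by blast
    show ?thesis unfolding x cobar_2[OF ghk A2] l[OF ghk] r[OF ghk]
      using AK ghk by (intro cancel) auto
  qed
  then show ?thesis using A2 by (simp add: cocycles2_def)
qed

text \<open>
  Let \<open>\<alpha>\<^sub>c = \<Sum> c\<^sub>i\<^sub>j (\<phi>\<^sub>i \<union> \<phi>\<^sub>j)\<close> with \<open>i < n \<le> j < r\<close>, and let \<open>q\<close> be the order of \<open>K\<close>. By the
  pigeonhole principle at least \<open>q^(n(r-n)-d)\<close> of the matrices \<open>c\<close> have cocycles that agree on the \<open>d\<close>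
  chains detecting \<open>H\<^sub>2\<close>, so that they are all cohomologous to one \<open>\<alpha>\<^sub>c\<^sub>0\<close>. Mapping each of these \<open>c\<close> to
  the restriction to \<open>N\<close> of some \<open>\<beta>\<^sub>c\<close> with coboundary \<open>\<alpha>\<^sub>c - \<alpha>\<^sub>c\<^sub>0\<close> is injective, and the target has at
  most \<open>q^s\<close> elements.
\<close>

lemma betti_kernel_bound_finite:
  assumes dual: "dual_system K G r \<phi> g" and nr: "n \<le> r"
    and d: "edim K (group_homology 2 G K) = enat d"
    and s: "edim K (group_homology 1 (G\<lparr>carrier := joint_kernel K G n \<phi>\<rparr>) K) = enat s"
  shows "n * (r - n) \<le> s + d"
proof -
  let ?N = "joint_kernel K G n \<phi>"
  let ?GN = "G\<lparr>carrier := ?N\<rparr>"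
  let ?q = "card (carrier K)"
  note D = dual_systemD[OF dual]
  have N: "?N \<lhd> G" using D(1) nr by (intro joint_kernel_normal) auto
  then have Nsub: "subgroup ?N G" by (rule normal_imp_subgroup)
  then have NG: "x \<in> carrier G" if "x \<in> ?N" for x using that by (auto simp: joint_kernel_def)
  have "group ?GN" by (rule G.subgroup_imp_group[OF Nsub])
  then interpret N: bar_complex K ?GN by (intro bar_complex.intro K.field_axioms)
  have finN: "finite (characters K ?GN)" and cardN: "card (characters K ?GN) \<le> ?q ^ s"
    using N.card_characters_le[OF s finite_K] .
  define P where "P = {..<n} \<times> {n..<r}"
  have P: "finite P" "P \<subseteq> {..<r} \<times> {..<r}" "card P = n * (r - n)" using nr by (auto simp: P_def)
  define \<alpha> where "\<alpha> = cup_sum \<phi> P"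
  have co: "\<alpha> c \<in> cocycles2 K G" if "c \<in> P \<rightarrow>\<^sub>E carrier K" for c
    unfolding \<alpha>_def using that D(1) P(2) by (intro cup_sum_cocycle) auto
  have \<alpha>N: "\<alpha> c [h, x] = \<zero>\<^bsub>K\<^esub>" if c: "c \<in> P \<rightarrow>\<^sub>E carrier K" and h: "h \<in> ?N" and x: "x \<in> carrier G" for c h x
  proof -
    have "\<alpha> c [h, x] = (\<Oplus>\<^bsub>K\<^esub>p\<in>P. \<zero>\<^bsub>K\<^esub>)"
      unfolding \<alpha>_def cup_sum_def
    proof (rule K.finsum_cong'[OF refl])
      fix p assume p: "p \<in> P"
      then have "fst p < n" "snd p < r" "c p \<in> carrier K" using c P(2) by (auto simp: P_def)
      then show "c p \<otimes>\<^bsub>K\<^esub> (\<phi> (fst p) ([h, x] ! 0) \<otimes>\<^bsub>K\<^esub> \<phi> (snd p) ([h, x] ! 1)) = \<zero>\<^bsub>K\<^esub>"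
        using h charactersD(1)[OF D(1) x] by (simp add: joint_kernel_def)
    qed auto
    then show ?thesis by simp
  qed
  have \<alpha>g: "\<alpha> c [g i, g j] = c (i, j)" if c: "c \<in> P \<rightarrow>\<^sub>E carrier K" and ij: "(i, j) \<in> P" for c i j
  proof -
    have ij': "i < r" "j < r" using ij P(2) by auto
    have "\<alpha> c [g i, g j] = (\<Oplus>\<^bsub>K\<^esub>p\<in>P. if (i, j) = p then c p else \<zero>\<^bsub>K\<^esub>)"
      unfolding \<alpha>_def cup_sum_def
    proof (rule K.finsum_cong'[OF refl])
      fix p assume p: "p \<in> P"
      then have p': "fst p < r" "snd p < r" "c p \<in> carrier K" using P(2) c by auto
      then show "c p \<otimes>\<^bsub>K\<^esub> (\<phi> (fst p) ([g i, g j] ! 0) \<otimes>\<^bsub>K\<^esub> \<phi> (snd p) ([g i, g j] ! 1)) =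
        (if (i, j) = p then c p else \<zero>\<^bsub>K\<^esub>)"
        using D(3)[OF p'(1) ij'(1)] D(3)[OF p'(2) ij'(2)] by (cases p) auto
    qed (use c in auto)
    also have "\<dots> = c (i, j)" using K.finsum_singleton[OF ij P(1), of c] c by auto
    finally show ?thesis .
  qed
  from cocycles_cohomologous[OF d] obtain z where z: "z \<in> {..<d} \<rightarrow> carrier (C 2)"
    and coh: "\<forall>a\<in>cocycles2 K G. \<forall>b\<in>cocycles2 K G.
    (\<forall>i<d. pairing K a (z i) = pairing K b (z i)) \<longrightarrow>
    (\<exists>\<beta>\<in>carrier G \<rightarrow> carrier K. \<forall>g\<in>carrier G. \<forall>h\<in>carrier G.
       a [g, h] \<ominus>\<^bsub>K\<^esub> b [g, h] = \<beta> h \<ominus>\<^bsub>K\<^esub> \<beta> (g \<otimes>\<^bsub>G\<^esub> h) \<oplus>\<^bsub>K\<^esub> \<beta> g)"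
    by (rule bexE)
  define E where "E c = restrict (\<lambda>i. pairing K (\<alpha> c) (z i)) {..<d}" for c
  have E: "E \<in> (P \<rightarrow>\<^sub>E carrier K) \<rightarrow> ({..<d} \<rightarrow>\<^sub>E carrier K)"
  proof
    fix c assume "c \<in> P \<rightarrow>\<^sub>E carrier K"
    then have "\<alpha> c \<in> tuples G 2 \<rightarrow> carrier K" using co by (simp add: cocycles2_def)
    from annihilatorD(1)[OF pairing_functional[OF this]]
    show "E c \<in> {..<d} \<rightarrow>\<^sub>E carrier K" unfolding E_def restrict_PiE_iff using z by blast
  qed
  have "\<zero>\<^bsub>K\<^esub> \<in> carrier K" by simp
  then have ne: "{..<d} \<rightarrow>\<^sub>E carrier K \<noteq> {}" by (auto simp: PiE_eq_empty_iff)
  have finPE: "finite (P \<rightarrow>\<^sub>E carrier K)" "finite ({..<d} \<rightarrow>\<^sub>E carrier K)"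
    using P(1) finite_K by (simp_all add: finite_PiE)
  obtain y where y: "card (P \<rightarrow>\<^sub>E carrier K) \<le> card (E -` {y} \<inter> (P \<rightarrow>\<^sub>E carrier K)) * card ({..<d} \<rightarrow>\<^sub>E carrier K)"
    using pigeonhole_card[OF E finPE ne] by blast
  define T where "T = E -` {y} \<inter> (P \<rightarrow>\<^sub>E carrier K)"
  have "card (P \<rightarrow>\<^sub>E carrier K) = ?q ^ (n * (r - n))" using P by (simp add: card_funcsetE)
  then have cardT: "?q ^ (n * (r - n)) \<le> card T * ?q ^ d" using y by (simp add: T_def card_funcsetE)
  have "card T \<le> card (characters K ?GN)"
  proof (cases "T = {}")
    case False
    then obtain c0 where c0: "c0 \<in> T" by blast
    then have c0P: "c0 \<in> P \<rightarrow>\<^sub>E carrier K" by (simp add: T_def)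
    have TP: "c \<in> P \<rightarrow>\<^sub>E carrier K" if "c \<in> T" for c using that by (simp add: T_def)
    have "\<exists>\<beta>\<in>carrier G \<rightarrow> carrier K. \<forall>g\<in>carrier G. \<forall>h\<in>carrier G.
       \<alpha> c [g, h] \<ominus>\<^bsub>K\<^esub> \<alpha> c0 [g, h] = \<beta> h \<ominus>\<^bsub>K\<^esub> \<beta> (g \<otimes>\<^bsub>G\<^esub> h) \<oplus>\<^bsub>K\<^esub> \<beta> g" if c: "c \<in> T" for c
    proof (rule coh[THEN bspec, OF co[OF TP[OF c]], THEN bspec, OF co[OF c0P], THEN mp])
      have "E c = E c0" using c c0 by (simp add: T_def)
      then show "\<forall>i<d. pairing K (\<alpha> c) (z i) = pairing K (\<alpha> c0) (z i)"
        unfolding E_def by (metis lessThan_iff restrict_apply')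
    qed
    then have "\<forall>c\<in>T. \<exists>b. b \<in> carrier G \<rightarrow> carrier K \<and> (\<forall>x\<in>carrier G. \<forall>h\<in>carrier G.
       \<alpha> c [x, h] \<ominus>\<^bsub>K\<^esub> \<alpha> c0 [x, h] = b h \<ominus>\<^bsub>K\<^esub> b (x \<otimes>\<^bsub>G\<^esub> h) \<oplus>\<^bsub>K\<^esub> b x)"
      by (simp only: Bex_def) simp
    from bchoice[OF this] obtain \<beta> where \<beta>': "\<forall>c\<in>T. \<beta> c \<in> carrier G \<rightarrow> carrier K \<and> (\<forall>x\<in>carrier G. \<forall>h\<in>carrier G.
       \<alpha> c [x, h] \<ominus>\<^bsub>K\<^esub> \<alpha> c0 [x, h] = \<beta> c h \<ominus>\<^bsub>K\<^esub> \<beta> c (x \<otimes>\<^bsub>G\<^esub> h) \<oplus>\<^bsub>K\<^esub> \<beta> c x)"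
      by (rule exE)
    have \<beta>: "\<beta> c x \<in> carrier K" if "c \<in> T" "x \<in> carrier G" for c x
      using bspec[OF \<beta>' that(1)] that(2) by (simp add: Pi_iff)
    have d\<beta>: "\<alpha> c [x, h] \<ominus>\<^bsub>K\<^esub> \<alpha> c0 [x, h] = \<beta> c h \<ominus>\<^bsub>K\<^esub> \<beta> c (x \<otimes>\<^bsub>G\<^esub> h) \<oplus>\<^bsub>K\<^esub> \<beta> c x"
      if "c \<in> T" "x \<in> carrier G" "h \<in> carrier G" for c x h
      using bspec[OF \<beta>' that(1)] that(2,3) by simp
    \<comment> \<open>All \<open>\<alpha>\<^sub>c\<close> vanish when the first argument is in \<open>N\<close>.\<close>
    have left: "\<beta> c (h \<otimes>\<^bsub>G\<^esub> x) = \<beta> c h \<oplus>\<^bsub>K\<^esub> \<beta> c x" if "c \<in> T" "h \<in> ?N" "x \<in> carrier G" for c h x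
    proof -
      have "\<beta> c x \<ominus>\<^bsub>K\<^esub> \<beta> c (h \<otimes>\<^bsub>G\<^esub> x) \<oplus>\<^bsub>K\<^esub> \<beta> c h = \<zero>\<^bsub>K\<^esub>"
        using d\<beta>[OF that(1) NG[OF that(2)] that(3)] \<alpha>N[OF TP[OF that(1)] that(2,3)] \<alpha>N[OF c0P that(2,3)]
        by (simp add: a_minus_def)
      then show ?thesis using \<beta>[OF that(1)] that NG by (simp add: K.minus_add_add_eq_zero_iff)
    qed
    define R where "R c = restrict (\<beta> c) ?N" for c
    have "inj_on R T"
    proof (rule inj_onI)
      fix c c' assume c: "c \<in> T" and c': "c' \<in> T" and eq: "R c = R c'"
      have eqN: "\<beta> c x = \<beta> c' x" if "x \<in> ?N" for x using eq that unfolding R_def by (metis restrict_apply')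
      show "c = c'"
      proof (rule PiE_ext[OF TP[OF c] TP[OF c']])
        fix p assume p: "p \<in> P"
        obtain i j where ij: "p = (i, j)" by (cases p)
        then have ij': "i < n" "n \<le> j" "i < r" "j < r" using p nr by (auto simp: P_def)
        let ?x = "g i" let ?h = "g j"
        \<comment> \<open>The cocycle at \<open>(g i, g j)\<close> is the entry \<open>c (i, j)\<close>. As \<open>g j\<close> is in the normal subgroup \<open>N\<close>,
          \<open>g i g j = h' g i\<close> with \<open>h'\<close> in \<open>N\<close>, so the entry can be read off from the values of \<open>\<beta>\<^sub>c\<close> on \<open>N\<close>.\<close>
        let ?h' = "?x \<otimes>\<^bsub>G\<^esub> ?h \<otimes>\<^bsub>G\<^esub> inv\<^bsub>G\<^esub> ?x"
        have x: "?x \<in> carrier G" and hG: "?h \<in> carrier G" using D(2) ij' by auto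
        have h: "?h \<in> ?N" using hG D(3) ij' nr by (auto simp: joint_kernel_def)
        have h': "?h' \<in> ?N" using N x h by (simp add: G.normal_inv_iff)
        have conj: "?h' \<otimes>\<^bsub>G\<^esub> ?x = ?x \<otimes>\<^bsub>G\<^esub> ?h" using x hG by (simp add: G.m_assoc)
        have diff: "\<alpha> e [?x, ?h] \<ominus>\<^bsub>K\<^esub> \<alpha> c0 [?x, ?h] = \<beta> e ?h \<ominus>\<^bsub>K\<^esub> \<beta> e ?h'" if e: "e \<in> T" for e
        proof -
          have "u \<ominus>\<^bsub>K\<^esub> (v \<oplus>\<^bsub>K\<^esub> w) \<oplus>\<^bsub>K\<^esub> w = u \<ominus>\<^bsub>K\<^esub> v" if "u \<in> carrier K" "v \<in> carrier K" "w \<in> carrier K" for u v w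
            using that by algebra
          then show ?thesis using d\<beta>[OF e x hG] left[OF e h' x] \<beta>[OF e] x hG NG[OF h'] unfolding conj by simp
        qed
        have "\<alpha> c [?x, ?h] \<ominus>\<^bsub>K\<^esub> \<alpha> c0 [?x, ?h] = \<alpha> c' [?x, ?h] \<ominus>\<^bsub>K\<^esub> \<alpha> c0 [?x, ?h]"
          using diff[OF c] diff[OF c'] eqN[OF h] eqN[OF h'] by simp
        then have "c (i, j) \<ominus>\<^bsub>K\<^esub> c0 (i, j) = c' (i, j) \<ominus>\<^bsub>K\<^esub> c0 (i, j)"
          using \<alpha>g[OF TP[OF c]] \<alpha>g[OF TP[OF c']] \<alpha>g[OF c0P] p ij by simp
        moreover have "c (i, j) \<in> carrier K" "c' (i, j) \<in> carrier K" "c0 (i, j) \<in> carrier K"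
          using TP[OF c] TP[OF c'] c0P p ij by auto
        ultimately show "c p = c' p" unfolding ij by (simp add: a_minus_def)
      qed
    qed
    moreover have "R ` T \<subseteq> characters K ?GN"
      using \<beta> left NG by (auto simp: R_def characters_def subgroup.m_closed[OF Nsub])
    ultimately show ?thesis using finN card_inj_on_le by blast
  qed simp
  then have "?q ^ (n * (r - n)) \<le> ?q ^ s * ?q ^ d"
    using cardT cardN by (meson le_trans mult_le_mono1)
  then have "?q ^ (n * (r - n)) \<le> ?q ^ (s + d)" by (simp add: power_add)
  then show ?thesis by (rule power_le_imp_le_exp[OF card_K])
qed

text \<open>
  The Betti numbers may be infinite here. The given dual system need not be maximal: as \<open>b\<^sub>1\<close> is at
  least \<open>r\<close>, it extends to one of size \<open>r\<close>.
\<close>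

lemma betti_kernel_bound:
  assumes dual: "dual_system K G n \<phi> g" and nr: "n \<le> r"
    and r: "enat r \<le> edim K (group_homology 1 G K)"
  shows "enat (n * (r - n)) \<le>
    edim K (group_homology 1 (G\<lparr>carrier := joint_kernel K G n \<phi>\<rparr>) K) + edim K (group_homology 2 G K)"
proof -
  have "\<not> (finite (characters K G) \<and> card (characters K G) < card (carrier K) ^ r)"
    using card_characters_ge[OF r] by linarith
  from extend_dual_system[OF dual nr all_characters_space this]
  obtain \<phi>' g' where d: "dual_system K G r \<phi>' g'" and "\<forall>i<n. \<phi>' i = \<phi> i" by blast
  then have j: "joint_kernel K G n \<phi>' = joint_kernel K G n \<phi>" by (auto simp: joint_kernel_def)
  show ?thesis
    using betti_kernel_bound_finite[OF d nr, unfolded j]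
    by (cases "edim K (group_homology 1 (G\<lparr>carrier := joint_kernel K G n \<phi>\<rparr>) K)";
        cases "edim K (group_homology 2 G K)") auto
qed

end

section \<open>Subgroups of finite index\<close>

context group
begin

lemma rcosets_eq: "rcosets H = (\<lambda>g. H #> g) ` carrier G"
  by (auto simp: RCOSETS_def)

lemma rcos_eq_iff:
  assumes "subgroup H G" "x \<in> carrier G" "y \<in> carrier G"
  shows "H #> x = H #> y \<longleftrightarrow> x \<otimes> inv y \<in> H"
proof -
  have "H #> x = H #> y \<longleftrightarrow> x \<in> H #> y"
    using repr_independence[OF _ assms(3,1)] rcos_self[OF assms(2,1)] by metis
  then show ?thesis using subgroup.rcos_module[OF assms(1) is_group assms(3,2)] by simp
qed

text \<open>
  If \<open>f\<close> separates the cosets of \<open>N\<close> inside \<open>P\<close>, then a coset \<open>N x\<close> is determined by \<open>P x\<close> and the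
  value of \<open>f\<close> at \<open>x t\<inverse>\<close>, where \<open>t\<close> is a representative of \<open>P x\<close> that depends only on \<open>P x\<close>.
\<close>

lemma finite_index_by_invariant:
  assumes P: "subgroup P G" "finite (rcosets P)" and N: "subgroup N G"
    and f: "f \<in> P \<rightarrow> B" "finite B"
    and inv: "\<And>x y. x \<in> P \<Longrightarrow> y \<in> P \<Longrightarrow> f x = f y \<Longrightarrow> x \<otimes> inv y \<in> N"
  shows "finite (rcosets N)" "card (rcosets N) \<le> card (rcosets P) * card B"
proof -
  define t where "t D = (SOME y. y \<in> D)" for D :: "'a set"
  have t: "t (P #> x) \<in> carrier G" "x \<otimes> inv (t (P #> x)) \<in> P" if x: "x \<in> carrier G" for x
  proof -
    have "t (P #> x) \<in> P #> x" unfolding t_def using rcos_self[OF x P(1)] by (rule someI)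
    then show c: "t (P #> x) \<in> carrier G" using subgroup.elemrcos_carrier[OF P(1) is_group x] by blast
    have "P #> x = P #> t (P #> x)" using repr_independence[OF \<open>t (P #> x) \<in> P #> x\<close> x P(1)] .
    then show "x \<otimes> inv (t (P #> x)) \<in> P" using rcos_eq_iff[OF P(1) x c] by simp
  qed
  define F where "F x = (P #> x, f (x \<otimes> inv (t (P #> x))))" for x
  define r where "r C = (SOME x. x \<in> carrier G \<and> C = N #> x)" for C
  have r: "r C \<in> carrier G" "C = N #> r C" if "C \<in> rcosets N" for C
  proof -
    have "\<exists>x. x \<in> carrier G \<and> C = N #> x" using that by (auto simp: rcosets_eq)
    from someI_ex[OF this] show "r C \<in> carrier G" "C = N #> r C" by (simp_all add: r_def)
  qed
  have "inj_on (\<lambda>C. F (r C)) (rcosets N)"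
  proof (rule inj_onI)
    fix C D assume C: "C \<in> rcosets N" and D: "D \<in> rcosets N" and eq: "F (r C) = F (r D)"
    let ?x = "r C" let ?y = "r D" let ?t = "t (P #> r D)"
    have e: "P #> ?x = P #> ?y" "f (?x \<otimes> inv ?t) = f (?y \<otimes> inv ?t)" using eq by (auto simp: F_def)
    have tx: "?t \<in> carrier G" "?y \<otimes> inv ?t \<in> P" using t[OF r(1)[OF D]] by auto
    have "?x \<otimes> inv ?t \<in> P" using t(2)[OF r(1)[OF C]] e(1) by simp
    from inv[OF this tx(2) e(2)] have "(?x \<otimes> inv ?t) \<otimes> inv (?y \<otimes> inv ?t) \<in> N" .
    also have "(?x \<otimes> inv ?t) \<otimes> inv (?y \<otimes> inv ?t) = ?x \<otimes> inv ?y"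
      using r(1)[OF C] r(1)[OF D] tx(1) by (simp add: inv_mult_group m_assoc) (simp flip: m_assoc)
    finally have "N #> ?x = N #> ?y" using rcos_eq_iff[OF N r(1)[OF C] r(1)[OF D]] by simp
    then show "C = D" using r(2)[OF C] r(2)[OF D] by simp
  qed
  moreover have "(\<lambda>C. F (r C)) ` (rcosets N) \<subseteq> (rcosets P) \<times> B"
    using r(1) t(2) f(1) by (auto simp: F_def rcosets_eq)
  moreover have "finite ((rcosets P) \<times> B)" using P f by simp
  ultimately show "finite (rcosets N)" "card (rcosets N) \<le> card (rcosets P) * card B"
    using inj_on_finite card_inj_on_le by (blast, metis card_cartesian_product)
qed

end

text \<open>
  \<^const>\<open>finite_index_subgroups\<close> is defined for records without additional fields.
\<close>

locale monoid_group = group G for G :: "'g monoid" (structure)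
begin

lemma carrier_finite_index: "carrier G \<in> finite_index_subgroups G"
proof -
  have "rcosets (carrier G) = {carrier G}" using coset_join2 subgroup_self by (auto simp: rcosets_eq)
  then show ?thesis by (simp add: finite_index_subgroups_def subgroup_self)
qed

lemma finite_index_overgroup:
  assumes "N \<in> finite_index_subgroups G" "subgroup P G" "N \<subseteq> P"
  shows "P \<in> finite_index_subgroups G"
proof -
  have N: "subgroup N G" "finite (rcosets N)" using assms by (auto simp: finite_index_subgroups_def)
  have c: "subgroup (carrier G) G" "finite (rcosets (carrier G))"
    using carrier_finite_index by (auto simp: finite_index_subgroups_def)
  have "finite (rcosets P)"
  proof (rule finite_index_by_invariant(1)[OF c assms(2) _ N(2)])
    show "(\<lambda>x. N #> x) \<in> carrier G \<rightarrow> rcosets N" by (auto simp: rcosets_eq)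
    show "x \<otimes> inv y \<in> P" if "x \<in> carrier G" "y \<in> carrier G" "N #> x = N #> y" for x y
      using that rcos_eq_iff[OF N(1)] assms(3) by blast
  qed
  then show ?thesis using assms by (simp add: finite_index_subgroups_def)
qed

text \<open>
  The kernel of the action of \<open>G\<close> on the finitely many right cosets of \<open>H\<close>.
\<close>

lemma normal_core_finite_index:
  assumes "H \<in> finite_index_subgroups G"
  obtains N where "N \<in> finite_index_subgroups G" "N \<lhd> G" "N \<subseteq> H"
proof -
  have H: "subgroup H G" "finite (rcosets H)" using assms by (auto simp: finite_index_subgroups_def)
  have HG: "D \<subseteq> carrier G" if "D \<in> rcosets H" for D using subgroup.rcosets_carrier[OF H(1) is_group that] .
  define N where "N = {x \<in> carrier G. \<forall>D\<in>rcosets H. D #> x = D}"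
  have act: "D #> x \<in> rcosets H" if "D \<in> rcosets H" "x \<in> carrier G" for D x
    using that subgroup.subset[OF H(1)] by (auto simp: rcosets_eq coset_mult_assoc)
  have Ninv: "inv x \<in> N" if x: "x \<in> N" for x
  proof -
    have xG: "x \<in> carrier G" using x by (simp add: N_def)
    have "D #> inv x = D" if D: "D \<in> rcosets H" for D
    proof -
      have "D #> inv x = (D #> x) #> inv x" using x D by (simp add: N_def)
      also have "\<dots> = D" using HG[OF D] xG by (simp add: coset_mult_assoc)
      finally show ?thesis .
    qed
    then show ?thesis using xG by (simp add: N_def)
  qed
  have sub: "subgroup N G"
  proof (rule subgroupI)
    show "N \<noteq> {}" using HG by (auto simp: N_def intro!: exI[of _ \<one>])
    show "x \<otimes> y \<in> N" if "x \<in> N" "y \<in> N" for x y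
      using that HG by (auto simp: N_def simp flip: coset_mult_assoc)
  qed (use Ninv in \<open>auto simp: N_def\<close>)
  have "N \<lhd> G"
    unfolding normal_inv_iff
  proof (intro conjI ballI sub)
    fix x h assume x: "x \<in> carrier G" and h: "h \<in> N"
    have hG: "h \<in> carrier G" using h by (simp add: N_def)
    have "D #> (x \<otimes> h \<otimes> inv x) = D" if D: "D \<in> rcosets H" for D
    proof -
      have "D #> (x \<otimes> h \<otimes> inv x) = ((D #> x) #> h) #> inv x"
        using x hG HG[OF D] HG[OF act[OF D x]] by (simp add: coset_mult_assoc m_assoc)
      also have "\<dots> = D" using h act[OF D x] x HG[OF D] by (simp add: N_def coset_mult_assoc)
      finally show ?thesis .
    qed
    then show "x \<otimes> h \<otimes> inv x \<in> N" using x hG by (simp add: N_def)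
  qed
  moreover have "N \<subseteq> H"
  proof
    fix x assume x: "x \<in> N"
    have "H \<in> rcosets H" using subgroup.subgroup_in_rcosets[OF H(1) is_group] .
    then show "x \<in> H" using x coset_join1[OF _ _ H(1)] by (auto simp: N_def)
  qed
  moreover have "finite (rcosets N)"
  proof (rule finite_index_by_invariant(1)[OF subgroup_self _ sub])
    show "finite (rcosets (carrier G))" using carrier_finite_index by (simp add: finite_index_subgroups_def)
    show "(\<lambda>x. restrict (\<lambda>D. D #> x) (rcosets H)) \<in> carrier G \<rightarrow> ((rcosets H) \<rightarrow>\<^sub>E (rcosets H))"
      using act by auto
    show "finite ((rcosets H) \<rightarrow>\<^sub>E (rcosets H))" using H(2) by (simp add: finite_PiE)
    fix x y assume xy: "x \<in> carrier G" "y \<in> carrier G"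
      and eq: "restrict (\<lambda>D. D #> x) (rcosets H) = restrict (\<lambda>D. D #> y) (rcosets H)"
    have "D #> (x \<otimes> inv y) = D" if D: "D \<in> rcosets H" for D
    proof -
      have "D #> x = D #> y" using fun_cong[OF eq, of D] D by simp
      then show ?thesis using coset_mult_inv2 xy HG[OF D] by blast
    qed
    then show "x \<otimes> inv y \<in> N" using xy by (simp add: N_def)
  qed
  ultimately show thesis using that sub by (simp add: finite_index_subgroups_def)
qed

text \<open>
  Such a subgroup is a union of cosets of \<open>N\<close>.
\<close>

lemma finite_intermediate_subgroups:
  assumes "N \<in> finite_index_subgroups G"
  shows "finite {P. subgroup P G \<and> N \<subseteq> P}"
proof -
  have N: "subgroup N G" "finite (rcosets N)" using assms by (auto simp: finite_index_subgroups_def)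
  have "P = \<Union>{D \<in> rcosets N. D \<subseteq> P}" if P: "subgroup P G" "N \<subseteq> P" for P
  proof
    show "P \<subseteq> \<Union>{D \<in> rcosets N. D \<subseteq> P}"
    proof
      fix x assume x: "x \<in> P"
      then have xG: "x \<in> carrier G" using subgroup.subset[OF P(1)] by auto
      have "N #> x \<subseteq> P" using P x by (auto simp: r_coset_def subgroup.m_closed)
      then show "x \<in> \<Union>{D \<in> rcosets N. D \<subseteq> P}" using rcos_self[OF xG N(1)] xG by (auto simp: rcosets_eq)
    qed
  qed auto
  then have "{P. subgroup P G \<and> N \<subseteq> P} \<subseteq> Union ` Pow (rcosets N)" by blast
  then show ?thesis using N(2) by (meson finite_Pow_iff finite_imageI finite_subset)
qed

end

section \<open>Characters of finite index subgroups with values in the prime field\<close>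

lemma residue_ring_complex:
  assumes "prime p" "group G"
  shows "bar_complex_prime (residue_ring (int p)) G" "card (carrier (residue_ring (int p))) = p"
proof -
  interpret residues_prime p "residue_ring (int p)" using assms by unfold_locales auto
  have add_pow: "[k] \<cdot>\<^bsub>residue_ring (int p)\<^esub> \<one>\<^bsub>residue_ring (int p)\<^esub> = int k mod int p" for k :: nat
    by (induction k) (auto simp: res_add_eq res_zero_eq res_one_eq mod_simps add.commute)
  show "bar_complex_prime (residue_ring (int p)) G"
  proof (intro bar_complex_prime.intro bar_complex.intro bar_complex_prime_axioms.intro is_field assms(2))
    fix c assume "c \<in> carrier (residue_ring (int p))"
    then have "c = int (nat c) mod int p" by (simp add: res_carrier_eq)
    then show "\<exists>k::nat. c = [k] \<cdot>\<^bsub>residue_ring (int p)\<^esub> \<one>\<^bsub>residue_ring (int p)\<^esub>"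
      using add_pow by metis
  qed (rule finite)
  show "card (carrier (residue_ring (int p))) = p" by (simp add: res_carrier_eq)
qed

locale fp_homology = monoid_group G for G :: "'g monoid" (structure) +
  fixes p :: nat
  assumes prime_p: "prime p"
begin

abbreviation Fp where "Fp \<equiv> residue_ring (int p)"
abbreviation sub where "sub P \<equiv> G\<lparr>carrier := P\<rparr>"
abbreviation FI where "FI \<equiv> finite_index_subgroups G"

lemma complex: "subgroup P G \<Longrightarrow> bar_complex_prime Fp (sub P)"
  using residue_ring_complex(1)[OF prime_p subgroup_imp_group] .

lemma card_Fp: "card (carrier Fp) = p"
  using residue_ring_complex(2)[OF prime_p is_group] .

lemma FI_subgroup: "P \<in> FI \<Longrightarrow> subgroup P G"
  by (simp add: finite_index_subgroups_def)

text \<open>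
  The values of the \<open>n\<close> characters form the invariant in \<open>finite_index_by_invariant\<close>.
\<close>

lemma joint_kernel_index:
  assumes P: "P \<in> FI" and \<phi>: "\<And>i. i < n \<Longrightarrow> \<phi> i \<in> characters Fp (sub P)"
  defines "N \<equiv> joint_kernel Fp (sub P) n \<phi>"
  shows "N \<lhd> sub P" "N \<in> FI" "subgroup_index G N \<le> p ^ n * subgroup_index G P"
proof -
  interpret C: bar_complex_prime Fp "sub P" by (rule complex[OF FI_subgroup[OF P]])
  show N: "N \<lhd> sub P" unfolding N_def using \<phi> by (rule C.joint_kernel_normal)
  have sub: "subgroup N G" using incl_subgroup[OF FI_subgroup[OF P]] normal_imp_subgroup[OF N] by blast
  have PG: "x \<in> carrier G" if "x \<in> P" for x using subgroup.mem_carrier[OF FI_subgroup[OF P] that] .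
  note ch = charactersD[OF \<phi>]
  define f where "f x = restrict (\<lambda>i. \<phi> i x) {..<n}" for x
  have f: "f \<in> P \<rightarrow> ({..<n} \<rightarrow>\<^sub>E carrier Fp)" using ch(1) by (auto simp: f_def)
  have fin: "finite ({..<n} \<rightarrow>\<^sub>E carrier Fp)" using C.finite_K by (simp add: finite_PiE)
  have fP: "finite (rcosets P)" using P by (simp add: finite_index_subgroups_def)
  have inv: "x \<otimes> inv y \<in> N" if xy: "x \<in> P" "y \<in> P" and eq: "f x = f y" for x y
  proof -
    have iy: "inv y \<in> P" using xy subgroup.m_inv_closed[OF FI_subgroup[OF P]] by blast
    have "\<phi> i (x \<otimes> inv y) = \<zero>\<^bsub>Fp\<^esub>" if i: "i < n" for i
    proof -
      have "\<phi> i x = \<phi> i y" using fun_cong[OF eq, of i] i by (simp add: f_def)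
      then have "\<phi> i (x \<otimes> inv y) = \<phi> i (y \<otimes> inv y)" using ch(2)[OF i] xy iy by simp
      also have "\<dots> = \<zero>\<^bsub>Fp\<^esub>" using C.character_one[OF \<phi>[OF i]] PG[OF xy(2)] by simp
      finally show ?thesis .
    qed
    then show ?thesis using subgroup.m_closed[OF FI_subgroup[OF P] xy(1) iy] by (simp add: N_def joint_kernel_def)
  qed
  have "finite (rcosets N)"
    by (rule finite_index_by_invariant(1)[OF FI_subgroup[OF P] fP sub f fin]) (rule inv)
  then show "N \<in> FI" using sub unfolding finite_index_subgroups_def by blast
  have "card (rcosets N) \<le> card (rcosets P) * card ({..<n} \<rightarrow>\<^sub>E carrier Fp)"
    by (rule finite_index_by_invariant(2)[OF FI_subgroup[OF P] fP sub f fin]) (rule inv)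
  also have "card ({..<n} \<rightarrow>\<^sub>E carrier Fp) = p ^ n" by (simp only: card_funcsetE card_Fp finite_lessThan card_lessThan)
  finally show "subgroup_index G N \<le> p ^ n * subgroup_index G P"
    by (simp only: subgroup_index_def mult.commute)
qed

text \<open>
  Such a character is constant on the cosets of \<open>N\<close>.
\<close>

lemma finite_vanishing_characters:
  assumes N: "N \<in> FI" and P: "subgroup P G" and NP: "N \<subseteq> P"
  shows "finite {\<phi> \<in> characters Fp (sub P). \<forall>h\<in>N. \<phi> h = \<zero>\<^bsub>Fp\<^esub>}" (is "finite ?X")
proof -
  interpret C: bar_complex_prime Fp "sub P" by (rule complex[OF P])
  define t where "t D = (SOME y. y \<in> D)" for D :: "'g set"
  define E where "E \<phi> = restrict (\<lambda>D. \<phi> (t D)) {D \<in> rcosets N. D \<subseteq> P}" for \<phi> :: "'g \<Rightarrow> int"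
  let ?R = "{D \<in> rcosets N. D \<subseteq> P}"
  have Ns: "subgroup N G" using N by (rule FI_subgroup)
  have PG: "x \<in> carrier G" if "x \<in> P" for x using subgroup.mem_carrier[OF P that] .
  have tD: "t D \<in> D" if "D \<in> ?R" for D
  proof -
    have "D \<noteq> {}" using that subgroup.rcosets_non_empty[OF Ns] by blast
    then have "\<exists>y. y \<in> D" by blast
    then show ?thesis unfolding t_def by (rule someI_ex)
  qed
  have "inj_on E ?X"
  proof (rule inj_onI)
    fix \<phi> \<psi> assume \<phi>: "\<phi> \<in> ?X" and \<psi>: "\<psi> \<in> ?X" and eq: "E \<phi> = E \<psi>"
    have \<phi>c: "\<phi> \<in> characters Fp (sub P)" and \<psi>c: "\<psi> \<in> characters Fp (sub P)" using \<phi> \<psi> by auto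
    show "\<phi> = \<psi>"
    proof (rule characters_eqI[OF \<phi>c \<psi>c])
      fix x assume "x \<in> carrier (sub P)"
      then have x: "x \<in> P" by simp
      have sub: "N #> x \<subseteq> P" using P NP x by (auto simp: r_coset_def subgroup.m_closed)
      then have D: "N #> x \<in> ?R" using PG[OF x] by (auto simp: rcosets_eq)
      obtain h where h: "h \<in> N" "t (N #> x) = h \<otimes> x" using tD[OF D] by (auto simp: r_coset_def)
      have val: "\<chi> (t (N #> x)) = \<chi> x" if "\<chi> \<in> ?X" for \<chi>
        using that h x NP charactersD(1,2)[of \<chi> Fp "sub P"] by auto
      have "\<phi> (t (N #> x)) = \<psi> (t (N #> x))" using fun_cong[OF eq, of "N #> x"] D by (simp add: E_def)
      then show "\<phi> x = \<psi> x" using val[OF \<phi>] val[OF \<psi>] by simp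
    qed
  qed
  moreover have "E ` ?X \<subseteq> ?R \<rightarrow>\<^sub>E carrier Fp"
  proof (rule image_subsetI)
    fix \<phi> assume "\<phi> \<in> ?X"
    then show "E \<phi> \<in> ?R \<rightarrow>\<^sub>E carrier Fp"
      unfolding E_def restrict_PiE_iff using charactersD(1)[of \<phi> Fp "sub P"] tD by auto
  qed
  moreover have "finite (?R \<rightarrow>\<^sub>E carrier Fp)"
    using N C.finite_K by (intro finite_PiE) (auto simp: finite_index_subgroups_def)
  ultimately show ?thesis by (meson finite_imageD finite_subset)
qed

text \<open>
  The set on the right is the kernel of the restriction map from \<open>Hom(P, F\<^sub>p)\<close> to \<open>Hom(N, F\<^sub>p)\<close>. A
  character of \<open>P\<close> is determined by its restriction and its difference from a chosen character
  with the same restriction.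
\<close>

lemma card_characters_restriction:
  assumes N: "subgroup N G" and P: "subgroup P G" and NP: "N \<subseteq> P"
    and fX: "finite {\<phi> \<in> characters Fp (sub P). \<forall>h\<in>N. \<phi> h = \<zero>\<^bsub>Fp\<^esub>}"
    and fN: "finite (characters Fp (sub N))"
  shows "finite (characters Fp (sub P))"
    "card (characters Fp (sub P)) \<le> card (characters Fp (sub N)) *
       card {\<phi> \<in> characters Fp (sub P). \<forall>h\<in>N. \<phi> h = \<zero>\<^bsub>Fp\<^esub>}"
proof -
  let ?X = "{\<phi> \<in> characters Fp (sub P). \<forall>h\<in>N. \<phi> h = \<zero>\<^bsub>Fp\<^esub>}"
  interpret C: bar_complex_prime Fp "sub P" by (rule complex[OF P])
  let ?c = "characters Fp (sub P)"
  define \<rho> where "\<rho> \<phi> = restrict \<phi> N" for \<phi> :: "'g \<Rightarrow> int"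
  define s where "s \<chi> = (SOME \<phi>. \<phi> \<in> ?c \<and> \<rho> \<phi> = \<chi>)" for \<chi>
  have s: "s (\<rho> \<phi>) \<in> ?c" "\<rho> (s (\<rho> \<phi>)) = \<rho> \<phi>" if "\<phi> \<in> ?c" for \<phi>
  proof -
    have "\<exists>\<psi>. \<psi> \<in> ?c \<and> \<rho> \<psi> = \<rho> \<phi>" using that by blast
    from someI_ex[OF this] show "s (\<rho> \<phi>) \<in> ?c" "\<rho> (s (\<rho> \<phi>)) = \<rho> \<phi>" by (simp_all add: s_def)
  qed
  define D where "D \<phi> \<psi> = restrict (\<lambda>x. \<one>\<^bsub>Fp\<^esub> \<otimes>\<^bsub>Fp\<^esub> (\<phi> x \<ominus>\<^bsub>Fp\<^esub> \<psi> x)) P" for \<phi> \<psi> :: "'g \<Rightarrow> int"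
  have Dc: "D \<phi> \<psi> \<in> ?c" if "\<phi> \<in> ?c" "\<psi> \<in> ?c" for \<phi> \<psi>
    using C.all_characters_space that C.K.one_closed unfolding character_space_def D_def by auto
  define F where "F \<phi> = (\<rho> \<phi>, D \<phi> (s (\<rho> \<phi>)))" for \<phi>
  have inj: "inj_on F ?c"
  proof (rule inj_onI)
    fix \<phi> \<psi> assume \<phi>: "\<phi> \<in> ?c" and \<psi>: "\<psi> \<in> ?c" and "F \<phi> = F \<psi>"
    then have e: "\<rho> \<phi> = \<rho> \<psi>" "D \<phi> (s (\<rho> \<psi>)) = D \<psi> (s (\<rho> \<psi>))" by (auto simp: F_def)
    show "\<phi> = \<psi>"
    proof (rule characters_eqI[OF \<phi> \<psi>])
      fix x assume x: "x \<in> carrier (sub P)"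
      note v = charactersD(1)[OF \<phi> x] charactersD(1)[OF \<psi> x] charactersD(1)[OF s(1)[OF \<psi>] x]
      have "\<phi> x \<ominus>\<^bsub>Fp\<^esub> s (\<rho> \<psi>) x = \<psi> x \<ominus>\<^bsub>Fp\<^esub> s (\<rho> \<psi>) x"
        using fun_cong[OF e(2), of x] x v by (simp add: D_def)
      then show "\<phi> x = \<psi> x" using v by (simp add: a_minus_def)
    qed
  qed
  have im: "F ` ?c \<subseteq> characters Fp (sub N) \<times> ?X"
  proof (rule image_subsetI)
    fix \<phi> assume \<phi>: "\<phi> \<in> ?c"
    have "\<rho> \<phi> \<in> characters Fp (sub N)"
      using charactersD(1,2)[OF \<phi>] NP subgroup.m_closed[OF N]
      by (auto simp: \<rho>_def characters_def subset_iff)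
    moreover have "D \<phi> (s (\<rho> \<phi>)) h = \<zero>\<^bsub>Fp\<^esub>" if h: "h \<in> N" for h
    proof -
      have "s (\<rho> \<phi>) h = \<phi> h" using fun_cong[OF s(2)[OF \<phi>], of h] h by (simp add: \<rho>_def)
      then show ?thesis using charactersD(1)[OF \<phi>, of h] h NP by (auto simp: D_def a_minus_def C.K.r_neg)
    qed
    ultimately show "F \<phi> \<in> characters Fp (sub N) \<times> ?X" using Dc[OF \<phi> s(1)[OF \<phi>]] by (simp add: F_def)
  qed
  have fin: "finite (characters Fp (sub N) \<times> ?X)" using fX fN by (rule finite_cartesian_product[rotated])
  show "finite ?c" by (rule inj_on_finite[OF inj im fin])
  show "card ?c \<le> card (characters Fp (sub N)) * card ?X"
    using card_inj_on_le[OF inj im fin] by (simp only: card_cartesian_product)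
qed

end

section \<open>Growth of the first Betti number\<close>

lemma ereal_of_enat_quotient_bound:
  assumes "ereal_of_enat b / (ereal_of_enat (enat r) + 1) \<le> ereal C" "C \<le> real c"
  shows "b \<le> enat (c * (r + 1))"
proof (cases b)
  case (enat d)
  have "ereal (real d / (real r + 1)) \<le> ereal C"
    using assms(1) enat by (simp add: one_ereal_def)
  then have "real d \<le> C * (real r + 1)" by (simp add: field_simps)
  also have "\<dots> \<le> real c * (real r + 1)" using assms(2) by (intro mult_right_mono) auto
  finally have "real d \<le> real (c * (r + 1))" by (simp add: algebra_simps)
  then have "d \<le> c * (r + 1)" by (simp only: of_nat_le_iff)
  then show ?thesis using enat by simp
next
  case infinity
  have "0 < real r + 1" by simp
  then show ?thesis using assms(1) infinity by (simp add: one_ereal_def)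
qed

text \<open>
  The b2/b1 property with a natural number as constant, for the subgroups with finite \<open>b\<^sub>1\<close>.
\<close>

locale linear_b2 = fp_homology +
  fixes c :: nat
  assumes b2_le: "\<And>P r. P \<in> FI \<Longrightarrow> betti 1 p (sub P) = enat r \<Longrightarrow> betti 2 p (sub P) \<le> enat (c * (r + 1))"
begin

text \<open>
  The number \<open>n\<close> of characters whose joint kernel is taken in each step. For this \<open>n\<close> the bound
  \<open>n (r - n) - c (r + 1)\<close> equals \<open>3 r - n^2 - c\<close>, which is at least \<open>2 r\<close> exactly when \<open>r\<close> reaches
  the threshold.
\<close>

definition rk :: nat where "rk = c + 3"
definition threshold :: nat where "threshold = rk * rk + c"

lemma doubling_arith:
  assumes "threshold \<le> r"
  shows "rk \<le> r" "c * (r + 1) + 2 * r \<le> rk * (r - rk)"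
proof -
  have "rk * 1 \<le> rk * rk" by (rule mult_le_mono2) (simp add: rk_def)
  then have "rk \<le> threshold" unfolding threshold_def by linarith
  then show rr: "rk \<le> r" using assms by simp
  have "c * (r + 1) + 2 * r + rk * rk = c * r + 2 * r + threshold" by (simp add: threshold_def)
  also have "\<dots> \<le> rk * r" using assms by (simp add: rk_def algebra_simps)
  finally show "c * (r + 1) + 2 * r \<le> rk * (r - rk)" using rr by (simp add: diff_mult_distrib2)
qed

text \<open>
  The bound \<open>n (r - n) - b\<^sub>2\<close> of \<open>betti_kernel_bound\<close> for \<open>n = c + 3\<close> and \<open>b\<^sub>2 \<le> c (r + 1)\<close>.
\<close>

lemma kernel_doubles_betti:
  assumes P: "P \<in> FI" and r: "betti 1 p (sub P) = enat r" "threshold \<le> r"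
    and dual: "dual_system Fp (sub P) rk \<phi> g"
  shows "enat (2 * r) \<le> betti 1 p (sub (joint_kernel Fp (sub P) rk \<phi>))"
proof -
  interpret C: bar_complex_prime Fp "sub P" by (rule complex[OF FI_subgroup[OF P]])
  let ?N = "joint_kernel Fp (sub P) rk \<phi>"
  have "enat (rk * (r - rk)) \<le> betti 1 p (sub ?N) + betti 2 p (sub P)"
    using C.betti_kernel_bound[OF dual doubling_arith(1)[OF r(2)]] r(1) by (simp add: betti_def)
  also have "\<dots> \<le> betti 1 p (sub ?N) + enat (c * (r + 1))"
    using b2_le[OF P r(1)] by (rule add_left_mono)
  finally have "enat (c * (r + 1) + 2 * r) \<le> betti 1 p (sub ?N) + enat (c * (r + 1))"
    using doubling_arith(2)[OF r(2)] by (meson enat_ord_simps(1) order_trans)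
  then show ?thesis by (cases "betti 1 p (sub ?N)") auto
qed

lemma doubling_step:
  assumes P: "P \<in> FI" and big: "enat threshold \<le> betti 1 p (sub P)"
  shows "\<exists>P'. P' \<in> FI \<and> P' \<lhd> sub P \<and> subgroup_index G P' \<le> p ^ rk * subgroup_index G P \<and>
    2 * betti 1 p (sub P) \<le> betti 1 p (sub P')"
proof (cases "betti 1 p (sub P)")
  case infinity
  interpret P: group "sub P" by (rule subgroup_imp_group[OF FI_subgroup[OF P]])
  have "P \<lhd> sub P" using P.normal_self by simp
  moreover have "1 \<le> p ^ rk" using prime_gt_0_nat[OF prime_p] by simp
  then have "subgroup_index G P \<le> p ^ rk * subgroup_index G P" by simp
  ultimately show ?thesis using P infinity by (intro exI[of _ P]) simp
next
  case (enat r)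
  interpret C: bar_complex_prime Fp "sub P" by (rule complex[OF FI_subgroup[OF P]])
  have r: "threshold \<le> r" using big enat by simp
  have "enat rk \<le> edim Fp (group_homology 1 (sub P) Fp)"
    using doubling_arith(1)[OF r] enat by (simp add: betti_def)
  from C.card_characters_ge[OF this]
  have "\<not> (finite (characters Fp (sub P)) \<and> card (characters Fp (sub P)) < card (carrier Fp) ^ rk)"
    by linarith
  then obtain \<phi> g where dual: "dual_system Fp (sub P) rk \<phi> g"
    by (rule C.exists_dual_system[OF C.all_characters_space])
  let ?N = "joint_kernel Fp (sub P) rk \<phi>"
  have \<phi>: "\<phi> i \<in> characters Fp (sub P)" if "i < rk" for i using dual_systemD(1)[OF dual that] .
  note ker = joint_kernel_index[OF P \<phi>]
  have "2 * betti 1 p (sub P) \<le> betti 1 p (sub ?N)"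
    using kernel_doubles_betti[OF P enat r dual] enat by (simp add: numeral_eq_enat)
  then show ?thesis using ker by (intro exI[of _ ?N] conjI) auto
qed

text \<open>
  Induction downwards from \<open>H\<close>, phrased as minimality: as long as \<open>b\<^sub>1(N)\<close> is small and \<open>b\<^sub>1(P)\<close> is
  large, enough characters of \<open>P\<close> vanish on \<open>N\<close> for a doubling step that stays above \<open>N\<close>.
\<close>

lemma betti_finite_index_lower_bound:
  assumes H: "H \<in> FI" and N: "N \<in> FI" and NH: "N \<subseteq> H"
    and big: "enat (threshold + rk) \<le> betti 1 p (sub H)"
  shows "enat threshold \<le> betti 1 p (sub N)"
proof (rule ccontr)
  assume "\<not> enat threshold \<le> betti 1 p (sub N)"
  then obtain s where s: "betti 1 p (sub N) = enat s" "s < threshold"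
    by (cases "betti 1 p (sub N)") auto
  interpret N: bar_complex_prime Fp "sub N" by (rule complex[OF FI_subgroup[OF N]])
  have chN: "finite (characters Fp (sub N))" "card (characters Fp (sub N)) \<le> p ^ s"
    using N.card_characters_le[OF _ N.finite_K, of s] s(1) card_Fp by (simp_all add: betti_def)
  define S where "S = {P. subgroup P G \<and> N \<subseteq> P \<and> enat (threshold + rk) \<le> betti 1 p (sub P)}"
  have "finite S" using finite_intermediate_subgroups[OF N] by (rule finite_subset[rotated]) (auto simp: S_def)
  moreover have "H \<in> S" using H NH big FI_subgroup by (simp add: S_def)
  ultimately obtain P where PS: "P \<in> S" and minP: "\<And>Q. Q \<in> S \<Longrightarrow> Q \<subseteq> P \<Longrightarrow> Q = P"
    using finite_has_minimal[of S] by (metis empty_iff)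
  have Ps: "subgroup P G" and NP: "N \<subseteq> P" and bigP: "enat (threshold + rk) \<le> betti 1 p (sub P)"
    using PS by (auto simp: S_def)
  have P: "P \<in> FI" using finite_index_overgroup[OF N Ps NP] .
  interpret C: bar_complex_prime Fp "sub P" by (rule complex[OF Ps])
  let ?X = "{\<phi> \<in> characters Fp (sub P). \<forall>h\<in>N. \<phi> h = \<zero>\<^bsub>Fp\<^esub>}"
  have fX: "finite ?X" by (rule finite_vanishing_characters[OF N Ps NP])
  note chP = card_characters_restriction[OF FI_subgroup[OF N] Ps NP fX chN(1)]
  have p1: "1 < p" using prime_gt_1_nat[OF prime_p] .
  have ge: "p ^ r \<le> card (characters Fp (sub P))" if "enat r \<le> betti 1 p (sub P)" for r
    using C.card_characters_ge[OF _ chP(1), of r] that card_Fp by (simp add: betti_def)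
  \<comment> \<open>\<open>P\<close> has only finitely many characters, since \<open>N\<close> does and has finite index in \<open>P\<close>.\<close>
  obtain r where r: "betti 1 p (sub P) = enat r"
  proof (cases "betti 1 p (sub P)")
    case infinity
    let ?m = "card (characters Fp (sub P))"
    have "p ^ ?m \<le> ?m" using infinity by (intro ge) simp
    moreover have "?m < p ^ ?m" using p1 by (simp add: power_gt_expt)
    ultimately show ?thesis by simp
  qed
  \<comment> \<open>The restriction map has image of size at most \<open>p^s\<close> with \<open>s\<close> below the threshold, so its
    kernel is large.\<close>
  have many: "\<not> (finite ?X \<and> card ?X < card (carrier Fp) ^ rk)"
  proof
    assume "finite ?X \<and> card ?X < card (carrier Fp) ^ rk"
    then have "card ?X < p ^ rk" using card_Fp by simp
    then have "card (characters Fp (sub N)) * card ?X \<le> p ^ s * p ^ rk"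
      using chN(2) by (intro mult_mono) auto
    then have "p ^ (threshold + rk) \<le> p ^ (s + rk)"
      using ge[OF bigP] chP(2) by (simp only: power_add)
    then have "threshold + rk \<le> s + rk" using p1 by (rule power_le_imp_le_exp[rotated])
    then show False using s(2) by simp
  qed
  have space: "character_space Fp (sub P) ?X" using NP by (intro C.vanishing_characters_space) simp
  obtain \<phi> g where dual: "dual_system Fp (sub P) rk \<phi> g" and "\<forall>i<rk. \<phi> i \<in> ?X"
    by (rule C.exists_dual_system[OF space many])
  then have \<phi>X: "\<phi> i \<in> ?X" if "i < rk" for i using that by blast
  let ?Q = "joint_kernel Fp (sub P) rk \<phi>"
  have rr: "threshold \<le> r" "threshold + rk \<le> r" using bigP r by auto
  have "?Q \<lhd> sub P" using \<phi>X by (intro joint_kernel_index(1)[OF P]) auto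
  then have "subgroup ?Q G" using incl_subgroup[OF Ps] normal_imp_subgroup by blast
  moreover have "N \<subseteq> ?Q" using NP \<phi>X by (auto simp: joint_kernel_def)
  moreover have "enat (threshold + rk) \<le> betti 1 p (sub ?Q)"
    by (rule order_trans[OF _ kernel_doubles_betti[OF P r rr(1) dual]]) (use rr(2) in simp)
  ultimately have "?Q \<in> S" by (simp add: S_def)
  moreover have "?Q \<subseteq> P" by (auto simp: joint_kernel_def)
  ultimately have "?Q = P" by (rule minP)
  \<comment> \<open>\<open>g 0\<close> witnesses that the joint kernel is a proper subgroup of \<open>P\<close>.\<close>
  moreover have pos: "0 < rk" by (simp add: rk_def)
  have "\<phi> 0 (g 0) = \<one>\<^bsub>Fp\<^esub>" "g 0 \<in> P" using dual_systemD(2,3)[OF dual pos] pos by simp_all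
  moreover have "g 0 \<notin> ?Q" using pos calculation(2) by (auto simp: joint_kernel_def residue_ring_def)
  ultimately show False by simp
qed

text \<open>
  After the first step from \<open>G\<close> to the normal core of a subgroup with large \<open>b\<^sub>1\<close>, every step is a
  doubling step. The bounds are therefore shifted by one.
\<close>

lemma exponential_chain:
  assumes sup: "(SUP H \<in> FI. betti 1 p (sub H)) = \<infinity>"
  obtains Gs I where "Gs 0 = carrier G" "\<And>i. Gs i \<in> FI" "\<And>i. Gs (Suc i) \<lhd> sub (Gs i)"
    "\<And>i. enat (2 ^ i) \<le> betti 1 p (sub (Gs (Suc i)))"
    "\<And>i. subgroup_index G (Gs (Suc i)) \<le> p ^ (rk * i) * I"
proof -
  have "enat (threshold + rk) < (SUP H \<in> FI. betti 1 p (sub H))" using sup by simp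
  then obtain H where H: "H \<in> FI" "enat (threshold + rk) < betti 1 p (sub H)"
    by (auto simp: less_SUP_iff)
  obtain N where N: "N \<in> FI" "N \<lhd> G" "N \<subseteq> H" using normal_core_finite_index[OF H(1)] .
  have bN: "enat threshold \<le> betti 1 p (sub N)"
    using betti_finite_index_lower_bound[OF H(1) N(1,3)] H(2) by simp
  define good where "good i P \<longleftrightarrow> P \<in> FI \<and> enat threshold \<le> betti 1 p (sub P) \<and>
    enat (2 ^ i) \<le> betti 1 p (sub P) \<and> subgroup_index G P \<le> p ^ (rk * i) * subgroup_index G N" for i P
  have "enat 1 \<le> enat threshold" by (simp add: threshold_def rk_def algebra_simps)
  then have "enat 1 \<le> betti 1 p (sub N)" using bN by (rule order_trans)
  then have good0: "good 0 N" using N(1) bN unfolding good_def by simp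
  have step: "\<exists>P'. good (Suc i) P' \<and> P' \<lhd> sub P" if P: "good i P" for i P
  proof -
    have P': "P \<in> FI" "enat threshold \<le> betti 1 p (sub P)" using P by (auto simp: good_def)
    obtain P' where Q: "P' \<in> FI" "P' \<lhd> sub P" "subgroup_index G P' \<le> p ^ rk * subgroup_index G P"
      "2 * betti 1 p (sub P) \<le> betti 1 p (sub P')" using doubling_step[OF P'] by blast
    have "subgroup_index G P' \<le> p ^ rk * (p ^ (rk * i) * subgroup_index G N)"
      using Q(3) P unfolding good_def by (meson le_trans mult_le_mono2)
    also have "\<dots> = p ^ (rk * Suc i) * subgroup_index G N" by (simp add: power_add)
    finally have idx: "subgroup_index G P' \<le> p ^ (rk * Suc i) * subgroup_index G N" .
    have "enat threshold \<le> betti 1 p (sub P') \<and> enat (2 ^ Suc i) \<le> betti 1 p (sub P')"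
    proof (cases "betti 1 p (sub P)")
      case (enat r)
      then have "threshold \<le> r" "2 ^ i \<le> r" using P by (auto simp: good_def)
      moreover have "enat (2 * r) \<le> betti 1 p (sub P')" using Q(4) enat by (simp add: numeral_eq_enat)
      moreover from calculation have "threshold \<le> 2 * r" "2 ^ Suc i \<le> 2 * r" by auto
      ultimately show ?thesis by (meson enat_ord_simps(1) order_trans)
    next
      case infinity
      then have "betti 1 p (sub P') = \<infinity>" using Q(4) by (simp add: mult_2)
      then show ?thesis by simp
    qed
    then show ?thesis using Q idx by (auto simp: good_def)
  qed
  obtain F where F: "\<And>i. good i (F i)" "\<And>i. F (Suc i) \<lhd> sub (F i)" "F 0 = N"
  proof -
    have "\<exists>f. \<forall>i. (good i (f i) \<and> (i = 0 \<longrightarrow> f i = N)) \<and> f (Suc i) \<lhd> sub (f i)"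
      by (rule dependent_nat_choice[where Q = "\<lambda>i P P'. P' \<lhd> sub P"]) (use good0 step in auto)
    then show ?thesis using that by blast
  qed
  define Gs where "Gs i = (case i of 0 \<Rightarrow> carrier G | Suc j \<Rightarrow> F j)" for i
  show thesis
  proof (rule that[of Gs "subgroup_index G N"])
    show "Gs 0 = carrier G" by (simp add: Gs_def)
    show "Gs i \<in> FI" for i using carrier_finite_index F(1) by (auto simp: Gs_def good_def split: nat.split)
    show "Gs (Suc i) \<lhd> sub (Gs i)" for i using F N(2) by (simp add: Gs_def split: nat.split)
    show "enat (2 ^ i) \<le> betti 1 p (sub (Gs (Suc i)))" for i using F(1) by (simp add: Gs_def good_def)
    show "subgroup_index G (Gs (Suc i)) \<le> p ^ (rk * i) * subgroup_index G N" for i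
      using F(1) by (simp add: Gs_def good_def)
  qed
qed

end

text \<open>
  The exponent is chosen such that \<open>p^(n k) = \<surd>2\<close>. Then the quotient grows at least like
  \<open>2^i / \<surd>2^i = \<surd>2^i\<close>, up to a constant factor.
\<close>

lemma dominates_power_of_index:
  fixes b :: "nat \<Rightarrow> enat" and idx :: "nat \<Rightarrow> nat"
  assumes b: "\<And>i. enat (2 ^ i) \<le> b (Suc i)" and idx: "\<And>i. 0 < idx i" "\<And>i. idx (Suc i) \<le> p ^ (n * i) * I"
    and pn: "1 < p" "0 < n"
  shows "\<exists>k>0. dominates (\<lambda>i. ereal_of_enat (b i)) (\<lambda>i. ereal (real (idx i) powr k))"
proof -
  define k where "k = 1 / (2 * n * log 2 p)"
  have lp: "0 < log 2 p" using pn by simp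
  have k: "0 < k" using lp pn by (simp add: k_def)
  have I: "0 < I" using idx(1)[of 1] idx(2)[of 0] by simp
  have pk: "(real p ^ n) powr k = sqrt 2"
  proof -
    have "(real p ^ n) powr k = real p powr (n * k)" using pn by (simp add: powr_powr flip: powr_realpow)
    also have "\<dots> = (2 powr (log 2 p)) powr (n * k)" using pn by simp
    also have "\<dots> = 2 powr (log 2 p * (n * k))" by (rule powr_powr)
    also have "log 2 p * (n * k) = 1 / 2"
    proof -
      have "log 2 p \<noteq> 0" "real n \<noteq> 0" using lp pn by linarith+
      then show ?thesis unfolding k_def by (simp only: field_simps) simp
    qed
    finally show ?thesis by (simp add: powr_half_sqrt)
  qed
  have bound: "ereal (sqrt 2 ^ i / real I powr k) \<le> ereal_of_enat (b (Suc i)) / ereal (real (idx (Suc i)) powr k)" for i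
  proof -
    let ?x = "real (idx (Suc i))"
    have x: "0 < ?x" using idx(1)[of "Suc i"] by simp
    have "?x \<le> (real p ^ n) ^ i * real I"
      using idx(2)[of i] by (metis of_nat_le_iff of_nat_mult of_nat_power power_mult)
    then have "?x powr k \<le> ((real p ^ n) ^ i * real I) powr k" using x k by (intro powr_mono2) auto
    also have "\<dots> = ((real p ^ n) powr k) ^ i * real I powr k"
    proof -
      have "(a ^ i) powr k = (a powr k) ^ i" if "0 < a" for a :: real
        using that by (simp add: powr_powr mult.commute flip: powr_realpow)
      then show ?thesis using pn by (simp add: powr_mult)
    qed
    finally have "?x powr k \<le> sqrt 2 ^ i * real I powr k" by (simp only: pk)
    then have "(sqrt 2 ^ i / real I powr k) * ?x powr k \<le> (sqrt 2 ^ i / real I powr k) * (sqrt 2 ^ i * real I powr k)"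
      by (intro mult_left_mono) auto
    also have "\<dots> = 2 ^ i" using I by (simp flip: power_mult_distrib)
    finally have "sqrt 2 ^ i / real I powr k \<le> 2 ^ i / ?x powr k" using x by (simp add: le_divide_eq)
    then have "ereal (sqrt 2 ^ i / real I powr k) \<le> ereal_of_enat (enat (2 ^ i)) / ereal (?x powr k)" using x by simp
    also have "\<dots> \<le> ereal_of_enat (b (Suc i)) / ereal (?x powr k)"
      using b[of i] x by (intro ereal_divide_right_mono) (auto simp only: ereal_of_enat_le_iff, auto)
    finally show ?thesis .
  qed
  have "filterlim (\<lambda>i. sqrt 2 ^ i / real I powr k) at_top sequentially"
    using I by real_asymp
  then have lim: "(\<lambda>i. ereal (sqrt 2 ^ i / real I powr k)) \<longlonglongrightarrow> \<infinity>"
    by (simp add: tendsto_PInfty_eq_at_top)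
  have "(\<lambda>i. ereal_of_enat (b (Suc i)) / ereal (real (idx (Suc i)) powr k)) \<longlonglongrightarrow> \<infinity>"
    unfolding Lim_PInfty using lim[unfolded Lim_PInfty] bound by (meson order_trans)
  then have "dominates (\<lambda>i. ereal_of_enat (b i)) (\<lambda>i. ereal (real (idx i) powr k))"
    unfolding dominates_def by (subst filterlim_sequentially_Suc[symmetric])
  then show ?thesis using k by blast
qed

theorem theorem1p8:
  fixes G :: "'g monoid" and p :: nat
  assumes "prime p"
    and "finitely_generated_group G"
    and "b2_b1_property p G"
    and "(SUP H \<in> finite_index_subgroups G. betti 1 p (G\<lparr>carrier := H\<rparr>)) = \<infinity>"
  shows "\<exists>Gs :: nat \<Rightarrow> 'g set.
           Gs 0 = carrier G \<and>
           (\<forall>i. Gs i \<in> finite_index_subgroups G \<and> Gs (Suc i) \<lhd> (G\<lparr>carrier := Gs i\<rparr>)) \<and>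
           (\<exists>k::real. k > 0 \<and>
              dominates (\<lambda>i. ereal_of_enat (betti 1 p (G\<lparr>carrier := Gs i\<rparr>)))
                        (\<lambda>i. ereal (real (subgroup_index G (Gs i)) powr k)))"
proof -
  interpret group G using assms(2) by (simp add: finitely_generated_group_def)
  obtain C where C: "\<And>H. H \<in> finite_index_subgroups G \<Longrightarrow>
    ereal_of_enat (betti 2 p (G\<lparr>carrier := H\<rparr>)) / (ereal_of_enat (betti 1 p (G\<lparr>carrier := H\<rparr>)) + 1) \<le> ereal C"
    using assms(3) unfolding b2_b1_property_def by blast
  interpret linear_b2 G p "nat \<lceil>C\<rceil>"
  proof unfold_locales
    fix P r assume P: "P \<in> finite_index_subgroups G" and r: "betti 1 p (G\<lparr>carrier := P\<rparr>) = enat r"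
    have "C \<le> real (nat \<lceil>C\<rceil>)" by linarith
    with C[OF P, unfolded r] show "betti 2 p (G\<lparr>carrier := P\<rparr>) \<le> enat (nat \<lceil>C\<rceil> * (r + 1))"
      by (rule ereal_of_enat_quotient_bound)
  qed (rule assms(1))
  obtain Gs I where Gs: "Gs 0 = carrier G" "\<And>i. Gs i \<in> FI" "\<And>i. Gs (Suc i) \<lhd> sub (Gs i)"
    and growth: "\<And>i. enat (2 ^ i) \<le> betti 1 p (sub (Gs (Suc i)))"
      "\<And>i. subgroup_index G (Gs (Suc i)) \<le> p ^ (rk * i) * I"
    using exponential_chain[OF assms(4)] by blast
  have pos: "0 < subgroup_index G (Gs i)" for i
  proof -
    have "finite (rcosets\<^bsub>G\<^esub> (Gs i))" "Gs i \<in> rcosets\<^bsub>G\<^esub> (Gs i)"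
      using Gs(2)[of i] subgroup.subgroup_in_rcosets[OF FI_subgroup is_group] by (auto simp: finite_index_subgroups_def)
    then show ?thesis unfolding subgroup_index_def by (auto simp: card_gt_0_iff)
  qed
  have "0 < rk" by (simp add: rk_def)
  from dominates_power_of_index[where b = "\<lambda>i. betti 1 p (sub (Gs i))" and idx = "\<lambda>i. subgroup_index G (Gs i)",
      OF growth(1) pos growth(2) prime_gt_1_nat[OF assms(1)] this]
  show ?thesis using Gs by blast
qed

end
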